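(* For $n\ge 1$ let $\Lambda_{A_n}=KQ$ be the finite dimensional hereditary algebra given by the linearly oriented quiver $Q:\ \circ\to\circ\to\cdots\to\circ$ with $n$ vertices. Then the $\tau$-tilting simplicial complex $\Delta(\Lambda_{A_n})$ is isomorphic to the cone of the support $\tau$-tilting simplicial complex $\Delta(s\Lambda_{A_{n-1}})$.
   Context: $K$ is an algebraically closed field. For a finite dimensional basic $K$-algebra $\Lambda$, $\tau$ is the Auslander–Reiten translation; $M\in\mathrm{mod}\,\Lambda$ is $\tau$-rigid if $\mathrm{Hom}_\Lambda(M,\tau M)=0$. A pair $(M,P)$ with $M\in\mathrm{mod}\,\Lambda$ and $P$ finitely generated projective is a $\tau$-rigid pair if $M$ is $\tau$-rigid and $\mathrm{Hom}_\Lambda(P,M)=0$; it is indecomposable (basic) if $M\oplus P$ is. $\Delta(s\Lambda)$ (support $\tau$-tilting simplicial complex): vertices are isomorphism classes of indecomposable $\tau$-rigid pairs, simplices are isomorphism classes of basic $\tau$-rigid pairs (identified with their sets of indecomposable summands). $\Delta(\Lambda)$ ($\tau$-tilting simplicial complex): vertices are isomorphism classes of indecomposable $\tau$-rigid modules, simplices are isomorphism classes of basic $\tau$-rigid modules. The zero object is the empty simplex; for $n=1$, $\Lambda_{A_0}=0$ and $\Delta(s\Lambda_{A_0})=\{\emptyset\}$. The cone of a simplicial complex $L$ has as simplices all $\sigma$ and $\sigma\cup\{*\}$ for $\sigma$ a simplex of $L$ and $*$ a new vertex. *)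

theory Defs
  imports
    "HOL-Computational_Algebra.Polynomial"
    "Graph_Theory.Arc_Walk"
    "HOL-Algebra.Module"
    "HOL-Algebra.QuotRing"
begin

section \<open>Modules over noncommutative rings\<close>

text \<open>
  The locale \<open>module\<close> of HOL-Algebra requires a commutative ring of scalars. Here the ring is
  arbitrary. The record type is reused; as there, the fields \<open>mult\<close> and \<open>one\<close> of the module carry
  no meaning, and isomorphism below ignores them.
\<close>

locale left_module = R?: ring R + M?: abelian_group M
  for R (structure) and M :: "('a, 'b) module" (structure) +
  assumes smult_closed [simp, intro]:
      "\<lbrakk>a \<in> carrier R; x \<in> carrier M\<rbrakk> \<Longrightarrow> a \<odot>\<^bsub>M\<^esub> x \<in> carrier M"
    and smult_l_distr:
      "\<lbrakk>a \<in> carrier R; b \<in> carrier R; x \<in> carrier M\<rbrakk> \<Longrightarrow>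
        (a \<oplus> b) \<odot>\<^bsub>M\<^esub> x = a \<odot>\<^bsub>M\<^esub> x \<oplus>\<^bsub>M\<^esub> b \<odot>\<^bsub>M\<^esub> x"
    and smult_r_distr:
      "\<lbrakk>a \<in> carrier R; x \<in> carrier M; y \<in> carrier M\<rbrakk> \<Longrightarrow>
        a \<odot>\<^bsub>M\<^esub> (x \<oplus>\<^bsub>M\<^esub> y) = a \<odot>\<^bsub>M\<^esub> x \<oplus>\<^bsub>M\<^esub> a \<odot>\<^bsub>M\<^esub> y"
    and smult_assoc1:
      "\<lbrakk>a \<in> carrier R; b \<in> carrier R; x \<in> carrier M\<rbrakk> \<Longrightarrow>
        (a \<otimes> b) \<odot>\<^bsub>M\<^esub> x = a \<odot>\<^bsub>M\<^esub> (b \<odot>\<^bsub>M\<^esub> x)"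
    and smult_one [simp]:
      "x \<in> carrier M \<Longrightarrow> \<one> \<odot>\<^bsub>M\<^esub> x = x"

definition fin_gen_module :: "('a, 'r) ring_scheme \<Rightarrow> ('a, 'm) module \<Rightarrow> bool" where
  "fin_gen_module R M \<longleftrightarrow> left_module R M \<and>
     (\<exists>S. finite S \<and> S \<subseteq> carrier M \<and> (\<forall>N. submodule N R M \<and> S \<subseteq> N \<longrightarrow> N = carrier M))"

text \<open>Homomorphisms are extensional, so that they form a module when they should.\<close>

definition module_hom ::
  "('a, 'r) ring_scheme \<Rightarrow> ('a, 'm) module \<Rightarrow> ('a, 'n) module \<Rightarrow> ('m \<Rightarrow> 'n) set" where
  "module_hom R M N = {f \<in> hom (add_monoid M) (add_monoid N). f \<in> extensional (carrier M) \<and>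
     (\<forall>a\<in>carrier R. \<forall>x\<in>carrier M. f (a \<odot>\<^bsub>M\<^esub> x) = a \<odot>\<^bsub>N\<^esub> f x)}"

definition module_iso :: "('a, 'r) ring_scheme \<Rightarrow> ('a, 'm) module \<Rightarrow> ('a, 'n) module \<Rightarrow> bool" where
  "module_iso R M N \<longleftrightarrow> (\<exists>f\<in>module_hom R M N. bij_betw f (carrier M) (carrier N))"

definition hom_vanishes :: "('a, 'r) ring_scheme \<Rightarrow> ('a, 'm) module \<Rightarrow> ('a, 'n) module \<Rightarrow> bool" where
  "hom_vanishes R M N \<longleftrightarrow> (\<forall>f\<in>module_hom R M N. \<forall>x\<in>carrier M. f x = \<zero>\<^bsub>N\<^esub>)"

definition direct_sum :: "('a, 'm) module \<Rightarrow> ('a, 'n) module \<Rightarrow> ('a, 'm \<times> 'n) module" where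
  "direct_sum M N =
    \<lparr>carrier = carrier M \<times> carrier N,
     mult = (\<lambda>x y. (fst x \<otimes>\<^bsub>M\<^esub> fst y, snd x \<otimes>\<^bsub>N\<^esub> snd y)),
     one = (\<one>\<^bsub>M\<^esub>, \<one>\<^bsub>N\<^esub>),
     zero = (\<zero>\<^bsub>M\<^esub>, \<zero>\<^bsub>N\<^esub>),
     add = (\<lambda>x y. (fst x \<oplus>\<^bsub>M\<^esub> fst y, snd x \<oplus>\<^bsub>N\<^esub> snd y)),
     smult = (\<lambda>a x. (a \<odot>\<^bsub>M\<^esub> fst x, a \<odot>\<^bsub>N\<^esub> snd x))\<rparr>"

abbreviation sub_module :: "('a, 'm) module \<Rightarrow> 'm set \<Rightarrow> ('a, 'm) module" where
  "sub_module M A \<equiv> M\<lparr>carrier := A\<rparr>"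

definition direct_decomp ::
  "('a, 'r) ring_scheme \<Rightarrow> ('a, 'm) module \<Rightarrow> 'm set \<Rightarrow> 'm set \<Rightarrow> bool" where
  "direct_decomp R M A B \<longleftrightarrow> submodule A R M \<and> submodule B R M \<and>
     A \<inter> B = {\<zero>\<^bsub>M\<^esub>} \<and> A <+>\<^bsub>M\<^esub> B = carrier M"

definition direct_summand :: "('a, 'r) ring_scheme \<Rightarrow> ('a, 'm) module \<Rightarrow> 'm set \<Rightarrow> bool" where
  "direct_summand R M A \<longleftrightarrow> (\<exists>B. direct_decomp R M A B)"

definition indecomposable :: "('a, 'r) ring_scheme \<Rightarrow> ('a, 'm) module \<Rightarrow> bool" where
  "indecomposable R M \<longleftrightarrow> carrier M \<noteq> {\<zero>\<^bsub>M\<^esub>} \<and>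
     (\<forall>A B. direct_decomp R M A B \<longrightarrow> A = {\<zero>\<^bsub>M\<^esub>} \<or> B = {\<zero>\<^bsub>M\<^esub>})"

text \<open>
  No two of the indecomposable summands occurring together in a direct sum decomposition
  \<open>M = A \<oplus> (B \<oplus> C)\<close> are isomorphic.
\<close>

definition basic :: "('a, 'r) ring_scheme \<Rightarrow> ('a, 'm) module \<Rightarrow> bool" where
  "basic R M \<longleftrightarrow> (\<forall>A D B C. direct_decomp R M A D \<and> direct_decomp R (sub_module M D) B C \<and>
     indecomposable R (sub_module M A) \<and> indecomposable R (sub_module M B)
     \<longrightarrow> \<not> module_iso R (sub_module M A) (sub_module M B))"

text \<open>
  The lifting property, tested against modules whose carriers live in the same type as that of \<open>P\<close>.
\<close>

definition projective :: "('a, 'r) ring_scheme \<Rightarrow> ('a, 'm) module \<Rightarrow> bool" where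
  "projective R P \<longleftrightarrow> left_module R P \<and>
     (\<forall>(X :: ('a, 'm) module) (Y :: ('a, 'm) module). \<forall>g\<in>module_hom R X Y. \<forall>f\<in>module_hom R P Y.
        left_module R X \<and> left_module R Y \<and> g ` carrier X = carrier Y \<longrightarrow>
        (\<exists>h\<in>module_hom R P X. \<forall>x\<in>carrier P. g (h x) = f x))"

definition projective_cover ::
  "('a, 'r) ring_scheme \<Rightarrow> ('a, 'm) module \<Rightarrow> ('m \<Rightarrow> 'm) \<Rightarrow> ('a, 'm) module \<Rightarrow> bool" where
  "projective_cover R P p M \<longleftrightarrow> fin_gen_module R P \<and> projective R P \<and>
     p \<in> module_hom R P M \<and> p ` carrier P = carrier M \<and>
     (\<forall>N. submodule N R P \<and> N <+>\<^bsub>P\<^esub> a_kernel P M p = carrier P \<longrightarrow> N = carrier P)"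

definition minimal_presentation ::
  "('a, 'r) ring_scheme \<Rightarrow> ('a, 'm) module \<Rightarrow> ('m \<Rightarrow> 'm) \<Rightarrow> ('a, 'm) module \<Rightarrow> ('m \<Rightarrow> 'm)
   \<Rightarrow> ('a, 'm) module \<Rightarrow> bool" where
  "minimal_presentation R P1 f P0 p M \<longleftrightarrow>
     projective_cover R P0 p M \<and> projective_cover R P1 f (sub_module P0 (a_kernel P0 M p))"

definition quotient_module :: "('a, 'm) module \<Rightarrow> 'm set \<Rightarrow> ('a, 'm set) module" where
  "quotient_module M H =
    \<lparr>carrier = a_rcosets\<^bsub>M\<^esub> H,
     mult = rcoset_mult M H,
     one = H +>\<^bsub>M\<^esub> \<one>\<^bsub>M\<^esub>,
     zero = H,
     add = set_add M,
     smult = (\<lambda>a X. \<Union>x\<in>X. H +>\<^bsub>M\<^esub> (a \<odot>\<^bsub>M\<^esub> x))\<rparr>"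


section \<open>The Auslander--Reiten translation\<close>

text \<open>
  An algebra over the field \<^typ>\<open>'k::field\<close> is a record of type \<open>('k, 'l) module\<close>. Right modules
  are treated as left modules over the opposite algebra.
\<close>

definition regular_module :: "('k, 'l) module \<Rightarrow> ('l, 'l) module" where
  "regular_module \<Lambda> =
    \<lparr>carrier = carrier \<Lambda>, mult = mult \<Lambda>, one = \<one>\<^bsub>\<Lambda>\<^esub>, zero = \<zero>\<^bsub>\<Lambda>\<^esub>, add = add \<Lambda>,
     smult = mult \<Lambda>\<rparr>"

text \<open>\<open>Hom\<^sub>\<Lambda>(P, \<Lambda>)\<close> as a left module over the opposite algebra.\<close>

definition hom_to_regular :: "('k, 'l) module \<Rightarrow> ('l, 'm) module \<Rightarrow> ('l, 'm \<Rightarrow> 'l) module" where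
  "hom_to_regular \<Lambda> P =
    \<lparr>carrier = module_hom \<Lambda> P (regular_module \<Lambda>),
     mult = undefined,
     one = undefined,
     zero = (\<lambda>x\<in>carrier P. \<zero>\<^bsub>\<Lambda>\<^esub>),
     add = (\<lambda>\<phi> \<psi>. \<lambda>x\<in>carrier P. \<phi> x \<oplus>\<^bsub>\<Lambda>\<^esub> \<psi> x),
     smult = (\<lambda>a \<phi>. \<lambda>x\<in>carrier P. \<phi> x \<otimes>\<^bsub>\<Lambda>\<^esub> a)\<rparr>"

text \<open>
  \<open>D N = Hom\<^sub>K(N, K)\<close> for a left module \<open>N\<close> over the opposite algebra; it is a left \<open>\<Lambda>\<close>-module. The
  scalar \<open>c\<close> of the ground field acts on \<open>N\<close> through \<open>c \<cdot> 1\<^sub>\<Lambda>\<close>.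
\<close>

definition dual_module :: "('k::field, 'l) module \<Rightarrow> ('l, 'n) module \<Rightarrow> ('l, 'n \<Rightarrow> 'k) module" where
  "dual_module \<Lambda> N =
    \<lparr>carrier = {\<phi> \<in> extensional (carrier N).
        (\<forall>x\<in>carrier N. \<forall>y\<in>carrier N. \<phi> (x \<oplus>\<^bsub>N\<^esub> y) = \<phi> x + \<phi> y) \<and>
        (\<forall>c. \<forall>x\<in>carrier N. \<phi> ((c \<odot>\<^bsub>\<Lambda>\<^esub> \<one>\<^bsub>\<Lambda>\<^esub>) \<odot>\<^bsub>N\<^esub> x) = c * \<phi> x)},
     mult = undefined,
     one = undefined,
     zero = (\<lambda>x\<in>carrier N. 0),
     add = (\<lambda>\<phi> \<psi>. \<lambda>x\<in>carrier N. \<phi> x + \<psi> x),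
     smult = (\<lambda>a \<phi>. \<lambda>x\<in>carrier N. \<phi> (a \<odot>\<^bsub>N\<^esub> x))\<rparr>"

text \<open>The cokernel of \<open>Hom\<^sub>\<Lambda>(f, \<Lambda>) : Hom\<^sub>\<Lambda>(P0, \<Lambda>) \<rightarrow> Hom\<^sub>\<Lambda>(P1, \<Lambda>)\<close>, for \<open>f : P1 \<rightarrow> P0\<close>.\<close>

definition transpose_of ::
  "('k, 'l) module \<Rightarrow> ('l, 'm) module \<Rightarrow> ('m \<Rightarrow> 'm) \<Rightarrow> ('l, 'm) module
   \<Rightarrow> ('l, ('m \<Rightarrow> 'l) set) module" where
  "transpose_of \<Lambda> P1 f P0 = quotient_module (hom_to_regular \<Lambda> P1)
     ((\<lambda>\<phi>. compose (carrier P1) \<phi> f) ` carrier (hom_to_regular \<Lambda> P0))"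

text \<open>
  \<open>\<tau> M = D Tr M\<close>, where the transpose is computed from a chosen minimal projective presentation;
  any two choices give isomorphic modules. The presentation has its carriers in the same type as
  \<open>M\<close>, so this is only meaningful if that type is large enough to contain an isomorphic copy of
  every finite dimensional module.
\<close>

definition AR_translate ::
  "('k::field, 'l) module \<Rightarrow> ('l, 'm) module \<Rightarrow> ('l, ('m \<Rightarrow> 'l) set \<Rightarrow> 'k) module" where
  "AR_translate \<Lambda> M =
     (let (P1, f, P0, p) = (SOME (P1, f, P0, p). minimal_presentation \<Lambda> P1 f P0 p M)
      in dual_module \<Lambda> (transpose_of \<Lambda> P1 f P0))"

definition tau_rigid :: "('k::field, 'l) module \<Rightarrow> ('l, 'm) module \<Rightarrow> bool" where
  "tau_rigid \<Lambda> M \<longleftrightarrow> fin_gen_module \<Lambda> M \<and> hom_vanishes \<Lambda> M (AR_translate \<Lambda> M)"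

definition tau_rigid_pair ::
  "('k::field, 'l) module \<Rightarrow> ('l, 'm) module \<Rightarrow> ('l, 'm) module \<Rightarrow> bool" where
  "tau_rigid_pair \<Lambda> M P \<longleftrightarrow> tau_rigid \<Lambda> M \<and> fin_gen_module \<Lambda> P \<and> projective \<Lambda> P \<and>
     hom_vanishes \<Lambda> P M"


section \<open>Abstract simplicial complexes\<close>

text \<open>A complex is given by its set of vertices and its set of simplices, which include \<open>{}\<close>.\<close>

type_synonym 'v scomplex = "'v set \<times> 'v set set"

definition sc_isomorphic :: "'v scomplex \<Rightarrow> 'w scomplex \<Rightarrow> bool" where
  "sc_isomorphic L L' \<longleftrightarrow>
     (\<exists>f. bij_betw f (fst L) (fst L') \<and> (\<lambda>\<sigma>. f ` \<sigma>) ` snd L = snd L')"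

definition sc_cone :: "'v scomplex \<Rightarrow> 'v option scomplex" where
  "sc_cone L = (insert None (Some ` fst L),
     (\<lambda>\<sigma>. Some ` \<sigma>) ` snd L \<union> (\<lambda>\<sigma>. insert None (Some ` \<sigma>)) ` snd L)"


section \<open>The \<open>\<tau>\<close>-tilting and support \<open>\<tau>\<close>-tilting complexes\<close>

text \<open>
  For a finite dimensional algebra over \<^typ>\<open>'k::field\<close>, the finitely generated modules are the
  finite dimensional ones, and each of them is isomorphic to one whose carrier consists of the
  functions \<^typ>\<open>nat \<Rightarrow> 'k\<close> supported on \<open>{..<d}\<close>. Isomorphism classes are taken among the modules
  with carrier in this type.
\<close>

type_synonym ('k, 'l) umodule = "('l, nat \<Rightarrow> 'k) module"

definition iso_class :: "('k, 'l) module \<Rightarrow> ('k, 'l) umodule \<Rightarrow> ('k, 'l) umodule set" where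
  "iso_class \<Lambda> M = {N. left_module \<Lambda> N \<and> module_iso \<Lambda> M N}"

definition pair_iso_class ::
  "('k, 'l) module \<Rightarrow> ('k, 'l) umodule \<Rightarrow> ('k, 'l) umodule
   \<Rightarrow> (('k, 'l) umodule \<times> ('k, 'l) umodule) set" where
  "pair_iso_class \<Lambda> M P = iso_class \<Lambda> M \<times> iso_class \<Lambda> P"

definition tau_tilting_complex :: "('k::field, 'l) module \<Rightarrow> ('k, 'l) umodule set scomplex" where
  "tau_tilting_complex \<Lambda> =
    ({iso_class \<Lambda> M | M. tau_rigid \<Lambda> M \<and> indecomposable \<Lambda> M},
     {{iso_class \<Lambda> (sub_module M A) | A.
         direct_summand \<Lambda> M A \<and> indecomposable \<Lambda> (sub_module M A)}
      | M. tau_rigid \<Lambda> M \<and> basic \<Lambda> M})"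

definition support_tau_tilting_complex ::
  "('k::field, 'l) module \<Rightarrow> (('k, 'l) umodule \<times> ('k, 'l) umodule) set scomplex" where
  "support_tau_tilting_complex \<Lambda> =
    ({pair_iso_class \<Lambda> M P | M P. tau_rigid_pair \<Lambda> M P \<and> indecomposable \<Lambda> (direct_sum M P)},
     {{pair_iso_class \<Lambda> (sub_module M A) (sub_module P B) | A B.
         direct_summand \<Lambda> M A \<and> direct_summand \<Lambda> P B \<and>
         indecomposable \<Lambda> (direct_sum (sub_module M A) (sub_module P B))}
      | M P. tau_rigid_pair \<Lambda> M P \<and> basic \<Lambda> (direct_sum M P)})"


section \<open>Path algebras\<close>

text \<open>
  A path is a triple of its start, its list of arrows and its end. Products of paths are written
  like composites of maps, \<open>\<sigma> \<rho>\<close> meaning first \<open>\<rho>\<close> and then \<open>\<sigma>\<close>, so that left modules over the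
  path algebra are representations of the quiver.
\<close>

type_synonym ('v, 'e) path = "'v \<times> 'e list \<times> 'v"

definition paths :: "('v, 'e) pre_digraph \<Rightarrow> ('v, 'e) path set" where
  "paths Q = {(u, p, v). pre_digraph.awalk Q u p v}"

definition factorizations ::
  "('v, 'e) pre_digraph \<Rightarrow> ('v, 'e) path \<Rightarrow> (('v, 'e) path \<times> ('v, 'e) path) set" where
  "factorizations Q \<pi> = {((v, q, w), (u, p, v)) | u p v q w.
     (u, p, v) \<in> paths Q \<and> (v, q, w) \<in> paths Q \<and> \<pi> = (u, p @ q, w)}"

definition path_algebra ::
  "('v, 'e) pre_digraph \<Rightarrow> ('k::field, ('v, 'e) path \<Rightarrow> 'k) module" where
  "path_algebra Q =
    \<lparr>carrier = {x. finite {\<pi>. x \<pi> \<noteq> 0} \<and> {\<pi>. x \<pi> \<noteq> 0} \<subseteq> paths Q},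
     mult = (\<lambda>x y \<pi>. \<Sum>(\<sigma>, \<rho>)\<in>factorizations Q \<pi>. x \<sigma> * y \<rho>),
     one = (\<lambda>\<pi>. if \<exists>v\<in>verts Q. \<pi> = (v, [], v) then 1 else 0),
     zero = (\<lambda>\<pi>. 0),
     add = (\<lambda>x y \<pi>. x \<pi> + y \<pi>),
     smult = (\<lambda>c x \<pi>. c * x \<pi>)\<rparr>"

definition linear_quiver :: "nat \<Rightarrow> (nat, nat) pre_digraph" where
  "linear_quiver n = \<lparr>verts = {1..n}, arcs = {1..<n}, tail = (\<lambda>i. i), head = Suc\<rparr>"

definition algebra_A :: "nat \<Rightarrow> ('k::field, (nat, nat) path \<Rightarrow> 'k) module" where
  "algebra_A n = path_algebra (linear_quiver n)"

end

theory Submission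
  imports Defs
begin

text \<open>
  Every finitely generated module over \<open>\<Lambda>\<^bsub>A_n\<^esub>\<close> is a direct sum of interval modules. With half-open
  intervals, \<open>\<tau>\<close> shifts \<open>[a, b)\<close> to \<open>[a + 1, b + 1)\<close> if \<open>b \<le> n\<close> and kills the projective \<open>[a, n +
      1)\<close>.
  Hence a sum of interval modules is \<open>\<tau>\<close>-rigid iff no two of them satisfy
  \<open>a < c \<le> b < d\<close>, that is, iff the diagonals \<open>{a, b + 1}\<close> of an \<open>(n + 2)\<close>-gon do not cross. The
  interval \<open>[1, n + 1)\<close> is compatible with all others, so \<open>\<Delta>(\<Lambda>\<^bsub>A_n\<^esub>)\<close> is a cone with this apex. In the
  base of the cone, the intervals with \<open>b \<le> n\<close> are the \<open>\<tau>\<close>-rigid indecomposables of \<open>\<Lambda>\<^bsub>A_n-1\<^esub>\<close>, and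
  \<open>[c + 1, n + 1)\<close> plays the role of the pair \<open>(0, P c)\<close>: it crosses \<open>[a, b)\<close> iff \<open>a \<le> c < b\<close>,
      that is,
  iff \<open>Hom (P c, [a, b))\<close> is nonzero.
\<close>

section \<open>Homomorphisms and decompositions of modules\<close>

text \<open>All homomorphisms are built from one presentation: the interval \<open>[a, b)\<close>
  has a generator at \<open>a\<close> and the single relation that the path from \<open>a\<close> to
  \<open>b\<close> kills it. The path to \<open>n + 1\<close> is read as zero, so projectives are
  the case \<open>b = n + 1\<close> of the same construction. The equations satisfied by a generator
  also make sense for elements of an arbitrary module, and testing them there gives both halves of
  the Krull--Schmidt theorem without local endomorphism rings. The translate is defined through a
  chosen minimal presentation and lives in a type of functionals on cosets, so no isomorphism with
  the shifted interval is established. Instead, homomorphisms into the translate are analysed for an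
  arbitrary minimal presentation, which has to be brought into diagonal form beforehand. The class
  of a pair is a Cartesian product of isomorphism classes. A zero component contributes the class of
  the zero module, not the empty set, so these products remember both factors.\<close>

lemma module_hom_iff:
  "f \<in> module_hom R M N \<longleftrightarrow> f \<in> carrier M \<rightarrow> carrier N \<and> f \<in> extensional (carrier M) \<and>
     (\<forall>x\<in>carrier M. \<forall>y\<in>carrier M. f (x \<oplus>\<^bsub>M\<^esub> y) = f x \<oplus>\<^bsub>N\<^esub> f y) \<and>
     (\<forall>a\<in>carrier R. \<forall>x\<in>carrier M. f (a \<odot>\<^bsub>M\<^esub> x) = a \<odot>\<^bsub>N\<^esub> f x)"
  unfolding module_hom_def hom_def by auto

lemma module_homD:
  assumes "f \<in> module_hom R M N"
  shows "x \<in> carrier M \<Longrightarrow> f x \<in> carrier N"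
    and "x \<in> carrier M \<Longrightarrow> y \<in> carrier M \<Longrightarrow> f (x \<oplus>\<^bsub>M\<^esub> y) = f x \<oplus>\<^bsub>N\<^esub> f y"
    and "a \<in> carrier R \<Longrightarrow> x \<in> carrier M \<Longrightarrow> f (a \<odot>\<^bsub>M\<^esub> x) = a \<odot>\<^bsub>N\<^esub> f x"
    and "f \<in> extensional (carrier M)"
  using assms unfolding module_hom_iff by auto

lemma left_module_homI:
  assumes "left_module R M"
    and "\<And>x. x \<in> carrier M \<Longrightarrow> F x \<in> carrier N"
    and "\<And>x y. x \<in> carrier M \<Longrightarrow> y \<in> carrier M \<Longrightarrow> F (x \<oplus>\<^bsub>M\<^esub> y) = F x \<oplus>\<^bsub>N\<^esub> F y"
    and "\<And>a x. a \<in> carrier R \<Longrightarrow> x \<in> carrier M \<Longrightarrow> F (a \<odot>\<^bsub>M\<^esub> x) = a \<odot>\<^bsub>N\<^esub> F x"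
  shows "(\<lambda>x\<in>carrier M. F x) \<in> module_hom R M N"
proof -
  interpret left_module R M by fact
  show ?thesis using assms unfolding module_hom_iff by auto
qed

context left_module
begin

lemma smult_l_null [simp]: "x \<in> carrier M \<Longrightarrow> \<zero> \<odot>\<^bsub>M\<^esub> x = \<zero>\<^bsub>M\<^esub>"
  by (metis M.add.r_cancel_one' R.add.r_one R.zero_closed smult_closed smult_l_distr)

lemma smult_r_null [simp]: "a \<in> carrier R \<Longrightarrow> a \<odot>\<^bsub>M\<^esub> \<zero>\<^bsub>M\<^esub> = \<zero>\<^bsub>M\<^esub>"
  by (metis M.add.r_cancel_one' M.zero_closed M.r_zero smult_closed smult_r_distr)

lemma smult_minus_one: "x \<in> carrier M \<Longrightarrow> (\<ominus> \<one>) \<odot>\<^bsub>M\<^esub> x = \<ominus>\<^bsub>M\<^esub> x"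
proof -
  assume x: "x \<in> carrier M"
  have "(\<ominus> \<one>) \<odot>\<^bsub>M\<^esub> x \<oplus>\<^bsub>M\<^esub> x = (\<ominus> \<one> \<oplus> \<one>) \<odot>\<^bsub>M\<^esub> x"
    using x smult_l_distr[of "\<ominus> \<one>" \<one> x] by simp
  then show ?thesis
    using x by (simp add: R.l_neg M.minus_equality)
qed

text \<open>Negatives, which \<open>submodule\<close> asks for through \<open>subgroup\<close>,
  arise by acting with minus one.\<close>

lemma submoduleI:
  assumes "H \<subseteq> carrier M" "\<zero>\<^bsub>M\<^esub> \<in> H"
    and "\<And>x y. x \<in> H \<Longrightarrow> y \<in> H \<Longrightarrow> x \<oplus>\<^bsub>M\<^esub> y \<in> H"
    and sm: "\<And>a x. a \<in> carrier R \<Longrightarrow> x \<in> H \<Longrightarrow> a \<odot>\<^bsub>M\<^esub> x \<in> H"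
  shows "submodule H R M"
proof (intro submodule.intro subgroup.intro submodule_axioms.intro)
  show "inv\<^bsub>add_monoid M\<^esub> x \<in> H" if "x \<in> H" for x
    using sm[of "\<ominus> \<one>" x] that assms(1) smult_minus_one[of x] by (auto simp: a_inv_def)
qed (use assms in auto)

lemma carrier_submodule: "submodule (carrier M) R M"
  by (rule submoduleI) auto

lemma zero_submodule: "submodule {\<zero>\<^bsub>M\<^esub>} R M"
  by (rule submoduleI) auto

end

lemma submoduleD:
  assumes "submodule H R M"
  shows "x \<in> H \<Longrightarrow> x \<in> carrier M" "\<zero>\<^bsub>M\<^esub> \<in> H"
    and "x \<in> H \<Longrightarrow> y \<in> H \<Longrightarrow> x \<oplus>\<^bsub>M\<^esub> y \<in> H"
    and "a \<in> carrier R \<Longrightarrow> x \<in> H \<Longrightarrow> a \<odot>\<^bsub>M\<^esub> x \<in> H"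
    and "x \<in> H \<Longrightarrow> \<ominus>\<^bsub>M\<^esub> x \<in> H"
  using assms subgroup.one_closed[of H "add_monoid M"] subgroup.m_closed[of H "add_monoid M"]
    subgroup.m_inv_closed[of H "add_monoid M"] subgroup.subset[of H "add_monoid M"]
  unfolding submodule_def submodule_axioms_def by (auto simp: a_inv_def)

lemma left_moduleI:
  fixes R (structure) and M (structure)
  assumes "ring R" "\<And>x y. x \<in> carrier M \<Longrightarrow> y \<in> carrier M \<Longrightarrow> x \<oplus>\<^bsub>M\<^esub> y \<in> carrier M"
    "\<zero>\<^bsub>M\<^esub> \<in> carrier M"
    "\<And>x y z. x \<in> carrier M \<Longrightarrow> y \<in> carrier M \<Longrightarrow> z \<in> carrier M \<Longrightarrow>
       (x \<oplus>\<^bsub>M\<^esub> y) \<oplus>\<^bsub>M\<^esub> z = x \<oplus>\<^bsub>M\<^esub> (y \<oplus>\<^bsub>M\<^esub> z)"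
    "\<And>x y. x \<in> carrier M \<Longrightarrow> y \<in> carrier M \<Longrightarrow> x \<oplus>\<^bsub>M\<^esub> y = y \<oplus>\<^bsub>M\<^esub> x"
    "\<And>x. x \<in> carrier M \<Longrightarrow> \<zero>\<^bsub>M\<^esub> \<oplus>\<^bsub>M\<^esub> x = x"
    "\<And>x. x \<in> carrier M \<Longrightarrow> \<exists>y\<in>carrier M. y \<oplus>\<^bsub>M\<^esub> x = \<zero>\<^bsub>M\<^esub>"
    "\<And>a x. a \<in> carrier R \<Longrightarrow> x \<in> carrier M \<Longrightarrow> a \<odot>\<^bsub>M\<^esub> x \<in> carrier M"
    "\<And>a b x. a \<in> carrier R \<Longrightarrow> b \<in> carrier R \<Longrightarrow> x \<in> carrier M \<Longrightarrow>
        (a \<oplus> b) \<odot>\<^bsub>M\<^esub> x = a \<odot>\<^bsub>M\<^esub> x \<oplus>\<^bsub>M\<^esub> b \<odot>\<^bsub>M\<^esub> x"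
    "\<And>a x y. a \<in> carrier R \<Longrightarrow> x \<in> carrier M \<Longrightarrow> y \<in> carrier M \<Longrightarrow>
        a \<odot>\<^bsub>M\<^esub> (x \<oplus>\<^bsub>M\<^esub> y) = a \<odot>\<^bsub>M\<^esub> x \<oplus>\<^bsub>M\<^esub> a \<odot>\<^bsub>M\<^esub> y"
    "\<And>a b x. a \<in> carrier R \<Longrightarrow> b \<in> carrier R \<Longrightarrow> x \<in> carrier M \<Longrightarrow>
        (a \<otimes> b) \<odot>\<^bsub>M\<^esub> x = a \<odot>\<^bsub>M\<^esub> (b \<odot>\<^bsub>M\<^esub> x)"
    "\<And>x. x \<in> carrier M \<Longrightarrow> \<one> \<odot>\<^bsub>M\<^esub> x = x"
  shows "left_module R M"
  by (intro left_module.intro left_module_axioms.intro abelian_groupI) (use assms in auto)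

lemma submodule_left_module:
  assumes "left_module R M" "submodule H R M"
  shows "left_module R (sub_module M H)"
proof -
  interpret left_module R M by fact
  note S = submoduleD[OF assms(2)]
  show ?thesis
  proof (rule left_moduleI)
    fix x assume "x \<in> carrier (sub_module M H)"
    then show "\<exists>y\<in>carrier (sub_module M H). y \<oplus>\<^bsub>sub_module M H\<^esub> x = \<zero>\<^bsub>sub_module M H\<^esub>"
      using S(1,5) by (intro bexI[of _ "\<ominus>\<^bsub>M\<^esub> x"]) (auto simp: M.l_neg)
  qed (use S in \<open>auto simp: smult_l_distr smult_r_distr smult_assoc1 M.a_ac R.ring_axioms\<close>)
qed

lemma module_hom_zero:
  assumes "left_module R M" "left_module R N" "f \<in> module_hom R M N"
  shows "f \<zero>\<^bsub>M\<^esub> = \<zero>\<^bsub>N\<^esub>"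
proof -
  interpret M: left_module R M by fact
  interpret N: left_module R N by fact
  note f = module_homD[OF assms(3)]
  show ?thesis using f(3)[of "\<zero>\<^bsub>R\<^esub>" "\<zero>\<^bsub>M\<^esub>"] f(1)[of "\<zero>\<^bsub>M\<^esub>"] by auto
qed

lemma module_hom_neg:
  assumes "left_module R M" "left_module R N" "f \<in> module_hom R M N" "x \<in> carrier M"
  shows "f (\<ominus>\<^bsub>M\<^esub> x) = \<ominus>\<^bsub>N\<^esub> f x"
proof -
  interpret M: left_module R M by fact
  interpret N: left_module R N by fact
  note f = module_homD[OF assms(3)]
  show ?thesis
    using f(3)[of "\<ominus>\<^bsub>R\<^esub> \<one>\<^bsub>R\<^esub>" x] f(1)[of x] assms(4) M.smult_minus_one N.smult_minus_one by auto
qed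

lemma module_hom_compose:
  assumes "f \<in> module_hom R M N" "g \<in> module_hom R N L" "left_module R M"
  shows "compose (carrier M) g f \<in> module_hom R M L"
proof -
  interpret left_module R M by fact
  show ?thesis
    using module_homD[OF assms(1)] module_homD[OF assms(2)] unfolding module_hom_iff
    by (auto simp: compose_def)
qed

lemma module_hom_id: "left_module R M \<Longrightarrow> (\<lambda>x\<in>carrier M. x) \<in> module_hom R M M"
  by (rule left_module_homI) auto

lemma module_hom_into_sub:
  assumes "f \<in> module_hom R M N" "\<And>x. x \<in> carrier M \<Longrightarrow> f x \<in> H"
  shows "f \<in> module_hom R M (sub_module N H)"
  using assms unfolding module_hom_iff by auto

lemma module_hom_from_sub:
  assumes "f \<in> module_hom R M (sub_module N H)" "submodule H R N"
  shows "f \<in> module_hom R M N"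
  using assms(1) submoduleD(1)[OF assms(2)] unfolding module_hom_iff by (auto simp: Pi_iff)

lemma module_hom_image_submodule:
  assumes "left_module R M" "left_module R N" "f \<in> module_hom R M N" "submodule H R M"
  shows "submodule (f ` H) R N"
proof -
  interpret M: left_module R M by fact
  interpret N: left_module R N by fact
  note f = module_homD[OF assms(3)] note S = submoduleD[OF assms(4)]
  show ?thesis
  proof (rule N.submoduleI)
    show "\<zero>\<^bsub>N\<^esub> \<in> f ` H" using module_hom_zero[OF assms(1-3)] S(2) by force
    show "x \<oplus>\<^bsub>N\<^esub> y \<in> f ` H" if xy: "x \<in> f ` H" "y \<in> f ` H" for x y
    proof -
      obtain u v where "u \<in> H" "v \<in> H" "x = f u" "y = f v" using xy by blast
      then show ?thesis using f(2)[of u v] S(1,3) by (intro image_eqI[of _ _ "u \<oplus>\<^bsub>M\<^esub> v"]) auto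
    qed
    show "a \<odot>\<^bsub>N\<^esub> x \<in> f ` H" if ax: "a \<in> carrier R" "x \<in> f ` H" for a x
    proof -
      obtain u where "u \<in> H" "x = f u" using ax by blast
      then show ?thesis using f(3)[of a u] S(1,4) ax by (intro image_eqI[of _ _ "a \<odot>\<^bsub>M\<^esub> u"]) auto
    qed
  qed (use f S in auto)
qed

lemma module_hom_vimage_submodule:
  assumes "left_module R M" "left_module R N" "f \<in> module_hom R M N" "submodule H R N"
  shows "submodule {x \<in> carrier M. f x \<in> H} R M"
proof -
  interpret M: left_module R M by fact
  interpret N: left_module R N by fact
  note f = module_homD[OF assms(3)] note S = submoduleD[OF assms(4)]
  show ?thesis
    by (rule M.submoduleI) (use f S module_hom_zero[OF assms(1-3)] in auto)
qed

lemma module_hom_kernel_submodule: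
  assumes "left_module R M" "left_module R N" "f \<in> module_hom R M N"
  shows "submodule (a_kernel M N f) R M"
proof -
  interpret N: left_module R N by fact
  show ?thesis
    using module_hom_vimage_submodule[OF assms N.zero_submodule] by (simp add: a_kernel_def')
qed

text \<open>Lets two homomorphisms be compared on generators: once the equalizer contains a
  generating set, it is everything.\<close>

lemma module_hom_equalizer_submodule:
  assumes "left_module R M" "left_module R N" "f \<in> module_hom R M N" "g \<in> module_hom R M N"
  shows "submodule {x \<in> carrier M. f x = g x} R M"
proof -
  interpret M: left_module R M by fact
  interpret N: left_module R N by fact
  note f = module_homD[OF assms(3)] note g = module_homD[OF assms(4)]
  show ?thesis
    by (rule M.submoduleI) (use f g module_hom_zero[OF assms(1-3)]
      module_hom_zero[OF assms(1,2,4)] in auto)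
qed

lemma submodule_set_add:
  assumes "left_module R M" "submodule H R M" "submodule K R M"
  shows "submodule (H <+>\<^bsub>M\<^esub> K) R M"
proof -
  interpret left_module R M by fact
  note H = submoduleD[OF assms(2)] note K = submoduleD[OF assms(3)]
  have iff: "x \<in> H <+>\<^bsub>M\<^esub> K \<longleftrightarrow> (\<exists>h\<in>H. \<exists>k\<in>K. x = h \<oplus>\<^bsub>M\<^esub> k)" for x
    by (auto simp: set_add_def' )
  show ?thesis
  proof (rule submoduleI)
    show "H <+>\<^bsub>M\<^esub> K \<subseteq> carrier M" using H K by (auto simp: iff)
    show "\<zero>\<^bsub>M\<^esub> \<in> H <+>\<^bsub>M\<^esub> K" unfolding iff
      using H(2) K(2) by (intro bexI[of _ "\<zero>\<^bsub>M\<^esub>"]) auto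
  next
    fix x y assume "x \<in> H <+>\<^bsub>M\<^esub> K" "y \<in> H <+>\<^bsub>M\<^esub> K"
    then obtain h k h' k' where e: "h \<in> H" "k \<in> K" "x = h \<oplus>\<^bsub>M\<^esub> k" "h' \<in> H" "k' \<in> K" "y = h' \<oplus>\<^bsub>M\<^esub> k'"
      by (auto simp: iff)
    then have "x \<oplus>\<^bsub>M\<^esub> y = (h \<oplus>\<^bsub>M\<^esub> h') \<oplus>\<^bsub>M\<^esub> (k \<oplus>\<^bsub>M\<^esub> k')"
      using H(1) K(1) by (simp add: M.a_ac)
    then show "x \<oplus>\<^bsub>M\<^esub> y \<in> H <+>\<^bsub>M\<^esub> K" unfolding iff
      using H(3)[OF e(1,4)] K(3)[OF e(2,5)] by (intro bexI)
  next
    fix a x assume "a \<in> carrier R" "x \<in> H <+>\<^bsub>M\<^esub> K"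
    then obtain h k where "h \<in> H" "k \<in> K" "x = h \<oplus>\<^bsub>M\<^esub> k" "a \<in> carrier R" by (auto simp: iff)
    then show "a \<odot>\<^bsub>M\<^esub> x \<in> H <+>\<^bsub>M\<^esub> K" unfolding iff using H(1,4) K(1,4)
      by (intro bexI[of _ "a \<odot>\<^bsub>M\<^esub> h"] bexI[of _ "a \<odot>\<^bsub>M\<^esub> k"]) (auto simp: smult_r_distr)
  qed
qed

lemma module_hom_inj_iff:
  assumes "left_module R M" "left_module R N" "f \<in> module_hom R M N"
  shows "inj_on f (carrier M) \<longleftrightarrow> (\<forall>x\<in>carrier M. f x = \<zero>\<^bsub>N\<^esub> \<longrightarrow> x = \<zero>\<^bsub>M\<^esub>)"
proof -
  interpret M: left_module R M by fact
  interpret N: left_module R N by fact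
  note f = module_homD[OF assms(3)] note z = module_hom_zero[OF assms] and neg
      = module_hom_neg[OF assms]
  show ?thesis
  proof (intro iffI inj_onI ballI impI)
    fix x assume "inj_on f (carrier M)" "x \<in> carrier M" "f x = \<zero>\<^bsub>N\<^esub>"
    then show "x = \<zero>\<^bsub>M\<^esub>" using z by (metis M.zero_closed inj_onD)
  next
    fix x y assume K: "\<forall>x\<in>carrier M. f x = \<zero>\<^bsub>N\<^esub> \<longrightarrow> x = \<zero>\<^bsub>M\<^esub>"
      and xy: "x \<in> carrier M" "y \<in> carrier M" "f x = f y"
    then have "f (x \<oplus>\<^bsub>M\<^esub> \<ominus>\<^bsub>M\<^esub> y) = \<zero>\<^bsub>N\<^esub>" using f neg by (simp add: N.M.r_neg)
    then have "x \<oplus>\<^bsub>M\<^esub> \<ominus>\<^bsub>M\<^esub> y = \<zero>\<^bsub>M\<^esub>" using K xy by auto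
    then show "x = y" using xy by (metis M.M.add.inv_closed M.M.minus_equality M.M.minus_minus
        a_inv_def)
  qed
qed

lemma module_hom_inv:
  assumes "left_module R M" "left_module R N" "f \<in> module_hom R M N" "bij_betw f (carrier M)
      (carrier N)"
  defines "g \<equiv> (\<lambda>y\<in>carrier N. inv_into (carrier M) f y)"
  shows "g \<in> module_hom R N M" "bij_betw g (carrier N) (carrier M)"
    "x \<in> carrier M \<Longrightarrow> g (f x) = x" "y \<in> carrier N \<Longrightarrow> f (g y) = y"
proof -
  interpret M: left_module R M by fact
  interpret N: left_module R N by fact
  note f = module_homD[OF assms(3)]
  have inj: "inj_on f (carrier M)" and sur: "f ` carrier M = carrier N"
    using assms(4) by (auto simp: bij_betw_def)
  show gf: "g (f x) = x" if "x \<in> carrier M" for x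
    using that inj f(1) by (simp add: g_def)
  show fg: "f (g y) = y" if "y \<in> carrier N" for y
    using that sur by (simp add: g_def f_inv_into_f)
  have gc: "g y \<in> carrier M" if "y \<in> carrier N" for y
    using that sur by (simp add: g_def inv_into_into)
  show "bij_betw g (carrier N) (carrier M)"
    by (rule bij_betwI[where g = f]) (use gc gf fg f(1) in auto)
  have 1: "g (x \<oplus>\<^bsub>N\<^esub> y) = g x \<oplus>\<^bsub>M\<^esub> g y" if "x \<in> carrier N" "y \<in> carrier N" for x y
    using that gf[of "g x \<oplus>\<^bsub>M\<^esub> g y"] by (simp add: f gc fg)
  have 2: "g (a \<odot>\<^bsub>N\<^esub> x) = a \<odot>\<^bsub>M\<^esub> g x" if "x \<in> carrier N" "a \<in> carrier R" for x a
    using that gf[of "a \<odot>\<^bsub>M\<^esub> g x"] by (simp add: f gc fg)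
  show "g \<in> module_hom R N M"
    using gc 1 2 by (auto simp: module_hom_iff) (auto simp: g_def)
qed

lemma module_iso_refl: "left_module R M \<Longrightarrow> module_iso R M M"
  unfolding module_iso_def
  by (rule bexI[of _ "\<lambda>x\<in>carrier M. x"]) (auto simp: module_hom_id bij_betw_def inj_on_def)

lemma module_iso_sym:
  assumes "left_module R M" "left_module R N" "module_iso R M N"
  shows "module_iso R N M"
proof -
  obtain f where f: "f \<in> module_hom R M N" "bij_betw f (carrier M) (carrier N)"
    using assms(3) by (auto simp: module_iso_def)
  show ?thesis unfolding module_iso_def
    using module_hom_inv(1,2)[OF assms(1,2) f] by (intro bexI)
qed

lemma bij_betw_compose: "bij_betw f A B \<Longrightarrow> bij_betw g B C \<Longrightarrow> bij_betw (compose A g f) A C"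
  using bij_betw_trans[of f A B g C] by (simp add: compose_def cong: bij_betw_cong)

lemma module_iso_trans:
  assumes "module_iso R M N" "module_iso R N L" "left_module R M"
  shows "module_iso R M L"
proof -
  obtain f where f: "f \<in> module_hom R M N" "bij_betw f (carrier M) (carrier N)"
    using assms(1) by (auto simp: module_iso_def)
  obtain g where g: "g \<in> module_hom R N L" "bij_betw g (carrier N) (carrier L)"
    using assms(2) by (auto simp: module_iso_def)
  show ?thesis unfolding module_iso_def
    using module_hom_compose[OF f(1) g(1) assms(3)] bij_betw_compose[OF f(2) g(2)] by (intro bexI)
qed

lemma module_iso_image:
  assumes "left_module R M" "left_module R N" "f \<in> module_hom R M N" "inj_on f (carrier M)"
    "submodule H R M"
  shows "module_iso R (sub_module M H) (sub_module N (f ` H))"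
proof -
  interpret left_module R M by fact
  note f = module_homD[OF assms(3)] note S = submoduleD[OF assms(5)]
  have "(\<lambda>x\<in>carrier (sub_module M H). f x) \<in> module_hom R (sub_module M H) (sub_module N (f ` H))"
    by (rule left_module_homI[OF submodule_left_module[OF assms(1,5)]]) (use f S in auto)
  moreover have "inj_on f H" using assms(4) S(1) by (meson inj_on_subset subsetI)
  then have "bij_betw (\<lambda>x\<in>carrier (sub_module M H). f x) H (f ` H)"
    by (auto simp: bij_betw_def inj_on_def)
  ultimately show ?thesis unfolding module_iso_def by (intro bexI) simp_all
qed

section \<open>Internal direct decompositions\<close>

lemma direct_decomp_iff:
  assumes "left_module R M"
  shows "direct_decomp R M A B \<longleftrightarrow> submodule A R M \<and> submodule B R M \<and>
     A \<inter> B \<subseteq> {\<zero>\<^bsub>M\<^esub>} \<and> (\<forall>x\<in>carrier M. \<exists>a\<in>A. \<exists>b\<in>B. x = a \<oplus>\<^bsub>M\<^esub> b)"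
proof -
  interpret left_module R M by fact
  have "A \<inter> B = {\<zero>\<^bsub>M\<^esub>} \<longleftrightarrow> A \<inter> B \<subseteq> {\<zero>\<^bsub>M\<^esub>}" if "submodule A R M" "submodule B R M"
    using submoduleD(2)[OF that(1)] submoduleD(2)[OF that(2)] by auto
  moreover have "A <+>\<^bsub>M\<^esub> B = carrier M \<longleftrightarrow> (\<forall>x\<in>carrier M. \<exists>a\<in>A. \<exists>b\<in>B. x = a \<oplus>\<^bsub>M\<^esub> b)"
    if "submodule A R M" "submodule B R M"
  proof -
    have "A <+>\<^bsub>M\<^esub> B \<subseteq> carrier M"
      using submoduleD(1)[OF that(1)] submoduleD(1)[OF that(2)] by (auto simp: set_add_def')
    moreover have "x \<in> A <+>\<^bsub>M\<^esub> B \<longleftrightarrow> (\<exists>a\<in>A. \<exists>b\<in>B. x = a \<oplus>\<^bsub>M\<^esub> b)" for x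
      by (auto simp: set_add_def')
    ultimately show ?thesis by (auto 0 3)
  qed
  ultimately show ?thesis unfolding direct_decomp_def by auto
qed

lemma direct_decomp_sym:
  assumes "left_module R M" "direct_decomp R M A B"
  shows "direct_decomp R M B A"
proof -
  interpret left_module R M by fact
  have dd: "submodule A R M" "submodule B R M" "A \<inter> B \<subseteq> {\<zero>\<^bsub>M\<^esub>}"
    "\<And>x. x \<in> carrier M \<Longrightarrow> \<exists>a\<in>A. \<exists>b\<in>B. x = a \<oplus>\<^bsub>M\<^esub> b"
    using assms(2) unfolding direct_decomp_iff[OF assms(1)] by auto
  have "\<exists>b\<in>B. \<exists>a\<in>A. x = b \<oplus>\<^bsub>M\<^esub> a" if x: "x \<in> carrier M" for x
  proof -
    obtain a b where "a \<in> A" "b \<in> B" "x = a \<oplus>\<^bsub>M\<^esub> b" using dd(4)[OF x] by blast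
    then show ?thesis
      using submoduleD(1)[OF dd(1)] submoduleD(1)[OF dd(2)] M.a_comm[of a b]
      by (intro bexI[of _ b] bexI[of _ a]) auto
  qed
  then show ?thesis
    unfolding direct_decomp_iff[OF assms(1)] using dd by auto
qed

text \<open>Because the summands meet trivially, the component in \<open>A\<close> is unique;
  components picked by \<open>SOME\<close> are therefore automatically additive and linear.\<close>

lemma direct_decomp_projection:
  assumes "left_module R M" "direct_decomp R M A B"
  obtains r where "r \<in> module_hom R M (sub_module M A)" "\<And>x. x \<in> A \<Longrightarrow> r x = x"
    "\<And>x. x \<in> B \<Longrightarrow> r x = \<zero>\<^bsub>M\<^esub>"
proof -
  interpret left_module R M by fact
  have dd: "submodule A R M" "submodule B R M" "A \<inter> B \<subseteq> {\<zero>\<^bsub>M\<^esub>}"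
    "\<And>x. x \<in> carrier M \<Longrightarrow> \<exists>a\<in>A. \<exists>b\<in>B. x = a \<oplus>\<^bsub>M\<^esub> b"
    using assms(2) unfolding direct_decomp_iff[OF assms(1)] by auto
  note A = submoduleD[OF dd(1)] note B = submoduleD[OF dd(2)]
  have uniq: "a = a'" if h: "a \<in> A" "a' \<in> A" "b \<in> B" "b' \<in> B" "a \<oplus>\<^bsub>M\<^esub> b = a' \<oplus>\<^bsub>M\<^esub> b'" for a a' b b'
  proof -
    note c = A(1)[OF h(1)] A(1)[OF h(2)] B(1)[OF h(3)] B(1)[OF h(4)]
    \<comment> \<open>\<open>a - a'\<close> is rewritten as \<open>b' - b\<close>, which places it
      in both summands.\<close>
    have "a \<oplus>\<^bsub>M\<^esub> \<ominus>\<^bsub>M\<^esub> a' = (a \<oplus>\<^bsub>M\<^esub> b) \<oplus>\<^bsub>M\<^esub> (\<ominus>\<^bsub>M\<^esub> b \<oplus>\<^bsub>M\<^esub> \<ominus>\<^bsub>M\<^esub> a')"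
    proof -
      have "(a \<oplus>\<^bsub>M\<^esub> b) \<oplus>\<^bsub>M\<^esub> (\<ominus>\<^bsub>M\<^esub> b \<oplus>\<^bsub>M\<^esub> \<ominus>\<^bsub>M\<^esub> a') = a \<oplus>\<^bsub>M\<^esub> (b \<oplus>\<^bsub>M\<^esub> (\<ominus>\<^bsub>M\<^esub> b \<oplus>\<^bsub>M\<^esub> \<ominus>\<^bsub>M\<^esub> a'))"
        using c by (intro M.a_assoc) auto
      then show ?thesis using c by (simp add: M.r_neg2)
    qed
    also have "\<dots> = b' \<oplus>\<^bsub>M\<^esub> \<ominus>\<^bsub>M\<^esub> b"
    proof -
      have "(a \<oplus>\<^bsub>M\<^esub> b) \<oplus>\<^bsub>M\<^esub> (\<ominus>\<^bsub>M\<^esub> b \<oplus>\<^bsub>M\<^esub> \<ominus>\<^bsub>M\<^esub> a') = (b' \<oplus>\<^bsub>M\<^esub> a') \<oplus>\<^bsub>M\<^esub> (\<ominus>\<^bsub>M\<^esub> a' \<oplus>\<^bsub>M\<^esub> \<ominus>\<^bsub>M\<^esub> b)"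
        unfolding h(5) using c by (simp add: M.a_comm)
      also have "\<dots> = b' \<oplus>\<^bsub>M\<^esub> (a' \<oplus>\<^bsub>M\<^esub> (\<ominus>\<^bsub>M\<^esub> a' \<oplus>\<^bsub>M\<^esub> \<ominus>\<^bsub>M\<^esub> b))"
        using c by (intro M.a_assoc) auto
      finally show ?thesis using c by (simp add: M.r_neg2)
    qed
    finally have "a \<oplus>\<^bsub>M\<^esub> \<ominus>\<^bsub>M\<^esub> a' \<in> A \<inter> B"
      using A(3)[OF h(1) A(5)[OF h(2)]] B(3)[OF h(4) B(5)[OF h(3)]] by auto
    then have "a \<oplus>\<^bsub>M\<^esub> \<ominus>\<^bsub>M\<^esub> a' = \<zero>\<^bsub>M\<^esub>" using dd(3) by auto
    then show ?thesis using c by (metis M.add.inv_closed M.minus_equality M.minus_minus)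
  qed
  define F where "F x = (SOME a. a \<in> A \<and> (\<exists>b\<in>B. x = a \<oplus>\<^bsub>M\<^esub> b))" for x
  have F: "F x \<in> A" "\<exists>b\<in>B. x = F x \<oplus>\<^bsub>M\<^esub> b" if "x \<in> carrier M" for x
  proof -
    have "\<exists>a. a \<in> A \<and> (\<exists>b\<in>B. x = a \<oplus>\<^bsub>M\<^esub> b)" using dd(4)[OF that] by blast
    from someI_ex[OF this] show "F x \<in> A" "\<exists>b\<in>B. x = F x \<oplus>\<^bsub>M\<^esub> b" unfolding F_def by blast+
  qed
  have Feq: "F (a \<oplus>\<^bsub>M\<^esub> b) = a" if ab: "a \<in> A" "b \<in> B" for a b
  proof -
    have c: "a \<oplus>\<^bsub>M\<^esub> b \<in> carrier M" using ab A(1) B(1) by auto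
    obtain b' where "b' \<in> B" "a \<oplus>\<^bsub>M\<^esub> b = F (a \<oplus>\<^bsub>M\<^esub> b) \<oplus>\<^bsub>M\<^esub> b'" using F(2)[OF c] by blast
    from uniq[OF ab(1) F(1)[OF c] ab(2) this] show ?thesis by simp
  qed
  have add: "F (x \<oplus>\<^bsub>M\<^esub> y) = F x \<oplus>\<^bsub>M\<^esub> F y" if xy: "x \<in> carrier M" "y \<in> carrier M" for x y
  proof -
    obtain b b' where b: "b \<in> B" "x = F x \<oplus>\<^bsub>M\<^esub> b" "b' \<in> B" "y = F y \<oplus>\<^bsub>M\<^esub> b'"
      using F(2)[OF xy(1)] F(2)[OF xy(2)] by blast
    note c = A(1)[OF F(1)[OF xy(1)]] A(1)[OF F(1)[OF xy(2)]] B(1)[OF b(1)] B(1)[OF b(3)]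
    have "x \<oplus>\<^bsub>M\<^esub> y = (F x \<oplus>\<^bsub>M\<^esub> b) \<oplus>\<^bsub>M\<^esub> (F y \<oplus>\<^bsub>M\<^esub> b')"
      using b(2,4) by (rule arg_cong2)
    also have "\<dots> = (F x \<oplus>\<^bsub>M\<^esub> F y) \<oplus>\<^bsub>M\<^esub> (b \<oplus>\<^bsub>M\<^esub> b')" using c by (simp add: M.a_ac)
    finally show ?thesis using Feq[OF A(3)[OF F(1)[OF xy(1)] F(1)[OF xy(2)]] B(3)[OF b(1,3)]]
        by metis
  qed
  have sm: "F (a \<odot>\<^bsub>M\<^esub> x) = a \<odot>\<^bsub>M\<^esub> F x" if xy: "x \<in> carrier M" "a \<in> carrier R" for x a
  proof -
    obtain b where b: "b \<in> B" "x = F x \<oplus>\<^bsub>M\<^esub> b" using F(2)[OF xy(1)] by blast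
    have "a \<odot>\<^bsub>M\<^esub> x = a \<odot>\<^bsub>M\<^esub> (F x \<oplus>\<^bsub>M\<^esub> b)" using b(2) by (rule arg_cong)
    also have "\<dots> = a \<odot>\<^bsub>M\<^esub> F x \<oplus>\<^bsub>M\<^esub> a \<odot>\<^bsub>M\<^esub> b"
      using smult_r_distr[OF xy(2) A(1)[OF F(1)[OF xy(1)]] B(1)[OF b(1)]] .
    finally show ?thesis using Feq[OF A(4)[OF xy(2) F(1)[OF xy(1)]] B(4)[OF xy(2) b(1)]] by metis
  qed
  have "(\<lambda>x\<in>carrier M. F x) \<in> module_hom R M (sub_module M A)"
    by (rule left_module_homI[OF assms(1)]) (use F add sm in auto)
  moreover have "F x = x" if "x \<in> A" for x
    using Feq[OF that B(2)] A(1)[OF that] by simp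
  moreover have "F x = \<zero>\<^bsub>M\<^esub>" if "x \<in> B" for x
    using Feq[OF A(2) that] B(1)[OF that] by simp
  ultimately show thesis using that[of "\<lambda>x\<in>carrier M. F x"] A(1) B(1) by auto
qed

lemma direct_decomp_transport:
  assumes "left_module R M" "left_module R N" "f \<in> module_hom R M N"
    "bij_betw f (carrier M) (carrier N)" "direct_decomp R M A B"
  shows "direct_decomp R N (f ` A) (f ` B)"
proof -
  interpret M: left_module R M by fact
  have dd: "submodule A R M" "submodule B R M" "A \<inter> B \<subseteq> {\<zero>\<^bsub>M\<^esub>}"
    "\<And>x. x \<in> carrier M \<Longrightarrow> \<exists>a\<in>A. \<exists>b\<in>B. x = a \<oplus>\<^bsub>M\<^esub> b"
    using assms(5) unfolding direct_decomp_iff[OF assms(1)] by auto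
  note A = submoduleD[OF dd(1)] note B = submoduleD[OF dd(2)]
  note f = module_homD[OF assms(3)]
  show ?thesis unfolding direct_decomp_iff[OF assms(2)]
  proof (intro conjI ballI)
    show "submodule (f ` A) R N" "submodule (f ` B) R N"
      using module_hom_image_submodule[OF assms(1-3)] dd by auto
    have "f ` A \<inter> f ` B = f ` (A \<inter> B)"
      using assms(4) A(1) B(1) by (intro inj_on_image_Int[symmetric, of _ "carrier M"]) (auto
          simp: bij_betw_def)
    also have "\<dots> \<subseteq> {\<zero>\<^bsub>N\<^esub>}" using dd(3) module_hom_zero[OF assms(1-3)] by auto
    finally show "f ` A \<inter> f ` B \<subseteq> {\<zero>\<^bsub>N\<^esub>}" .
    fix y assume "y \<in> carrier N"
    then obtain x where x: "x \<in> carrier M" "y = f x" using assms(4) by (auto simp: bij_betw_def)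
    then obtain a b where "a \<in> A" "b \<in> B" "x = a \<oplus>\<^bsub>M\<^esub> b" using dd(4) by metis
    then show "\<exists>a\<in>f ` A. \<exists>b\<in>f ` B. y = a \<oplus>\<^bsub>N\<^esub> b"
      using x f(2) A(1) B(1) by (intro bexI[of _ "f a"] bexI[of _ "f b"]) auto
  qed
qed

lemma indecomposable_iso_imp:
  assumes M: "left_module R M" and N: "left_module R N" and "module_iso R M N" "indecomposable R M"
  shows "indecomposable R N"
proof -
  obtain f where f: "f \<in> module_hom R M N" "bij_betw f (carrier M) (carrier N)"
    using assms(3) by (auto simp: module_iso_def)
  define g where "g = (\<lambda>y\<in>carrier N. inv_into (carrier M) f y)"
  note g = module_hom_inv[OF M N f, folded g_def]
  note fz = module_hom_zero[OF M N f(1)] and gz = module_hom_zero[OF N M g(1)]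
  have "carrier N \<noteq> {\<zero>\<^bsub>N\<^esub>}"
  proof
    assume "carrier N = {\<zero>\<^bsub>N\<^esub>}"
    then have "carrier M = {\<zero>\<^bsub>M\<^esub>}" using g(2) gz by (auto simp: bij_betw_def)
    then show False using assms(4) by (simp add: indecomposable_def)
  qed
  moreover have "A = {\<zero>\<^bsub>N\<^esub>} \<or> B = {\<zero>\<^bsub>N\<^esub>}" if dd: "direct_decomp R N A B" for A B
  proof -
    have "submodule A R N" "submodule B R N" using dd by (simp_all add: direct_decomp_def)
    then have sub: "A \<subseteq> carrier N" "B \<subseteq> carrier N"
      using submoduleD(1)[of A R N] submoduleD(1)[of B R N] by auto
    have "g ` A = {\<zero>\<^bsub>M\<^esub>} \<or> g ` B = {\<zero>\<^bsub>M\<^esub>}"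
      using direct_decomp_transport[OF N M g(1,2) dd] assms(4)
      unfolding indecomposable_def by simp
    moreover have "C = {\<zero>\<^bsub>N\<^esub>}" if "g ` C = {\<zero>\<^bsub>M\<^esub>}" "C \<subseteq> carrier N" for C
    proof -
      have "f ` g ` C = (\<lambda>y. y) ` C" unfolding image_image
        by (rule image_cong) (use g(4) that(2) in auto)
      then show ?thesis unfolding that(1) using fz by simp
    qed
    ultimately show ?thesis using sub by blast
  qed
  ultimately show ?thesis by (auto simp: indecomposable_def)
qed

lemma indecomposable_iso:
  assumes "left_module R M" "left_module R N" "module_iso R M N"
  shows "indecomposable R M \<longleftrightarrow> indecomposable R N"
  using indecomposable_iso_imp[OF assms]
    indecomposable_iso_imp[OF assms(2,1) module_iso_sym[OF assms]] by blast

section \<open>Finite generation and external direct sums\<close>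

lemma fin_gen_module_surj:
  assumes "fin_gen_module R M" "left_module R N" "f \<in> module_hom R M N" "f ` carrier M = carrier N"
  shows "fin_gen_module R N"
proof -
  obtain S where S: "finite S" "S \<subseteq> carrier M" "\<And>H. submodule H R M \<Longrightarrow> S \<subseteq> H \<Longrightarrow> H = carrier M"
    and M: "left_module R M" using assms(1) unfolding fin_gen_module_def by auto
  have "H = carrier N" if "submodule H R N" "f ` S \<subseteq> H" for H
  proof -
    have "{x \<in> carrier M. f x \<in> H} = carrier M"
      using S(2) that(2) by (intro S(3) module_hom_vimage_submodule[OF M assms(2,3) that(1)]) auto
    then have "carrier N \<subseteq> H" using assms(4) by force
    then show ?thesis using submoduleD(1)[OF that(1)] by auto
  qed
  then show ?thesis unfolding fin_gen_module_def
    using assms(2,4) S by (intro conjI exI[of _ "f ` S"]) auto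
qed

text \<open>A summand is the image of \<open>M\<close> under the projection along its complement,
  and finite generation passes to images.\<close>

lemma fin_gen_module_summand:
  assumes "fin_gen_module R M" "direct_decomp R M A B"
  shows "fin_gen_module R (sub_module M A)"
proof -
  have M: "left_module R M" using assms(1) by (simp add: fin_gen_module_def)
  obtain r where r: "r \<in> module_hom R M (sub_module M A)" "\<And>x. x \<in> A \<Longrightarrow> r x = x"
    using direct_decomp_projection[OF M assms(2)] by metis
  have A: "submodule A R M" using assms(2) by (simp add: direct_decomp_def)
  have "r ` carrier M = carrier (sub_module M A)"
    using module_homD(1)[OF r(1)] r(2) submoduleD(1)[OF A] by force
  then show ?thesis
    using fin_gen_module_surj[OF assms(1) submodule_left_module[OF M A] r(1)] by blast
qed

lemma direct_sum_left_module:
  assumes "left_module R M" "left_module R N"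
  shows "left_module R (direct_sum M N)"
proof -
  interpret M: left_module R M by fact
  interpret N: left_module R N by fact
  show ?thesis
  proof (rule left_moduleI)
    fix x assume "x \<in> carrier (direct_sum M N)"
    then show "\<exists>y\<in>carrier (direct_sum M N). y \<oplus>\<^bsub>direct_sum M N\<^esub> x = \<zero>\<^bsub>direct_sum M N\<^esub>"
      by (intro bexI[of _ "(\<ominus>\<^bsub>M\<^esub> fst x, \<ominus>\<^bsub>N\<^esub> snd x)"]) (auto simp: direct_sum_def M.M.l_neg N.M.l_neg)
  qed (auto simp: direct_sum_def M.M.a_ac N.M.a_ac M.R.ring_axioms
      M.smult_l_distr N.smult_l_distr M.smult_r_distr N.smult_r_distr M.smult_assoc1 N.smult_assoc1)
qed

lemma direct_sum_simps [simp]: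
  "carrier (direct_sum M N) = carrier M \<times> carrier N"
  "\<zero>\<^bsub>direct_sum M N\<^esub> = (\<zero>\<^bsub>M\<^esub>, \<zero>\<^bsub>N\<^esub>)"
  "x \<oplus>\<^bsub>direct_sum M N\<^esub> y = (fst x \<oplus>\<^bsub>M\<^esub> fst y, snd x \<oplus>\<^bsub>N\<^esub> snd y)"
  "a \<odot>\<^bsub>direct_sum M N\<^esub> x = (a \<odot>\<^bsub>M\<^esub> fst x, a \<odot>\<^bsub>N\<^esub> snd x)"
  by (auto simp: direct_sum_def)

lemma direct_sum_zero_right:
  assumes "left_module R M" "left_module R N" "carrier N = {\<zero>\<^bsub>N\<^esub>}"
  shows "module_iso R (direct_sum M N) M"
proof -
  interpret N: left_module R N by fact
  have "(\<lambda>x\<in>carrier (direct_sum M N). fst x) \<in> module_hom R (direct_sum M N) M"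
    by (rule left_module_homI[OF direct_sum_left_module[OF assms(1,2)]]) auto
  moreover have "bij_betw (\<lambda>x\<in>carrier (direct_sum M N). fst x) (carrier (direct_sum M N)) (carrier
      M)"
    by (rule bij_betwI[where g = "\<lambda>x. (x, \<zero>\<^bsub>N\<^esub>)"]) (use assms(3) in auto)
  ultimately show ?thesis unfolding module_iso_def by (intro bexI)
qed

lemma direct_sum_zero_left:
  assumes "left_module R M" "left_module R N" "carrier M = {\<zero>\<^bsub>M\<^esub>}"
  shows "module_iso R (direct_sum M N) N"
proof -
  interpret M: left_module R M by fact
  have "(\<lambda>x\<in>carrier (direct_sum M N). snd x) \<in> module_hom R (direct_sum M N) N"
    by (rule left_module_homI[OF direct_sum_left_module[OF assms(1,2)]]) auto
  moreover have "bij_betw (\<lambda>x\<in>carrier (direct_sum M N). snd x) (carrier (direct_sum M N)) (carrier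
      N)"
    by (rule bij_betwI[where g = "\<lambda>x. (\<zero>\<^bsub>M\<^esub>, x)"]) (use assms(3) in auto)
  ultimately show ?thesis unfolding module_iso_def by (intro bexI)
qed

text \<open>Indecomposability of a pair is tested on \<open>direct_sum M P\<close>. Splitting that
  sum into its two factors shows that an indecomposable pair has the form \<open>(M, 0)\<close> or
  \<open>(0, P)\<close>.\<close>

lemma indecomposable_direct_sum_iff:
  assumes "left_module R M" "left_module R N"
  shows "indecomposable R (direct_sum M N) \<longleftrightarrow>
    (indecomposable R M \<and> carrier N = {\<zero>\<^bsub>N\<^esub>}) \<or> (carrier M = {\<zero>\<^bsub>M\<^esub>} \<and> indecomposable R N)"
proof -
  interpret M: left_module R M by fact
  interpret N: left_module R N by fact
  note L = direct_sum_left_module[OF assms]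
  interpret S: left_module R "direct_sum M N" by (rule L)
  have "direct_decomp R (direct_sum M N) (carrier M \<times> {\<zero>\<^bsub>N\<^esub>}) ({\<zero>\<^bsub>M\<^esub>} \<times> carrier N)"
    unfolding direct_decomp_iff[OF L]
  proof (intro conjI ballI S.submoduleI)
    fix x assume "x \<in> carrier (direct_sum M N)"
    then show "\<exists>a\<in>carrier M \<times> {\<zero>\<^bsub>N\<^esub>}. \<exists>b\<in>{\<zero>\<^bsub>M\<^esub>} \<times> carrier N. x = a \<oplus>\<^bsub>direct_sum M N\<^esub> b"
      by (intro bexI[of _ "(fst x, \<zero>\<^bsub>N\<^esub>)"] bexI[of _ "(\<zero>\<^bsub>M\<^esub>, snd x)"]) auto
  qed auto
  note dd = this
  have "carrier M = {\<zero>\<^bsub>M\<^esub>} \<or> carrier N = {\<zero>\<^bsub>N\<^esub>}" if "indecomposable R (direct_sum M N)"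
  proof -
    have "carrier M \<times> {\<zero>\<^bsub>N\<^esub>} = {(\<zero>\<^bsub>M\<^esub>, \<zero>\<^bsub>N\<^esub>)} \<or> {\<zero>\<^bsub>M\<^esub>} \<times> carrier N = {(\<zero>\<^bsub>M\<^esub>, \<zero>\<^bsub>N\<^esub>)}"
      using that dd unfolding indecomposable_def direct_sum_simps(2) by simp
    then show ?thesis using M.M.zero_closed N.M.zero_closed by (auto simp: set_eq_iff)
  qed
  moreover have "\<not> indecomposable R M" if "carrier M = {\<zero>\<^bsub>M\<^esub>}"
    using that by (simp add: indecomposable_def)
  moreover have "\<not> indecomposable R N" if "carrier N = {\<zero>\<^bsub>N\<^esub>}"
    using that by (simp add: indecomposable_def)
  ultimately show ?thesis
    using indecomposable_iso[OF L assms(1) direct_sum_zero_right[OF assms]]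
      indecomposable_iso[OF L assms(2) direct_sum_zero_left[OF assms]] by blast
qed

section \<open>The path algebra and sums of interval modules\<close>

type_synonym 'k path_alg = "('k, (nat, nat) path \<Rightarrow> 'k) module"

type_synonym 'k rep = "('k, (nat, nat) path \<Rightarrow> 'k) umodule"

text \<open>The linear quiver has at most one path between two vertices, so the endpoints determine
  it. For \<open>j < i\<close> the triple is not a path, and every element of the algebra has
  coefficient zero there; this allows sums over all vertices below.\<close>

abbreviation pth :: "nat \<Rightarrow> nat \<Rightarrow> (nat, nat) path" where
  "pth i j \<equiv> (i, [i..<j], j)"

text \<open>The arrow \<open>e\<close> leads from \<open>e\<close> to \<open>Suc e\<close>, so the
  requirement that consecutive arrows match determines the whole list.\<close>

lemma cas_linear_quiver:
  "pre_digraph.cas (linear_quiver n) u p v \<longleftrightarrow> u \<le> v \<and> p = [u..<v]"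
proof (induction p arbitrary: u)
  case Nil
  show ?case by (cases "u < v") (auto simp: pre_digraph.cas.simps upt_conv_Cons)
next
  case (Cons e p)
  have "tail (linear_quiver n) e = e" "head (linear_quiver n) e = Suc e"
    by (simp_all add: linear_quiver_def)
  then have "pre_digraph.cas (linear_quiver n) u (e # p) v \<longleftrightarrow> e = u \<and> Suc u \<le> v \<and> p = [Suc u..<v]"
    by (auto simp: pre_digraph.cas.simps Cons.IH)
  moreover have "[u..<v] = (if u < v then u # [Suc u..<v] else [])"
    by (rule upt_rec)
  ultimately show ?case by (auto split: if_splits simp del: upt_Suc)
qed

lemma paths_linear_quiver:
  "\<pi> \<in> paths (linear_quiver n) \<longleftrightarrow> (\<exists>i j. 1 \<le> i \<and> i \<le> j \<and> j \<le> n \<and> \<pi> = pth i j)"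
proof -
  have "pre_digraph.awalk (linear_quiver n) u p v \<longleftrightarrow> 1 \<le> u \<and> u \<le> v \<and> v \<le> n \<and> p = [u..<v]" for u p v
    unfolding pre_digraph.awalk_def cas_linear_quiver by (auto simp: linear_quiver_def) 
  then show ?thesis by (auto simp: paths_def)
qed

lemma pth_in_paths [simp]: "pth i j \<in> paths (linear_quiver n) \<longleftrightarrow> 1 \<le> i \<and> i \<le> j \<and> j \<le> n"
  by (auto simp: paths_linear_quiver)

lemma finite_paths_linear_quiver: "finite (paths (linear_quiver n))"
proof (rule finite_subset)
  show "paths (linear_quiver n) \<subseteq> (\<lambda>(i, j). pth i j) ` ({1..n} \<times> {1..n})"
    by (force simp: paths_linear_quiver)
qed auto

lemma algebra_A_carrier:
  "x \<in> carrier (algebra_A n) \<longleftrightarrow> (\<forall>\<pi>. x \<pi> \<noteq> 0 \<longrightarrow> \<pi> \<in> paths (linear_quiver n))"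
proof -
  have "{\<pi>. x \<pi> \<noteq> 0} \<subseteq> paths (linear_quiver n) \<longleftrightarrow> (\<forall>\<pi>. x \<pi> \<noteq> 0 \<longrightarrow> \<pi> \<in> paths (linear_quiver n))"
      by blast
  moreover have "finite {\<pi>. x \<pi> \<noteq> 0}" if "{\<pi>. x \<pi> \<noteq> 0} \<subseteq> paths (linear_quiver n)"
    using finite_subset[OF that finite_paths_linear_quiver] .
  moreover have "x \<in> carrier (algebra_A n) \<longleftrightarrow> finite {\<pi>. x \<pi> \<noteq> 0} \<and> {\<pi>. x \<pi> \<noteq> 0} \<subseteq> paths
      (linear_quiver n)"
    by (simp add: algebra_A_def path_algebra_def)
  ultimately show ?thesis by blast
qed

lemma algebra_A_simps [simp]:
  "\<zero>\<^bsub>algebra_A n\<^esub> = (\<lambda>\<pi>. 0)"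
  "x \<oplus>\<^bsub>algebra_A n\<^esub> y = (\<lambda>\<pi>. x \<pi> + y \<pi>)"
  "c \<odot>\<^bsub>algebra_A n\<^esub> x = (\<lambda>\<pi>. c * x \<pi>)"
  by (auto simp: algebra_A_def path_algebra_def)

lemma algebra_A_ext:
  assumes "x \<in> carrier (algebra_A n)" "y \<in> carrier (algebra_A n)"
    and "\<And>i j. 1 \<le> i \<Longrightarrow> i \<le> j \<Longrightarrow> j \<le> n \<Longrightarrow> x (pth i j) = y (pth i j)"
  shows "x = y"
proof
  fix \<pi>
  show "x \<pi> = y \<pi>"
  proof (cases "\<pi> \<in> paths (linear_quiver n)")
    case True
    then show ?thesis using assms(3) unfolding paths_linear_quiver by blast
  next
    case False
    then show ?thesis using assms(1,2) unfolding algebra_A_carrier by metis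
  qed
qed

lemma algebra_A_out:
  "x \<in> carrier (algebra_A n) \<Longrightarrow> \<not> (1 \<le> i \<and> i \<le> j \<and> j \<le> n) \<Longrightarrow> x (pth i j) = 0"
  unfolding algebra_A_carrier using pth_in_paths by blast

lemma factorizations_linear_quiver:
  "factorizations (linear_quiver n) (pth i k) =
     (if 1 \<le> i \<and> k \<le> n then (\<lambda>j. (pth j k, pth i j)) ` {i..k} else {})"
proof -
  have e: "[i..<j] @ [j..<k] = [i..<k]" if "i \<le> j" "j \<le> k" for i j k :: nat
    using that by (metis upt_add_eq_append le_add_diff_inverse)
  show ?thesis
    by (force simp: factorizations_def paths_linear_quiver e)
qed

text \<open>Concatenating two composable paths gives a path, so a product has no coefficients
  elsewhere.\<close>

lemma factorizations_linear_quiver_empty: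
  assumes "\<pi> \<notin> paths (linear_quiver n)"
  shows "factorizations (linear_quiver n) \<pi> = {}"
proof -
  have e: "[i..<j] @ [j..<k] = [i..<k]" if "i \<le> j" "j \<le> k" for i j k :: nat
    using that by (metis upt_add_eq_append le_add_diff_inverse)
  show ?thesis
    using assms by (force simp: factorizations_def paths_linear_quiver e)
qed

text \<open>Read \<open>x (pth j k)\<close> as the entry \<open>(k, j)\<close> of a lower triangular
  matrix; the product is then the matrix product. Extending the sum from \<open>{i..k}\<close> to
  all vertices adds only zeros and makes its range independent of \<open>i\<close> and
  \<open>k\<close>, so that associativity becomes an exchange of sums.\<close>

lemma algebra_A_mult:
  assumes "x \<in> carrier (algebra_A n)" "y \<in> carrier (algebra_A n)"
  shows "(x \<otimes>\<^bsub>algebra_A n\<^esub> y) (pth i k) = (\<Sum>j\<in>{1..n}. x (pth j k) * y (pth i j))"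
proof -
  have inj: "inj_on (\<lambda>j. (pth j k, pth i j)) {i..k}" by (auto simp: inj_on_def)
  have "(x \<otimes>\<^bsub>algebra_A n\<^esub> y) (pth i k)
      = (\<Sum>(\<sigma>, \<rho>)\<in>factorizations (linear_quiver n) (pth i k). x \<sigma> * y \<rho>)"
    by (simp add: algebra_A_def path_algebra_def)
  also have "\<dots> = (if 1 \<le> i \<and> k \<le> n then \<Sum>j\<in>{i..k}. x (pth j k) * y (pth i j) else 0)"
    by (simp add: factorizations_linear_quiver sum.reindex[OF inj])
  also have "\<dots> = (\<Sum>j\<in>{1..n}. x (pth j k) * y (pth i j))"
  proof (cases "1 \<le> i \<and> k \<le> n")
    case True
    then have "(\<Sum>j\<in>{i..k}. x (pth j k) * y (pth i j)) = (\<Sum>j\<in>{1..n}. x (pth j k) * y (pth i j))"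
    proof (intro sum.mono_neutral_left ballI)
      fix j assume "j \<in> {1..n} - {i..k}"
      then show "x (pth j k) * y (pth i j) = 0"
        using algebra_A_out[OF assms(1), of j k] algebra_A_out[OF assms(2), of i j] by fastforce
    qed (use True in auto)
    then show ?thesis using True by simp
  next
    case False
    then have "x (pth j k) * y (pth i j) = 0" for j
      using algebra_A_out[OF assms(1), of j k] algebra_A_out[OF assms(2), of i j] by fastforce
    then show ?thesis using False by (simp add: sum.neutral)
  qed
  finally show ?thesis .
qed

lemma algebra_A_mult_closed:
  "x \<otimes>\<^bsub>algebra_A n\<^esub> y \<in> carrier (algebra_A n)"
proof -
  have "(x \<otimes>\<^bsub>algebra_A n\<^esub> y) \<pi> = 0" if "\<pi> \<notin> paths (linear_quiver n)" for \<pi>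
    using factorizations_linear_quiver_empty[OF that] by (simp add: algebra_A_def path_algebra_def)
  then show ?thesis unfolding algebra_A_carrier by blast
qed

lemma algebra_A_one:
  "\<one>\<^bsub>algebra_A n\<^esub> \<in> carrier (algebra_A n)"
  "\<one>\<^bsub>algebra_A n\<^esub> (pth i j) = (if i = j \<and> 1 \<le> i \<and> i \<le> n then 1 else 0)"
proof -
  show "\<one>\<^bsub>algebra_A n\<^esub> (pth i j) = (if i = j \<and> 1 \<le> i \<and> i \<le> n then 1 else 0)"
    by (auto simp: algebra_A_def path_algebra_def linear_quiver_def)
  show "\<one>\<^bsub>algebra_A n\<^esub> \<in> carrier (algebra_A n)"
    by (auto simp: algebra_A_carrier paths_linear_quiver)
      (auto simp: algebra_A_def path_algebra_def linear_quiver_def split: if_splits)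
qed

text \<open>The condition \<open>P\<close> collects the range restrictions in the coefficients of
  \<open>pel\<close> and of the unit that do not involve the summation index.\<close>

lemma sum_if_eq1:
  fixes f :: "nat \<Rightarrow> 'k::field"
  shows "(\<Sum>j\<in>{1..n}. (if j = i \<and> P then c else 0) * f j) = (if P \<and> 1 \<le> i \<and> i \<le> n then c * f i else
      0)"
    "(\<Sum>j\<in>{1..n}. f j * (if j = i \<and> P then c else 0)) = (if P \<and> 1 \<le> i \<and> i \<le> n then f i * c else 0)"
proof -
  have "(\<Sum>j\<in>{1..n}. (if j = i \<and> P then c else 0) * f j) = (\<Sum>j\<in>{1..n}. if j
      = i then (if P then c * f j else 0) else 0)"
    by (intro sum.cong) auto
  then show "(\<Sum>j\<in>{1..n}. (if j = i \<and> P then c else 0) * f j) = (if P \<and> 1 \<le> i \<and> i \<le> n then c * f i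
      else 0)"
    by (simp add: sum.delta)
  have "(\<Sum>j\<in>{1..n}. f j * (if j = i \<and> P then c else 0)) = (\<Sum>j\<in>{1..n}. if j
      = i then (if P then f j * c else 0) else 0)"
    by (intro sum.cong) auto
  then show "(\<Sum>j\<in>{1..n}. f j * (if j = i \<and> P then c else 0)) = (if P \<and> 1 \<le> i \<and> i \<le> n then f i * c
      else 0)"
    by (simp add: sum.delta)
qed

lemma algebra_A_add_closed:
  "x \<in> carrier (algebra_A n) \<Longrightarrow> y \<in> carrier (algebra_A n) \<Longrightarrow> (\<lambda>\<pi>. x \<pi> + y \<pi>) \<in> carrier (algebra_A n)"
  unfolding algebra_A_carrier by (metis add_0)

lemma algebra_A_ring: "ring (algebra_A n :: 'k::field path_alg)"
  (is "ring ?A")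
proof (rule ringI)
  note cl = algebra_A_mult_closed algebra_A_add_closed algebra_A_one(1)
  show "abelian_group ?A"
  proof (rule abelian_groupI)
    fix x assume "x \<in> carrier ?A"
    then show "\<exists>y\<in>carrier ?A. y \<oplus>\<^bsub>?A\<^esub> x = \<zero>\<^bsub>?A\<^esub>"
      by (intro bexI[of _ "\<lambda>\<pi>. - x \<pi>"]) (auto simp: algebra_A_carrier)
  qed (auto intro: cl simp: algebra_simps, simp add: algebra_A_carrier)
  show "monoid ?A"
  proof (rule monoidI)
    fix x y z assume x: "x \<in> carrier ?A" and y: "y \<in> carrier ?A" and z: "z \<in> carrier ?A"
    show "x \<otimes>\<^bsub>?A\<^esub> y \<otimes>\<^bsub>?A\<^esub> z = x \<otimes>\<^bsub>?A\<^esub> (y \<otimes>\<^bsub>?A\<^esub> z)"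
    proof (rule algebra_A_ext)
      fix i l
      have "(x \<otimes>\<^bsub>?A\<^esub> y \<otimes>\<^bsub>?A\<^esub> z) (pth i l) = (\<Sum>j\<in>{1..n}. \<Sum>k\<in>{1..n}. x (pth k l) * y (pth j k) * z (pth
          i j))"
        by (simp only: algebra_A_mult[OF x y] algebra_A_mult[OF algebra_A_mult_closed z]
            sum_distrib_right)
      also have "\<dots> = (\<Sum>k\<in>{1..n}. \<Sum>j\<in>{1..n}. x (pth k l) * y (pth j k) * z (pth i j))"
        by (rule sum.swap)
      also have "\<dots> = (x \<otimes>\<^bsub>?A\<^esub> (y \<otimes>\<^bsub>?A\<^esub> z)) (pth i l)"
        by (simp only: algebra_A_mult[OF y z] algebra_A_mult[OF x algebra_A_mult_closed]
            sum_distrib_left mult.assoc)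
      finally show "(x \<otimes>\<^bsub>?A\<^esub> y \<otimes>\<^bsub>?A\<^esub> z) (pth i l) = (x \<otimes>\<^bsub>?A\<^esub> (y \<otimes>\<^bsub>?A\<^esub> z)) (pth i l)" .
    qed (rule algebra_A_mult_closed)+
  next
    fix x assume x: "x \<in> carrier ?A"
    show "\<one>\<^bsub>?A\<^esub> \<otimes>\<^bsub>?A\<^esub> x = x"
    proof (rule algebra_A_ext)
      fix i k :: nat assume ik: "1 \<le> i" "i \<le> k" "k \<le> n"
      have "(\<one>\<^bsub>?A\<^esub> \<otimes>\<^bsub>?A\<^esub> x) (pth i k) = (\<Sum>j\<in>{1..n}. (if j = k \<and> 1 \<le> k \<and> k \<le> n then 1 else 0) * x (pth
          i j))"
        unfolding algebra_A_mult[OF algebra_A_one(1) x] algebra_A_one by (intro sum.cong) auto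
      then show "(\<one>\<^bsub>?A\<^esub> \<otimes>\<^bsub>?A\<^esub> x) (pth i k) = x (pth i k)"
        using ik by (simp only: sum_if_eq1) simp
    qed (use x in \<open>auto intro: cl\<close>)
    show "x \<otimes>\<^bsub>?A\<^esub> \<one>\<^bsub>?A\<^esub> = x"
    proof (rule algebra_A_ext)
      fix i k :: nat assume ik: "1 \<le> i" "i \<le> k" "k \<le> n"
      have "(x \<otimes>\<^bsub>?A\<^esub> \<one>\<^bsub>?A\<^esub>) (pth i k) = (\<Sum>j\<in>{1..n}. x (pth j k) * (if j = i \<and> 1 \<le> i
          \<and> i \<le> n then 1 else 0))"
        unfolding algebra_A_mult[OF x algebra_A_one(1)] algebra_A_one by (intro sum.cong) auto
      then show "(x \<otimes>\<^bsub>?A\<^esub> \<one>\<^bsub>?A\<^esub>) (pth i k) = x (pth i k)"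
        using ik by (simp only: sum_if_eq1) simp
    qed (use x in \<open>auto intro: cl\<close>)
  qed (rule cl)+
  fix x y z assume x: "x \<in> carrier ?A" and y: "y \<in> carrier ?A" and z: "z \<in> carrier ?A"
  note xy = algebra_A_add_closed[OF x y]
  show "(x \<oplus>\<^bsub>?A\<^esub> y) \<otimes>\<^bsub>?A\<^esub> z = x \<otimes>\<^bsub>?A\<^esub> z \<oplus>\<^bsub>?A\<^esub> y \<otimes>\<^bsub>?A\<^esub> z"
    by (rule algebra_A_ext)
      (auto intro!: cl simp: algebra_A_mult[OF xy z] algebra_A_mult[OF x z] algebra_A_mult[OF y z]
        sum.distrib[symmetric] algebra_simps)
  show "z \<otimes>\<^bsub>?A\<^esub> (x \<oplus>\<^bsub>?A\<^esub> y) = z \<otimes>\<^bsub>?A\<^esub> x \<oplus>\<^bsub>?A\<^esub> z \<otimes>\<^bsub>?A\<^esub> y"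
    by (rule algebra_A_ext)
      (auto intro!: cl simp: algebra_A_mult[OF z xy] algebra_A_mult[OF z x] algebra_A_mult[OF z y]
        sum.distrib[symmetric] algebra_simps)
qed

section \<open>Matrix units and columns of the path algebra\<close>

text \<open>A scaled matrix unit that becomes zero as soon as the path leaves the quiver. In
  particular \<open>pel n i (Suc n) c\<close> is zero, which makes the relation of an interval
  ending at \<open>n + 1\<close> vacuous.\<close>

definition pel :: "nat \<Rightarrow> nat \<Rightarrow> nat \<Rightarrow> 'k::field \<Rightarrow> (nat, nat) path \<Rightarrow> 'k" where
  "pel n i j c = (\<lambda>\<pi>. if \<pi> = pth i j \<and> 1 \<le> i \<and> i \<le> j \<and> j \<le> n then c else 0)"

lemma pel_carrier [simp]: "pel n i j c \<in> carrier (algebra_A n)"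
  by (auto simp: pel_def algebra_A_carrier split: if_splits)

lemma pel_coeff: "pel n i j c (pth i' j') = (if i' = i \<and> j' = j \<and> 1 \<le> i \<and> i \<le> j
    \<and> j \<le> n then c else 0)"
  by (auto simp: pel_def)

lemma pel_out: "n < j \<Longrightarrow> pel n i j c = (\<lambda>_. 0)"
  by (auto simp: pel_def)

lemma pel_mult_left:
  assumes "x \<in> carrier (algebra_A n)"
  shows "(x \<otimes>\<^bsub>algebra_A n\<^esub> pel n i j c) (pth i' k) = (if i' = i \<and> 1 \<le> i \<and> i \<le> j
      \<and> j \<le> n then x (pth j k) * c else 0)"
proof -
  have "(x \<otimes>\<^bsub>algebra_A n\<^esub> pel n i j c) (pth i' k)
     = (\<Sum>l\<in>{1..n}. x (pth l k) * (if l = j \<and> (i' = i \<and> 1 \<le> i \<and> i \<le> j \<and> j \<le> n) then c else 0))"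
    unfolding algebra_A_mult[OF assms pel_carrier] by (intro sum.cong) (auto simp: pel_coeff)
  then show ?thesis by (auto simp only: sum_if_eq1 split: if_splits)
qed

lemma pel_mult:
  assumes "i \<le> j" "j \<le> k"
  shows "pel n j k c \<otimes>\<^bsub>algebra_A n\<^esub> pel n i j d = pel n i k (c * d)"
  by (rule algebra_A_ext)
    (use assms in \<open>auto intro: algebra_A_mult_closed simp: pel_mult_left pel_coeff\<close>)

text \<open>An element of the left ideal generated by the idempotent at \<open>u\<close>, that is,
  of the projective at \<open>u\<close>. Letting it act on the image of a generator sends a whole
  vector of coordinates to the target module at once.\<close>

definition col :: "nat \<Rightarrow> nat \<Rightarrow> (nat \<Rightarrow> 'k::field) \<Rightarrow> (nat, nat) path \<Rightarrow> 'k" where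
  "col n u h = (\<lambda>\<pi>. if fst \<pi> = u \<and> \<pi> \<in> paths (linear_quiver n) then h (snd (snd \<pi>)) else 0)"

lemma col_carrier [simp]: "col n u h \<in> carrier (algebra_A n)"
  by (auto simp: col_def algebra_A_carrier split: if_splits)

lemma col_coeff: "col n u h (pth i j) = (if i = u \<and> 1 \<le> i \<and> i \<le> j \<and> j \<le> n then h j else 0)"
  by (auto simp: col_def)

lemma col_add: "col n u (\<lambda>v. h v + h' v) = col n u h \<oplus>\<^bsub>algebra_A n\<^esub> col n u h'"
  by (auto simp: col_def)

text \<open>Every path from \<open>u\<close> to a vertex from \<open>b\<close> on passes through
  \<open>b\<close>, so the path from \<open>u\<close> to \<open>b\<close> splits off on the
  right.\<close>

lemma col_pel:
  assumes "1 \<le> u" "u \<le> b" "\<And>v. u \<le> v \<Longrightarrow> v \<le> n \<Longrightarrow> v < b \<Longrightarrow> h v = 0"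
  shows "col n u h = col n b h \<otimes>\<^bsub>algebra_A n\<^esub> pel n u b 1"
  by (rule algebra_A_ext)
    (use assms in \<open>auto intro: algebra_A_mult_closed simp: pel_mult_left col_coeff\<close>)

text \<open>Left multiplication of a column is the action on the projective at \<open>u\<close> in
  coordinates. The values of \<open>h\<close> before \<open>u\<close> must vanish: the sum on the
  right meets these vertices, whereas the column ignores them.\<close>

lemma mult_col:
  assumes "x \<in> carrier (algebra_A n)" "\<And>v. v < u \<Longrightarrow> h v = 0" "1 \<le> u"
  shows "x \<otimes>\<^bsub>algebra_A n\<^esub> col n u h = col n u (\<lambda>v. \<Sum>j\<in>{1..n}. x (pth j v) * h j)"
proof (rule algebra_A_ext)
  fix i j :: nat assume ij: "1 \<le> i" "i \<le> j" "j \<le> n"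
  show "(x \<otimes>\<^bsub>algebra_A n\<^esub> col n u h) (pth i j) = col n u (\<lambda>v. \<Sum>j\<in>{1..n}. x (pth j v) * h j) (pth i j)"
  proof (cases "i = u")
    case True
    then show ?thesis
      using ij assms(2) unfolding algebra_A_mult[OF assms(1) col_carrier] col_coeff
      by (auto intro!: sum.cong)
  qed (use ij in \<open>auto simp: algebra_A_mult[OF assms(1) col_carrier] col_coeff\<close>)
qed (auto intro: algebra_A_mult_closed)

lemma col_zero: "col n u (\<lambda>v. 0) = (\<lambda>_. 0)"
  by (auto simp: col_def)

lemma sum_pel_one:
  fixes n :: nat
  defines "A \<equiv> (algebra_A n :: 'k::field path_alg)"
  shows "finsum A (\<lambda>i. pel n i i 1) {1..n} = \<one>\<^bsub>A\<^esub>"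
proof -
  interpret ring A unfolding A_def by (rule algebra_A_ring)
  have ind: "m \<le> n \<Longrightarrow> finsum A (\<lambda>i. pel n i i 1) {1..m} = (\<lambda>\<pi>. if \<exists>v\<in>{1..m}. \<pi>
      = (v, [], v) then 1 else 0)" for m
  proof (induction m)
    case 0
    have "finsum A (\<lambda>i. pel n i i 1) {} = \<zero>\<^bsub>A\<^esub>" by (rule finsum_empty)
    then show ?case by (simp add: A_def)
  next
    case (Suc m)
    have "{1..Suc m} = insert (Suc m) {1..m}" by auto
    then have "finsum A (\<lambda>i. pel n i i 1) {1..Suc m} = pel n (Suc m) (Suc m) 1 \<oplus>\<^bsub>A\<^esub> finsum A (\<lambda>i.
        pel n i i 1) {1..m}"
      using finsum_insert[of "{1..m}" "Suc m" "\<lambda>i. pel n i i 1"] by (simp add: A_def)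
    also have "\<dots> = (\<lambda>\<pi>. if \<exists>v\<in>{1..Suc m}. \<pi> = (v, [], v) then 1 else 0)"
      using Suc by (auto simp: A_def pel_def fun_eq_iff le_Suc_eq)
    finally show ?case .
  qed
  show ?thesis using ind[of n] by (simp add: A_def algebra_A_def path_algebra_def linear_quiver_def)
qed

section \<open>Sums of interval modules in coordinates\<close>

text \<open>A cell is a summand together with a vertex, encoded as a number because the modules that
  enter the complexes have their carriers in \<open>nat \<Rightarrow> 'k\<close>.\<close>

definition cells :: "nat set \<Rightarrow> (nat \<Rightarrow> nat) \<Rightarrow> (nat \<Rightarrow> nat) \<Rightarrow> nat set" where
  "cells I a b = {prod_encode (i, j) | i j. i \<in> I \<and> a i \<le> j \<and> j < b i}"

lemma cells_iff [simp]: "prod_encode (i, j) \<in> cells I a b \<longleftrightarrow> i \<in> I \<and> a i \<le> j \<and> j < b i"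
  by (auto simp: cells_def)

text \<open>
  The direct sum over \<open>i \<in> I\<close> of the interval modules supported on the vertices \<open>a i, \<dots>, b i - 1\<close>;
  the value at \<open>prod_encode (i, j)\<close> is the coordinate of the \<open>i\<close>-th summand at the vertex \<open>j\<close>.
\<close>

definition imod :: "nat \<Rightarrow> nat set \<Rightarrow> (nat \<Rightarrow> nat) \<Rightarrow> (nat \<Rightarrow> nat) \<Rightarrow> 'k::field rep" where
  "imod n I a b =
    \<lparr>carrier = {f. \<forall>k. f k \<noteq> 0 \<longrightarrow> k \<in> cells I a b},
     mult = (\<lambda>f g k. 0), one = (\<lambda>k. 0), zero = (\<lambda>k. 0),
     add = (\<lambda>f g k. f k + g k),
     smult = (\<lambda>x f k. if k \<in> cells I a b
       then (\<Sum>j\<in>{1..n}. x (pth j (snd (prod_decode k))) * f (prod_encode (fst (prod_decode k),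
           j))) else 0)\<rparr>"

definition ivalid :: "nat \<Rightarrow> nat set \<Rightarrow> (nat \<Rightarrow> nat) \<Rightarrow> (nat \<Rightarrow> nat) \<Rightarrow> bool" where
  "ivalid n I a b \<longleftrightarrow> finite I \<and> (\<forall>i\<in>I. 1 \<le> a i \<and> a i < b i \<and> b i \<le> Suc n)"

lemma imod_simps [simp]:
  "\<zero>\<^bsub>imod n I a b\<^esub> = (\<lambda>k. 0)"
  "f \<oplus>\<^bsub>imod n I a b\<^esub> g = (\<lambda>k. f k + g k)"
  by (auto simp: imod_def)

lemma imod_carrier: "f \<in> carrier (imod n I a b) \<longleftrightarrow> (\<forall>k. f k \<noteq> 0 \<longrightarrow> k \<in> cells I a b)"
  by (auto simp: imod_def)

lemma imod_smult:
  "(x \<odot>\<^bsub>imod n I a b\<^esub> f) (prod_encode (i, j)) = (if i \<in> I \<and> a i \<le> j \<and> j < b i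
       then (\<Sum>l\<in>{1..n}. x (pth l j) * f (prod_encode (i, l))) else 0)"
  by (simp add: imod_def)

lemma imod_smult_closed: "x \<odot>\<^bsub>imod n I a b\<^esub> f \<in> carrier (imod n I a b)"
  by (auto simp: imod_def)

lemma imod_ext:
  fixes f g :: "nat \<Rightarrow> 'a"
  assumes "\<And>i j. f (prod_encode (i, j)) = g (prod_encode (i, j))"
  shows "f = g"
  using assms by (metis ext prod_decode_inverse surj_pair)

lemma imod_out:
  "f \<in> carrier (imod n I a b) \<Longrightarrow> \<not> (i \<in> I \<and> a i \<le> j \<and> j < b i) \<Longrightarrow> f (prod_encode (i, j)) = 0"
  unfolding imod_carrier using cells_iff by blast

text \<open>The delicate axiom is associativity, because the action discards what leaves the cells.
  Discarding after \<open>y\<close> loses nothing: a path that starts and ends in an interval stays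
  in it, so intermediate vertices outside the interval contribute zero.\<close>

lemma imod_left_module:
  assumes "ivalid n I a b"
  shows "left_module (algebra_A n) (imod n I a b)" (is "left_module ?A ?M")
proof (rule left_moduleI)
  have v: "1 \<le> a i" "a i < b i" "b i \<le> Suc n" if "i \<in> I" for i using that assms
      by (auto simp: ivalid_def)
  show "ring ?A" by (rule algebra_A_ring)
  fix f assume f: "f \<in> carrier ?M"
  show "\<exists>g\<in>carrier ?M. g \<oplus>\<^bsub>?M\<^esub> f = \<zero>\<^bsub>?M\<^esub>"
    using f by (intro bexI[of _ "\<lambda>k. - f k"]) (auto simp: imod_carrier)
  show "\<one>\<^bsub>?A\<^esub> \<odot>\<^bsub>?M\<^esub> f = f"
  proof (rule imod_ext)
    fix i j
    have "(\<one>\<^bsub>?A\<^esub> \<odot>\<^bsub>?M\<^esub> f) (prod_encode (i, j)) = (if i \<in> I \<and> a i \<le> j \<and> j < b i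
       then (\<Sum>l\<in>{1..n}. (if l = j \<and> True then 1 else 0) * f (prod_encode (i, l))) else 0)"
      unfolding imod_smult algebra_A_one by (auto intro!: sum.cong)
    then show "(\<one>\<^bsub>?A\<^esub> \<odot>\<^bsub>?M\<^esub> f) (prod_encode (i, j)) = f (prod_encode (i, j))"
      using v[of i] imod_out[OF f, of i j] unfolding sum_if_eq1 by auto
  qed
  fix x y assume x: "x \<in> carrier ?A" and y: "y \<in> carrier ?A"
  show "(x \<oplus>\<^bsub>?A\<^esub> y) \<odot>\<^bsub>?M\<^esub> f = x \<odot>\<^bsub>?M\<^esub> f \<oplus>\<^bsub>?M\<^esub> y \<odot>\<^bsub>?M\<^esub> f"
    by (rule imod_ext) (simp add: imod_smult sum.distrib algebra_simps)
  show "(x \<otimes>\<^bsub>?A\<^esub> y) \<odot>\<^bsub>?M\<^esub> f = x \<odot>\<^bsub>?M\<^esub> (y \<odot>\<^bsub>?M\<^esub> f)"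
  proof (rule imod_ext)
    fix i j
    show "((x \<otimes>\<^bsub>?A\<^esub> y) \<odot>\<^bsub>?M\<^esub> f) (prod_encode (i, j)) = (x \<odot>\<^bsub>?M\<^esub> (y \<odot>\<^bsub>?M\<^esub> f)) (prod_encode (i, j))"
    proof (cases "i \<in> I \<and> a i \<le> j \<and> j < b i")
      case True
      have "((x \<otimes>\<^bsub>?A\<^esub> y) \<odot>\<^bsub>?M\<^esub> f) (prod_encode (i, j))
          = (\<Sum>l\<in>{1..n}. \<Sum>k\<in>{1..n}. x (pth k j) * y (pth l k) * f (prod_encode (i, l)))"
        using True by (simp add: imod_smult algebra_A_mult[OF x y] sum_distrib_right)
      also have "\<dots> = (\<Sum>k\<in>{1..n}. \<Sum>l\<in>{1..n}. x (pth k j) * y (pth l k) * f (prod_encode (i, l)))"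
        by (rule sum.swap)
      also have "\<dots> = (\<Sum>k\<in>{1..n}. x (pth k j) * (y \<odot>\<^bsub>?M\<^esub> f) (prod_encode (i, k)))"
      proof (rule sum.cong[OF refl])
        fix k
        have z: "y (pth l k) * f (prod_encode (i, l)) = 0" if "k < a i" for l
          using algebra_A_out[OF y, of l k] imod_out[OF f, of i l] that by fastforce
        have "(\<Sum>l\<in>{1..n}. x (pth k j) * y (pth l k) * f (prod_encode (i, l))) = 0" if "k < a i"
          unfolding mult.assoc z[OF that] by simp
        then show "(\<Sum>l\<in>{1..n}. x (pth k j) * y (pth l k) * f (prod_encode (i, l)))
            = x (pth k j) * (y \<odot>\<^bsub>?M\<^esub> f) (prod_encode (i, k))"
          using True algebra_A_out[OF x, of k j]
          by (cases "k < a i"; cases "b i \<le> k") (auto simp: imod_smult sum_distrib_left mult.assoc)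
      qed
      also have "\<dots> = (x \<odot>\<^bsub>?M\<^esub> (y \<odot>\<^bsub>?M\<^esub> f)) (prod_encode (i, j))"
        using True by (simp add: imod_smult)
      finally show ?thesis .
    next
      case False
      then show ?thesis unfolding imod_smult by (simp only: if_False)
    qed
  qed
next
  fix f g assume f: "f \<in> carrier ?M" and g: "g \<in> carrier ?M"
  show "f \<oplus>\<^bsub>?M\<^esub> g \<in> carrier ?M" using f g unfolding imod_carrier imod_simps by (metis add_0)
  fix x
  show "x \<odot>\<^bsub>?M\<^esub> (f \<oplus>\<^bsub>?M\<^esub> g) = x \<odot>\<^bsub>?M\<^esub> f \<oplus>\<^bsub>?M\<^esub> x \<odot>\<^bsub>?M\<^esub> g"
    by (rule imod_ext) (simp add: imod_smult sum.distrib algebra_simps)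
qed (auto simp: imod_carrier algebra_simps intro!: imod_smult_closed[unfolded imod_carrier,
    rule_format])

definition uv :: "nat \<Rightarrow> nat \<Rightarrow> 'k::field \<Rightarrow> nat \<Rightarrow> 'k" where
  "uv i j c = (\<lambda>k. if k = prod_encode (i, j) then c else 0)"

lemma uv_coeff [simp]: "uv i j c (prod_encode (i', j')) = (if i' = i \<and> j' = j then c else 0)"
  by (auto simp: uv_def)

lemma uv_carrier: "i \<in> I \<Longrightarrow> a i \<le> j \<Longrightarrow> j < b i \<Longrightarrow> uv i j c \<in> carrier (imod n I a b)"
  by (auto simp: uv_def imod_carrier)

lemma pel_smult:
  assumes "1 \<le> j" "j \<le> l" "l \<le> n"
  shows "(pel n j l c \<odot>\<^bsub>imod n I a b\<^esub> f) (prod_encode (i, l')) =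
    (if l' = l \<and> i \<in> I \<and> a i \<le> l \<and> l < b i then c * f (prod_encode (i, j)) else 0)"
proof -
  have "(pel n j l c \<odot>\<^bsub>imod n I a b\<^esub> f) (prod_encode (i, l')) = (if i \<in> I \<and> a i \<le> l' \<and> l' < b i
       then (\<Sum>m\<in>{1..n}. (if m = j \<and> l' = l then c else 0) * f (prod_encode (i, m))) else 0)"
    unfolding imod_smult pel_coeff using assms by (auto intro!: sum.cong)
  then show ?thesis using assms by (auto simp only: sum_if_eq1 split: if_splits)
qed

lemma pel_smult_uv:
  assumes "1 \<le> j" "j \<le> l" "l \<le> n"
  shows "pel n j l c \<odot>\<^bsub>imod n I a b\<^esub> uv i j d = (if i \<in> I \<and> a i \<le> l \<and> l < b i then uv i l (c * d)
      else (\<lambda>k. 0))"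
  by (rule imod_ext) (use assms in \<open>auto simp: pel_smult\<close>)

text \<open>Membership in a submodule is checked one coordinate at a time. An element is a finite
  combination of the basis vectors in its support, and the scalars act through multiples of the
  vertex idempotents; the induction removes one cell of the support in each step.\<close>

lemma imod_submodule_supp:
  assumes v: "ivalid n I a b" and N: "submodule N (algebra_A n) (imod n I a b)"
    and f: "f \<in> carrier (imod n I a b)"
    and u: "\<And>i j. f (prod_encode (i, j)) \<noteq> 0 \<Longrightarrow> uv i j (1 :: 'k::field) \<in> N"
  shows "f \<in> N"
proof -
  interpret left_module "algebra_A n" "imod n I a b" by (rule imod_left_module[OF v])
  note S = submoduleD[OF N]
  have fin: "finite (cells I a b)"
  proof (rule finite_subset)
    show "cells I a b \<subseteq> prod_encode ` (I \<times> {..n})" using v by (force simp: cells_def ivalid_def)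
  qed (use v in \<open>auto simp: ivalid_def\<close>)
  have scal: "uv i j c \<in> N" if "uv i j 1 \<in> N" "i \<in> I" "a i \<le> j" "j < b i" for i j c
    using S(4)[OF pel_carrier that(1), of j j c] that v
    by (auto simp: pel_smult_uv ivalid_def)
  have "finite K \<Longrightarrow> \<forall>f\<in>carrier (imod n I a b). {k. f k \<noteq> 0} \<subseteq> K \<longrightarrow>
      (\<forall>i j. f (prod_encode (i, j)) \<noteq> 0 \<longrightarrow> uv i j (1 :: 'k::field) \<in> N) \<longrightarrow> f \<in> N" for K
  proof (induction K rule: finite_induct)
    case empty
    have "f = (\<lambda>_. 0)" if "{k. f k \<noteq> 0} \<subseteq> {}" for f :: "nat \<Rightarrow> 'k" using that
        by (auto simp: fun_eq_iff)
    then show ?case using S(2) unfolding imod_simps by metis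
  next
    case (insert k K)
    show ?case
    proof (intro ballI impI)
      fix f :: "nat \<Rightarrow> 'k" assume f: "f \<in> carrier (imod n I a b)" "{k. f k \<noteq> 0} \<subseteq> insert k K"
        and u: "\<forall>i j. f (prod_encode (i, j)) \<noteq> 0 \<longrightarrow> uv i j (1 :: 'k::field) \<in> N"
      show "f \<in> N"
      proof (cases "f k = 0")
        case True
        then have "{k. f k \<noteq> 0} \<subseteq> K" using f by auto
        then show ?thesis using insert.IH f u by blast
      next
        case False
        obtain i j where k: "k = prod_encode (i, j)" by (metis prod_decode_inverse surj_pair)
        have ij: "i \<in> I" "a i \<le> j" "j < b i" using f(1) False unfolding imod_carrier k by auto
        have 1: "f(k := 0) \<in> N"
        proof (rule insert.IH[THEN bspec, THEN mp, THEN mp])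
          show "f(k := 0) \<in> carrier (imod n I a b)" using f(1) by (auto simp: imod_carrier)
          show "{ka. (f(k := 0)) ka \<noteq> 0} \<subseteq> K" using f(2) by auto
          show "\<forall>i j. (f(k := 0)) (prod_encode (i, j)) \<noteq> 0 \<longrightarrow> uv i j (1 :: 'k) \<in> N"
            using u by simp
        qed
        have 2: "uv i j (f k) \<in> N" using scal ij u False k by blast
        have "f = f(k := 0) \<oplus>\<^bsub>imod n I a b\<^esub> uv i j (f k)" by (auto simp: uv_def k)
        then show ?thesis using S(3)[OF 1 2] by simp
      qed
    qed
  qed
  moreover have "finite {k. f k \<noteq> 0}"
    by (rule finite_subset[OF _ fin]) (use f in \<open>auto simp: imod_carrier\<close>)
  ultimately show ?thesis using f u by blast
qed

section \<open>Generators and relations of a sum of interval modules\<close>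

lemma imod_uv_gen:
  assumes v: "ivalid n I a b" and N: "submodule N (algebra_A n) (imod n I a b)"
    and u: "uv i (a i) (1 :: 'k::field) \<in> N" "i \<in> I" "a i \<le> j" "j < b i"
  shows "uv i j 1 \<in> N"
  using submoduleD(4)[OF N pel_carrier u(1), of "a i" j 1] u(2-4) v
  by (auto simp: pel_smult_uv ivalid_def)

lemma imod_generated:
  assumes v: "ivalid n I a b" and N: "submodule N (algebra_A n) (imod n I a b)"
    and u: "\<And>i. i \<in> I \<Longrightarrow> uv i (a i) (1 :: 'k::field) \<in> N"
  shows "N = carrier (imod n I a b)"
proof -
  have "f \<in> N" if "f \<in> carrier (imod n I a b)" for f
    using imod_submodule_supp[OF v N that] imod_uv_gen[OF v N] u imod_out[OF that] by blast
  then show ?thesis using submoduleD(1)[OF N] by blast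
qed

lemma imod_fin_gen:
  assumes "ivalid n I a b"
  shows "fin_gen_module (algebra_A n) (imod n I a b)"
  unfolding fin_gen_module_def
proof (intro conjI exI[of _ "(\<lambda>i. uv i (a i) 1) ` I"] allI impI)
  fix N assume "submodule N (algebra_A n) (imod n I a b) \<and> (\<lambda>i. uv i (a i) 1) ` I \<subseteq> N"
  then show "N = carrier (imod n I a b)" using imod_generated[OF assms] by blast
qed (use assms in \<open>auto simp: imod_left_module uv_carrier ivalid_def\<close>)

lemma imod_hom_eqI:
  assumes v: "ivalid n I a b" and M: "left_module (algebra_A n) M"
    and "f \<in> module_hom (algebra_A n) (imod n I a b) M" "g \<in> module_hom (algebra_A n) (imod n I a
        b) M"
    and "\<And>i. i \<in> I \<Longrightarrow> f (uv i (a i) 1) = g (uv i (a i) 1)"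
  shows "f = g"
proof -
  have "{x \<in> carrier (imod n I a b). f x = g x} = carrier (imod n I a b)"
    by (rule imod_generated[OF v module_hom_equalizer_submodule[OF imod_left_module[OF v] M
        assms(3,4)]])
      (use assms(1,5) in \<open>auto intro!: uv_carrier simp: ivalid_def\<close>)
  then show ?thesis using module_homD(4)[OF assms(3)] module_homD(4)[OF assms(4)]
    by (intro extensionalityI) auto
qed

text \<open>The coordinates of \<open>f\<close> in the summand \<open>i\<close> are read as an
  element of the projective at \<open>a i\<close>, which then acts on \<open>x i\<close>; the image
  of \<open>f\<close> is the sum over \<open>i\<close>. The relation on \<open>x i\<close> makes
  this compatible with the truncated action on the interval.\<close>

lemma imod_hom_ex:
  fixes n :: nat
  defines "A \<equiv> (algebra_A n :: 'k::field path_alg)"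
  assumes v: "ivalid n I a b" and M: "left_module A M"
    and x: "\<And>i. i \<in> I \<Longrightarrow> x i \<in> carrier M" "\<And>i. i \<in> I \<Longrightarrow> pel n (a i) (a i) 1 \<odot>\<^bsub>M\<^esub> x i = x i"
      "\<And>i. i \<in> I \<Longrightarrow> pel n (a i) (b i) 1 \<odot>\<^bsub>M\<^esub> x i = \<zero>\<^bsub>M\<^esub>"
  obtains \<Phi> where "\<Phi> \<in> module_hom A (imod n I a b) M" "\<And>i. i \<in> I \<Longrightarrow> \<Phi> (uv i (a i) 1) = x i"
proof -
  interpret M: left_module A M by (rule M)
  have val: "1 \<le> a i" "a i < b i" "b i \<le> Suc n" if "i \<in> I" for i using that v
      by (auto simp: ivalid_def)
  have finI: "finite I" using v by (simp add: ivalid_def)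
  define g where "g i f = col n (a i) (\<lambda>v. f (prod_encode (i, v))) \<odot>\<^bsub>M\<^esub> x i" for i and f :: "nat \<Rightarrow> 'k"
  have cc: "col n u h \<in> carrier A" for u h by (simp add: A_def)
  have gc: "g i f \<in> carrier M" if "i \<in> I" for i f using x(1)[OF that] cc by (simp add: g_def)
  have g_add: "g i (\<lambda>k. f k + f' k) = g i f \<oplus>\<^bsub>M\<^esub> g i f'" if "i \<in> I" for i f f'
    using M.smult_l_distr[OF cc cc x(1)[OF that]] by (simp add: g_def col_add A_def)
  have g_smult: "g i (y \<odot>\<^bsub>imod n I a b\<^esub> f) = y \<odot>\<^bsub>M\<^esub> g i f"
    if i: "i \<in> I" and f: "f \<in> carrier (imod n I a b)" and y: "y \<in> carrier A" for i f y
  proof -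
    define s where "s v = (\<Sum>j\<in>{1..n}. y (pth j v) * f (prod_encode (i, j)))" for v
    \<comment> \<open>\<open>r\<close> collects the part of the product that runs past the end of
      the interval. The action on the interval module drops it; in \<open>M\<close> it factors
      through the path from \<open>a i\<close> to \<open>b i\<close> and hence kills
      \<open>x i\<close>.\<close>
    define r where "r v = (if b i \<le> v then s v else 0)" for v
    have s0: "s v = 0" if "v < a i" for v
    proof -
      have "y (pth j v) * f (prod_encode (i, j)) = 0" for j
        using algebra_A_out[OF y[unfolded A_def], of j v] imod_out[OF f, of i j] that by fastforce
      then show ?thesis unfolding s_def by (simp only: sum.neutral_const)
    qed
    have eq: "s v = (y \<odot>\<^bsub>imod n I a b\<^esub> f) (prod_encode (i, v)) + r v" for v
      using i s0[of v] by (auto simp: imod_smult s_def r_def)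
    have "y \<odot>\<^bsub>M\<^esub> g i f = (y \<otimes>\<^bsub>A\<^esub> col n (a i) (\<lambda>v. f (prod_encode (i, v)))) \<odot>\<^bsub>M\<^esub> x i"
      unfolding g_def using M.smult_assoc1[OF y cc x(1)[OF i]] by simp
    also have "y \<otimes>\<^bsub>A\<^esub> col n (a i) (\<lambda>v. f (prod_encode (i, v))) = col n (a i) s"
      unfolding A_def s_def by (rule mult_col) (use y val[OF i] imod_out[OF f] in \<open>auto simp:
          A_def\<close>)
    also have "s = (\<lambda>v. (y \<odot>\<^bsub>imod n I a b\<^esub> f) (prod_encode (i, v)) + r v)" using eq by auto
    also have "col n (a i) \<dots> \<odot>\<^bsub>M\<^esub> x i = g i (y \<odot>\<^bsub>imod n I a b\<^esub> f) \<oplus>\<^bsub>M\<^esub> col n (a i) r \<odot>\<^bsub>M\<^esub> x i"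
      unfolding col_add g_def by (rule M.smult_l_distr[OF cc cc x(1)[OF i], unfolded A_def])
    also have "col n (a i) r = col n (b i) r \<otimes>\<^bsub>A\<^esub> pel n (a i) (b i) 1"
      unfolding A_def by (rule col_pel) (use val[OF i] in \<open>auto simp: r_def\<close>)
    also have "\<dots> \<odot>\<^bsub>M\<^esub> x i = \<zero>\<^bsub>M\<^esub>"
      using M.smult_assoc1[OF cc _ x(1)[OF i]] x(3)[OF i] cc by (simp add: A_def)
    finally show ?thesis using gc[OF i] by simp
  qed
  have Pi: "(\<lambda>i. g i f) \<in> I \<rightarrow> carrier M" for f using gc by auto
  have "(\<lambda>f\<in>carrier (imod n I a b). finsum M (\<lambda>i. g i f) I) \<in> module_hom A (imod n I a b) M"
  proof (rule left_module_homI)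
    show "left_module A (imod n I a b)" unfolding A_def by (rule imod_left_module[OF v])
    fix f :: "nat \<Rightarrow> 'k" assume f: "f \<in> carrier (imod n I a b)"
    show "finsum M (\<lambda>i. g i f) I \<in> carrier M" by (rule M.finsum_closed[OF Pi])
    show "finsum M (\<lambda>i. g i (f \<oplus>\<^bsub>imod n I a b\<^esub> f')) I = finsum M (\<lambda>i. g i f) I \<oplus>\<^bsub>M\<^esub> finsum M (\<lambda>i. g i
        f') I" for f' :: "nat \<Rightarrow> 'k"
    proof -
      have "finsum M (\<lambda>i. g i (f \<oplus>\<^bsub>imod n I a b\<^esub> f')) I = finsum M (\<lambda>i. g i f \<oplus>\<^bsub>M\<^esub> g i f') I"
        by (rule M.finsum_cong') (use gc in \<open>auto simp: g_add\<close>)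
      also have "\<dots> = finsum M (\<lambda>i. g i f) I \<oplus>\<^bsub>M\<^esub> finsum M (\<lambda>i. g i f') I"
        by (rule M.finsum_addf[OF Pi Pi])
      finally show ?thesis .
    qed
    fix y assume y: "y \<in> carrier A"
    have "finite J \<Longrightarrow> J \<subseteq> I \<Longrightarrow> finsum M (\<lambda>i. g i (y \<odot>\<^bsub>imod n I a b\<^esub> f)) J = y \<odot>\<^bsub>M\<^esub> finsum M (\<lambda>i. g i f)
        J" for J
    proof (induction J rule: finite_induct)
      case empty
      then show ?case using y by simp
    next
      case (insert i J)
      have P: "(\<lambda>i. g i f) \<in> J \<rightarrow> carrier M" "g i f \<in> carrier M" "i \<in> I"
        "(\<lambda>i. g i (y \<odot>\<^bsub>imod n I a b\<^esub> f)) \<in> J \<rightarrow> carrier M" "g i (y \<odot>\<^bsub>imod n I a b\<^esub> f) \<in> carrier M"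
        using gc insert.prems by auto
      show ?case
        using insert P M.smult_r_distr[OF y P(2) M.finsum_closed[OF P(1)]] g_smult[OF P(3) f y]
        by (simp add: M.finsum_insert)
    qed
    then show "finsum M (\<lambda>i. g i (y \<odot>\<^bsub>imod n I a b\<^esub> f)) I = y \<odot>\<^bsub>M\<^esub> finsum M (\<lambda>i. g i f) I"
      using finI by blast
  qed
  moreover have "finsum M (\<lambda>i. g i (uv i0 (a i0) 1)) I = x i0" if i0: "i0 \<in> I" for i0
  proof -
    have "g i (uv i0 (a i0) 1) = (if i0 = i then x i else \<zero>\<^bsub>M\<^esub>)" if i: "i \<in> I" for i
    proof (cases "i = i0")
      case True
      have "col n (a i) (\<lambda>v. uv i (a i) 1 (prod_encode (i, v))) = (pel n (a i) (a i) 1 :: _ \<Rightarrow> 'k)"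
        by (rule algebra_A_ext[of _ n]) (auto simp: col_coeff pel_coeff)
      then show ?thesis using True x(2)[OF i] by (simp add: g_def)
    next
      case False
      then show ?thesis using x(1)[OF i] M.smult_l_null[OF x(1)[OF i]]
          by (simp add: g_def col_zero A_def)
    qed
    then have "finsum M (\<lambda>i. g i (uv i0 (a i0) 1)) I = finsum M (\<lambda>i. if i0 = i then x i else \<zero>\<^bsub>M\<^esub>) I"
      using x(1) by (intro M.finsum_cong') auto
    also have "\<dots> = x i0" by (rule M.finsum_singleton[OF i0 finI]) (use x in auto)
    finally show ?thesis .
  qed
  ultimately show thesis using that[of "\<lambda>f\<in>carrier (imod n I a b). finsum M (\<lambda>i. g i f) I"] val
    by (auto simp: uv_carrier)
qed

section \<open>Decomposition into interval modules\<close>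

lemma module_isoI:
  assumes "left_module R M" "left_module R N" "f \<in> module_hom R M N" "g \<in> module_hom R N M"
    and "\<And>x. x \<in> carrier M \<Longrightarrow> g (f x) = x" "\<And>y. y \<in> carrier N \<Longrightarrow> f (g y) = y"
  shows "module_iso R M N"
  unfolding module_iso_def
proof (rule bexI[OF _ assms(3)])
  show "bij_betw f (carrier M) (carrier N)"
    by (rule bij_betwI[where g = g]) (use assms module_homD(1) in auto)
qed

lemma iso_class_eq_iff:
  assumes "left_module R M" "left_module R N"
  shows "iso_class R M = iso_class R N \<longleftrightarrow> module_iso R M N"
proof
  assume "iso_class R M = iso_class R N"
  moreover have "N \<in> iso_class R N" using assms module_iso_refl by (simp add: iso_class_def)
  ultimately show "module_iso R M N" by (auto simp: iso_class_def)
next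
  assume MN: "module_iso R M N"
  note NM = module_iso_sym[OF assms MN]
  show "iso_class R M = iso_class R N"
    unfolding iso_class_def
    using module_iso_trans[OF MN _ assms(1)] module_iso_trans[OF NM _ assms(2)] by blast
qed

text \<open>An element is the sum of its components at the vertices, because the vertex idempotents
  add up to one.\<close>

lemma submodule_from_idempotents:
  fixes n :: nat
  defines "A \<equiv> (algebra_A n :: 'k::field path_alg)"
  assumes M: "left_module A M" and N: "submodule N A M" and x: "x \<in> carrier M"
    and e: "\<And>j. 1 \<le> j \<Longrightarrow> j \<le> n \<Longrightarrow> pel n j j 1 \<odot>\<^bsub>M\<^esub> x \<in> N"
  shows "x \<in> N"
proof -
  interpret left_module A M by (rule M)
  note S = submoduleD[OF N]
  have p: "(\<lambda>i. pel n i i 1) \<in> X \<rightarrow> carrier A" for X by (simp add: A_def)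
  have "m \<le> n \<Longrightarrow> finsum A (\<lambda>i. pel n i i 1) {1..m} \<odot>\<^bsub>M\<^esub> x \<in> N" for m
  proof (induction m)
    case 0
    have "finsum A (\<lambda>i. pel n i i 1) {} = \<zero>\<^bsub>A\<^esub>" by (rule R.finsum_empty)
    then show ?case using x S(2) by simp
  next
    case (Suc m)
    have "{1..Suc m} = insert (Suc m) {1..m}" by auto
    then have "finsum A (\<lambda>i. pel n i i 1) {1..Suc m} = pel n (Suc m) (Suc m) 1 \<oplus>\<^bsub>A\<^esub> finsum A (\<lambda>i.
        pel n i i 1) {1..m}"
      using R.finsum_insert[of "{1..m}" "Suc m" "\<lambda>i. pel n i i 1"] p by (simp add: A_def)
    moreover have "pel n (Suc m) (Suc m) 1 \<in> carrier A" by (simp add: A_def)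
    ultimately show ?case
      using Suc smult_l_distr[OF _ R.finsum_closed[OF p] x] e[of "Suc m"] S(3) by simp
  qed
  from this[of n] show ?thesis using x sum_pel_one[where 'k = 'k, of n]
      by (simp add: A_def[symmetric])
qed

lemma pel_pel_smult:
  assumes "left_module (algebra_A n) M" "x \<in> carrier M" "i \<le> j" "j \<le> k"
  shows "pel n j k c \<odot>\<^bsub>M\<^esub> (pel n i j d \<odot>\<^bsub>M\<^esub> x) = pel n i k (c * d) \<odot>\<^bsub>M\<^esub> x"
  using left_module.smult_assoc1[OF assms(1) pel_carrier[of n j k c] pel_carrier[of n i j d]
      assms(2)]
    pel_mult[OF assms(3,4), of n c d] by simp

text \<open>A generator of \<open>M\<close> may have components at several vertices, so it is
  replaced by these components. The one at \<open>j\<close> is the image of the generator of the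
  projective at \<open>j\<close>, whose relation is vacuous.\<close>

lemma fin_gen_surj:
  fixes n :: nat
  defines "A \<equiv> (algebra_A n :: 'k::field path_alg)"
  assumes fg: "fin_gen_module A M"
  obtains I a \<Phi> where "ivalid n I a (\<lambda>_. Suc n)" "\<Phi> \<in> module_hom A (imod n I a (\<lambda>_. Suc n)) M"
    "\<Phi> ` carrier (imod n I a (\<lambda>_. Suc n)) = carrier M"
proof -
  obtain S where S: "finite S" "S \<subseteq> carrier M" "\<And>N. submodule N A M \<Longrightarrow> S \<subseteq> N \<Longrightarrow> N = carrier M"
    and M: "left_module A M" using fg unfolding fin_gen_module_def by auto
  interpret M: left_module A M by (rule M)
  obtain h where h: "bij_betw h {0..<card S} S" using ex_bij_betw_nat_finite[OF S(1)] by blast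
  \<comment> \<open>An index encodes the number of the generator and the vertex of the
    component.\<close>
  define I where "I = prod_encode ` ({0..<card S} \<times> {1..n})"
  define a where "a k = snd (prod_decode k)" for k
  define x where "x k = pel n (a k) (a k) 1 \<odot>\<^bsub>M\<^esub> h (fst (prod_decode k))" for k
  have v: "ivalid n I a (\<lambda>_. Suc n)" by (auto simp: ivalid_def I_def a_def)
  have hc: "h (fst (prod_decode k)) \<in> carrier M" if "k \<in> I" for k
    using that S(2) h by (auto simp: I_def bij_betw_def)
  have pA: "pel n i j c \<in> carrier A" for i j c by (simp add: A_def)
  have xc: "x k \<in> carrier M" if "k \<in> I" for k using hc[OF that] pA by (simp add: x_def)
  have xe: "pel n (a k) (a k) 1 \<odot>\<^bsub>M\<^esub> x k = x k" if "k \<in> I" for k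
    unfolding x_def using pel_pel_smult[OF M[unfolded A_def] hc[OF that]] by simp
  have x0: "pel n (a k) (Suc n) 1 \<odot>\<^bsub>M\<^esub> x k = \<zero>\<^bsub>M\<^esub>" if "k \<in> I" for k
    using M.smult_l_null[OF xc[OF that]] by (simp add: pel_out A_def)
  obtain \<Phi> where \<Phi>: "\<Phi> \<in> module_hom A (imod n I a (\<lambda>_. Suc n)) M" "\<And>k. k \<in> I \<Longrightarrow> \<Phi> (uv k (a k) 1)
      = x k"
    using imod_hom_ex[OF v M[unfolded A_def], of x] xc xe x0 unfolding A_def by metis
  have Ml: "left_module A (imod n I a (\<lambda>_. Suc n))" unfolding A_def by (rule imod_left_module[OF v])
  interpret I: left_module A "imod n I a (\<lambda>_. Suc n)" by (rule Ml)
  have "\<Phi> ` carrier (imod n I a (\<lambda>_. Suc n)) = carrier M"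
  proof (rule S(3)[OF module_hom_image_submodule[OF Ml M \<Phi>(1) I.carrier_submodule]], rule subsetI)
    fix s assume s: "s \<in> S"
    then obtain m where m: "m < card S" "s = h m" using h unfolding bij_betw_def by fastforce
    show "s \<in> \<Phi> ` carrier (imod n I a (\<lambda>_. Suc n))"
    proof (rule submodule_from_idempotents[OF M[unfolded A_def] module_hom_image_submodule[OF Ml M
        \<Phi>(1) I.carrier_submodule, unfolded A_def]])
      show "s \<in> carrier M" using s S(2) by auto
      fix j assume j: "1 \<le> j" "j \<le> n"
      then have k: "prod_encode (m, j) \<in> I" using m by (auto simp: I_def)
      have "pel n j j 1 \<odot>\<^bsub>M\<^esub> s = \<Phi> (uv (prod_encode (m, j)) (a (prod_encode (m, j))) 1)"
        unfolding \<Phi>(2)[OF k] by (simp add: x_def a_def m)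
      moreover have "uv (prod_encode (m, j)) (a (prod_encode (m, j))) 1 \<in> carrier (imod n I a (\<lambda>_.
          Suc n))"
        using j by (intro uv_carrier k) (auto simp: a_def)
      ultimately show "pel n j j 1 \<odot>\<^bsub>M\<^esub> s \<in> \<Phi> ` carrier (imod n I a (\<lambda>_. Suc n))" by blast
    qed
  qed
  then show thesis using that v \<Phi>(1) by blast
qed

lemma pel_one_uv:
  assumes "ivalid n I a b" "i \<in> I"
  shows "pel n (a i) (a i) 1 \<odot>\<^bsub>imod n I a b\<^esub> uv i (a i) 1 = uv i (a i) 1"
    "pel n (a i) (b i) c \<odot>\<^bsub>imod n I a b\<^esub> uv i (a i) d = (\<lambda>_. 0)"
    "a i \<le> j \<Longrightarrow> j < b i \<Longrightarrow> pel n (a i) j c \<odot>\<^bsub>imod n I a b\<^esub> uv i (a i) d = uv i j (c * d)"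
    "uv i (a i) c \<in> carrier (imod n I a b)"
proof -
  interpret left_module "algebra_A n" "imod n I a b" by (rule imod_left_module[OF assms(1)])
  have v: "1 \<le> a i" "a i < b i" "b i \<le> Suc n" using assms by (auto simp: ivalid_def)
  show "pel n (a i) (a i) 1 \<odot>\<^bsub>imod n I a b\<^esub> uv i (a i) 1 = uv i (a i) 1"
    using v assms(2) by (simp add: pel_smult_uv)
  show "a i \<le> j \<Longrightarrow> j < b i \<Longrightarrow> pel n (a i) j c \<odot>\<^bsub>imod n I a b\<^esub> uv i (a i) d = uv i j (c * d)"
    using v assms(2) by (simp add: pel_smult_uv)
  show c: "uv i (a i) c \<in> carrier (imod n I a b)" for c using v assms(2) by (simp add: uv_carrier)
  show "pel n (a i) (b i) c \<odot>\<^bsub>imod n I a b\<^esub> uv i (a i) d = (\<lambda>_. 0)"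
  proof (cases "b i \<le> n")
    case True
    then show ?thesis using v by (simp add: pel_smult_uv)
  next
    case False
    then show ?thesis using smult_l_null[OF c] by (simp add: pel_out)
  qed
qed

text \<open>
  A surjection from a sum of interval modules that kills a combination of path multiples of
  generators can be replaced by one from a smaller sum: the combination is a path multiple of a
  combination of generators whose interval starts last, and that combination can replace
  this generator.
\<close>

lemma surj_imp_iso:
  fixes n :: nat
  defines "A \<equiv> (algebra_A n :: 'k::field path_alg)"
  assumes M: "left_module A M" and "ivalid n I a b" "\<Phi> \<in> module_hom A (imod n I a b) M"
    "\<Phi> ` carrier (imod n I a b) = carrier M"
  shows "\<exists>I a b. ivalid n I a b \<and> module_iso A (imod n I a b) M"
  using assms(3-)
\<comment> \<open>The total length of the intervals decreases: each round cuts one of them or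
  removes it.\<close>
proof (induction "\<Sum>i\<in>I. b i - a i" arbitrary: I b \<Phi> rule: less_induct)
  case less
  note v = less.prems(1) and \<Phi> = less.prems(2,3)
  interpret M: left_module A M by (rule M)
  let ?D = "imod n I a b"
  have Dl: "left_module A ?D" unfolding A_def by (rule imod_left_module[OF v])
  interpret D: left_module A ?D by (rule Dl)
  note h = module_homD[OF \<Phi>(1)]
  have val: "1 \<le> a i" "a i < b i" "b i \<le> Suc n" if "i \<in> I" for i using that v
      by (auto simp: ivalid_def)
  have finI: "finite I" using v by (simp add: ivalid_def)
  have pA: "pel n i j c \<in> carrier A" for i j c by (simp add: A_def)
  show ?case
  proof (cases "inj_on \<Phi> (carrier ?D)")
    case True
    then have "module_iso A ?D M" using \<Phi> unfolding module_iso_def by (auto simp: bij_betw_def)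
    then show ?thesis using v by blast
  next
    case False
    then obtain f where f: "f \<in> carrier ?D" "\<Phi> f = \<zero>\<^bsub>M\<^esub>" "f \<noteq> (\<lambda>_. 0)"
      unfolding module_hom_inj_iff[OF Dl M \<Phi>(1)] by auto
    then obtain i1 j where ij: "f (prod_encode (i1, j)) \<noteq> 0" using imod_ext[of f "\<lambda>_. 0"] by auto
    then have i1: "i1 \<in> I" "a i1 \<le> j" "j < b i1" using imod_out[OF f(1)] by blast+
    have j: "1 \<le> j" "j \<le> n" using val[OF i1(1)] i1 by auto
    \<comment> \<open>Acting with the idempotent at \<open>j\<close> stays in the kernel and leaves
      only the coordinates at \<open>j\<close>, one of which is nonzero.\<close>
    define g where "g = pel n j j 1 \<odot>\<^bsub>?D\<^esub> f"
    have g: "g \<in> carrier ?D" "\<Phi> g = \<zero>\<^bsub>M\<^esub>"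
      using f h(3)[OF pA f(1)] pA D.smult_closed by (auto simp: g_def)
    have g_lev: "g (prod_encode (i, l)) = 0" if "l \<noteq> j" for i l
      using j that by (simp add: g_def pel_smult)
    have g1: "g (prod_encode (i1, j)) \<noteq> 0" using j i1 ij by (simp add: g_def pel_smult)
    define S where "S = {i \<in> I. g (prod_encode (i, j)) \<noteq> 0}"
    have "finite S" "S \<noteq> {}" using finI i1 g1 by (auto simp: S_def)
    then have "Max (a ` S) \<in> a ` S" "\<And>i. i \<in> S \<Longrightarrow> a i \<le> Max (a ` S)" by simp_all
    then obtain i0 where i0: "i0 \<in> S" "\<And>i. i \<in> S \<Longrightarrow> a i \<le> a i0" by force
    have i0': "i0 \<in> I" "g (prod_encode (i0, j)) \<noteq> 0" "a i0 \<le> j" "j < b i0"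
      using i0(1) imod_out[OF g(1), of i0 j] by (auto simp: S_def)
    \<comment> \<open>\<open>t\<close> carries the coordinates of \<open>g\<close> back from
      \<open>j\<close> to the vertex \<open>a i0\<close>. This stays inside the cells because
      \<open>a i0\<close> is the latest start among the summands that occur in
      \<open>g\<close>.\<close>
    define t where "t k = (if snd (prod_decode k) = a i0 then g (prod_encode (fst (prod_decode k),
        j)) else 0)" for k
    have t: "t (prod_encode (i, l)) = (if l = a i0 then g (prod_encode (i, j)) else 0)" for i l
      by (simp add: t_def)
    have tc: "t \<in> carrier ?D"
      unfolding imod_carrier
    proof (intro allI impI)
      fix k assume k: "t k \<noteq> 0"
      obtain i l where il: "k = prod_encode (i, l)" by (metis prod_decode_inverse surj_pair)
      have l: "l = a i0" "g (prod_encode (i, j)) \<noteq> 0" using k by (auto simp: il t split: if_splits)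
      then have "i \<in> I \<and> a i \<le> j \<and> j < b i" using imod_out[OF g(1), of i j] by blast
      moreover have "i \<in> S" using l calculation by (simp add: S_def)
      ultimately show "k \<in> cells I a b" using i0(2)[of i] i0'(3) l by (simp add: il)
    qed
    have te: "pel n (a i0) (a i0) 1 \<odot>\<^bsub>?D\<^esub> t = t"
    proof (rule imod_ext)
      fix i l
      show "(pel n (a i0) (a i0) 1 \<odot>\<^bsub>?D\<^esub> t) (prod_encode (i, l)) = t (prod_encode (i, l))"
        using val[OF i0'(1)] imod_out[OF tc, of i l] by (auto simp: pel_smult t)
    qed
    have tj: "pel n (a i0) j 1 \<odot>\<^bsub>?D\<^esub> t = g"
    proof (rule imod_ext)
      fix i l
      show "(pel n (a i0) j 1 \<odot>\<^bsub>?D\<^esub> t) (prod_encode (i, l)) = g (prod_encode (i, l))"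
        using val[OF i0'(1)] imod_out[OF g(1), of i l] j i0'(3) g_lev[of l i]
            by (auto simp: pel_smult t)
    qed
    \<comment> \<open>The path from \<open>a i0\<close> to \<open>j\<close> takes \<open>t\<close>
      to \<open>g\<close>, which is zero in \<open>M\<close>, so a generator sent to the image of
      \<open>t\<close> allows the interval of \<open>i0\<close> to be cut off at \<open>j\<close>.
      If the interval starts at \<open>j\<close>, nothing is left and the index is dropped.\<close>
    define I' where "I' = {i \<in> I. i = i0 \<longrightarrow> a i0 < j}"
    define b' where "b' = b(i0 := j)"
    have v': "ivalid n I' a b'" using v j by (auto simp: ivalid_def I'_def b'_def)
    define u where "u i = (if i = i0 then t else uv i (a i) 1)" for i
    have u: "u i \<in> carrier ?D" "pel n (a i) (a i) 1 \<odot>\<^bsub>?D\<^esub> u i = u i" if "i \<in> I" for i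
      using that tc te pel_one_uv[OF v that] by (auto simp: u_def)
    have u0: "\<Phi> (pel n (a i) (b' i) 1 \<odot>\<^bsub>?D\<^esub> u i) = \<zero>\<^bsub>M\<^esub>" if "i \<in> I" for i
      using that tj g(2) module_hom_zero[OF Dl M \<Phi>(1)]
      by (auto simp: u_def b'_def pel_one_uv(2)[OF v that])
    have sub: "i \<in> I" if "i \<in> I'" for i using that by (simp add: I'_def)
    obtain \<Psi> where \<Psi>: "\<Psi> \<in> module_hom A (imod n I' a b') M" "\<And>i. i \<in> I' \<Longrightarrow> \<Psi> (uv i (a i) 1)
        = \<Phi> (u i)"
    proof (rule imod_hom_ex[OF v' M[unfolded A_def], of "\<lambda>i. \<Phi> (u i)"])
      fix i assume "i \<in> I'"
      then have i: "i \<in> I" by (rule sub)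
      show "\<Phi> (u i) \<in> carrier M" using h(1) u(1)[OF i] by blast
      show "pel n (a i) (a i) 1 \<odot>\<^bsub>M\<^esub> \<Phi> (u i) = \<Phi> (u i)" using h(3)[OF pA u(1)[OF i]] u(2)[OF i]
          by metis
      show "pel n (a i) (b' i) 1 \<odot>\<^bsub>M\<^esub> \<Phi> (u i) = \<zero>\<^bsub>M\<^esub>" using h(3)[OF pA u(1)[OF i]] u0[OF i] by metis
    qed (auto simp: A_def)
    let ?D' = "imod n I' a b'"
    have Dl': "left_module A ?D'" unfolding A_def by (rule imod_left_module[OF v'])
    interpret D': left_module A ?D' by (rule Dl')
    define N where "N = \<Psi> ` carrier ?D'"
    have N: "submodule N A M" unfolding N_def by (rule module_hom_image_submodule[OF Dl' M \<Psi>(1)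
        D'.carrier_submodule])
    \<comment> \<open>Surjectivity of \<open>\<Psi>\<close> amounts to \<open>X\<close> being all of
      \<open>?D\<close>, and for this it suffices that \<open>X\<close> contains every old
      generator.\<close>
    define X where "X = {f \<in> carrier ?D. \<Phi> f \<in> N}"
    have X: "submodule X A ?D" unfolding X_def by (rule module_hom_vimage_submodule[OF Dl M \<Phi>(1) N])
    note XS = submoduleD[OF X]
    have uX: "u i \<in> X" if i: "i \<in> I" for i
    proof (cases "i \<in> I'")
      case True
      have "uv i (a i) 1 \<in> carrier ?D'" using pel_one_uv(4)[OF v' True] .
      then have "\<Phi> (u i) \<in> N" unfolding N_def using \<Psi>(2)[OF True] by (metis image_eqI)
      then show ?thesis using u(1)[OF i] by (simp add: X_def)
    next
      case False
      then have "i = i0" "a i0 = j" using i i0'(3) by (auto simp: I'_def)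
      then have "u i = g" using tj te by (simp add: u_def)
      then show ?thesis using g submoduleD(2)[OF N] by (simp add: X_def)
    qed
    have "uv i (a i) 1 \<in> X" if i: "i \<in> I" for i
    proof (cases "i = i0")
      case False
      then show ?thesis using uX[OF i] by (simp add: u_def)
    next
      case True
      \<comment> \<open>The old generator of \<open>i0\<close> is recovered from \<open>t\<close>:
        the other coordinates of \<open>t\<close> belong to path multiples of generators that
        already lie in \<open>X\<close>, and the remaining coefficient \<open>c\<close> is
        invertible.\<close>
      define t' where "t' = t(prod_encode (i0, a i0) := 0)"
      define c where "c = g (prod_encode (i0, j))"
      have t'X: "t' \<in> X"
        unfolding A_def
      proof (rule imod_submodule_supp[OF v X[unfolded A_def]])
        show "t' \<in> carrier ?D" using tc unfolding t'_def imod_carrier by auto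
        fix i l assume nz: "t' (prod_encode (i, l)) \<noteq> 0"
        then have "t (prod_encode (i, l)) \<noteq> 0" and ne: "(i, l) \<noteq> (i0, a i0)"
            by (auto simp: t'_def split: if_splits)
        then have cell: "i \<in> I" "a i \<le> l" "l < b i" and "l = a i0"
          using imod_out[OF tc, of i l] by (auto simp: t split: if_splits)
        then have "u i = uv i (a i) 1" using ne by (auto simp: u_def)
        then show "uv i l 1 \<in> X"
          using imod_uv_gen[OF v X[unfolded A_def] _ cell] uX[OF cell(1)] by simp
      qed
      have tX: "t \<in> X" using uX[OF i0'(1)] by (simp add: u_def)
      have eq: "t \<oplus>\<^bsub>?D\<^esub> (\<ominus>\<^bsub>A\<^esub> \<one>\<^bsub>A\<^esub>) \<odot>\<^bsub>?D\<^esub> t' = uv i0 (a i0) c"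
      proof -
        have "t' \<in> carrier ?D" using \<open>t' \<in> X\<close> by (simp add: X_def)
        then have neg: "(\<ominus>\<^bsub>A\<^esub> \<one>\<^bsub>A\<^esub>) \<odot>\<^bsub>?D\<^esub> t' = \<ominus>\<^bsub>?D\<^esub> t'" by (rule D.smult_minus_one)
        have "t = uv i0 (a i0) c \<oplus>\<^bsub>?D\<^esub> t'" by (auto simp: fun_eq_iff t'_def uv_def t c_def)
        then have "t \<oplus>\<^bsub>?D\<^esub> \<ominus>\<^bsub>?D\<^esub> t' = (uv i0 (a i0) c \<oplus>\<^bsub>?D\<^esub> t') \<oplus>\<^bsub>?D\<^esub> \<ominus>\<^bsub>?D\<^esub> t'" by (rule arg_cong)
        also have "\<dots> = uv i0 (a i0) c"
          using \<open>t' \<in> carrier ?D\<close> pel_one_uv(4)[OF v i0'(1), of c]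
          by (simp only: D.M.a_assoc D.M.r_neg D.M.a_inv_closed D.M.r_zero)
        finally show ?thesis unfolding neg .
      qed
      have "\<ominus>\<^bsub>A\<^esub> \<one>\<^bsub>A\<^esub> \<in> carrier A" by simp
      from XS(3)[OF tX XS(4)[OF this t'X]] have "uv i0 (a i0) c \<in> X" unfolding eq .
      then have "pel n (a i0) (a i0) (1 / c) \<odot>\<^bsub>?D\<^esub> uv i0 (a i0) c \<in> X" using XS(4)[OF pA] by blast
      moreover have "pel n (a i0) (a i0) (1 / c) \<odot>\<^bsub>?D\<^esub> uv i0 (a i0) c = uv i0 (a i0) 1"
        using pel_one_uv(3)[OF v i0'(1), of "a i0" "1 / c" c] val[OF i0'(1)] i0'(2)
            by (simp add: c_def)
      ultimately show ?thesis using True by simp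
    qed
    then have "X = carrier ?D" using imod_generated[OF v X[unfolded A_def]] by blast
    moreover have "\<Phi> ` X \<subseteq> N" by (auto simp: X_def)
    ultimately have "carrier M \<subseteq> N" using \<Phi>(2) by simp
    then have surj: "\<Psi> ` carrier ?D' = carrier M"
      using submoduleD(1)[OF N] unfolding N_def by blast
    have "(\<Sum>i\<in>I'. b' i - a i) \<le> (\<Sum>i\<in>I. b' i - a i)"
      by (rule sum_mono2) (use finI in \<open>auto simp: I'_def\<close>)
    also have "\<dots> < (\<Sum>i\<in>I. b i - a i)"
    proof (rule sum_strict_mono_ex1[OF finI])
      show "\<forall>i\<in>I. b' i - a i \<le> b i - a i" using i0' by (auto simp: b'_def)
      show "\<exists>i\<in>I. b' i - a i < b i - a i"
        using i0' by (intro bexI[of _ i0]) (auto simp: b'_def)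
    qed
    finally show ?thesis using less.hyps v' \<Psi>(1) surj by blast
  qed
qed

text \<open>The existence half of the Krull--Schmidt theorem: a surjection from a sum of projectives
  is shrunk until it is injective.\<close>

theorem fin_gen_decomposition:
  fixes n :: nat
  defines "A \<equiv> (algebra_A n :: 'k::field path_alg)"
  assumes "fin_gen_module A M"
  obtains I a b where "ivalid n I a b" "module_iso A (imod n I a b) M"
proof -
  have M: "left_module A M" using assms(2) by (simp add: fin_gen_module_def)
  obtain I a \<Phi> where "ivalid n I a (\<lambda>_. Suc n)" "\<Phi> \<in> module_hom A (imod n I a (\<lambda>_. Suc n)) M"
    "\<Phi> ` carrier (imod n I a (\<lambda>_. Suc n)) = carrier M"
    using fin_gen_surj[OF assms(2)[unfolded A_def]] unfolding A_def by blast
  then have "\<exists>I a b. ivalid n I a b \<and> module_iso A (imod n I a b) M"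
    using surj_imp_iso[OF M[unfolded A_def]] unfolding A_def by blast
  then show thesis using that by blast
qed

section \<open>Single interval modules\<close>

abbreviation iv :: "nat \<Rightarrow> nat \<Rightarrow> nat \<Rightarrow> 'k::field rep" where
  "iv n a b \<equiv> imod n {0} (\<lambda>_. a) (\<lambda>_. b)"

lemma iv_valid: "1 \<le> a \<Longrightarrow> a < b \<Longrightarrow> b \<le> Suc n \<Longrightarrow> ivalid n {0} (\<lambda>_. a) (\<lambda>_. b)"
  by (simp add: ivalid_def)

lemma level_zero:
  assumes "pel n j j 1 \<odot>\<^bsub>imod n I a b\<^esub> f = f" "1 \<le> j" "j \<le> n" "l \<noteq> j"
  shows "f (prod_encode (i, l)) = 0"
  using pel_smult[where j = j and l = j and l' = l and n = n and c = 1 and I = I and a = a and b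
      = b and f = f and i = i] assms by simp

text \<open>
  The component of \<open>w\<close> in a summand \<open>i\<close> is killed by every homomorphism to the interval module
  of \<open>{a0..<b0}\<close> if \<open>a i < a0\<close>, or if \<open>a i = a0\<close> and \<open>b i < b0\<close>.
\<close>

lemma interval_component:
  fixes n :: nat
  defines "A \<equiv> (algebra_A n :: 'k::field path_alg)"
  assumes v: "ivalid n I a b" and v0: "1 \<le> a0" "a0 < b0" "b0 \<le> Suc n"
    and r: "r \<in> module_hom A (imod n I a b) (iv n a0 b0)"
    and w: "w \<in> carrier (imod n I a b)" "pel n a0 a0 1 \<odot>\<^bsub>imod n I a b\<^esub> w = w"
      "pel n a0 b0 1 \<odot>\<^bsub>imod n I a b\<^esub> w = (\<lambda>_. 0)"
    and rw: "r w \<noteq> (\<lambda>_. 0)"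
  shows "\<exists>i\<in>I. a i = a0 \<and> b i = b0 \<and> w (prod_encode (i, a0)) \<noteq> 0"
proof (rule ccontr)
  assume neg: "\<not> ?thesis"
  let ?D = "imod n I a b" and ?N = "iv n a0 b0 :: 'k rep"
  have Dl: "left_module A ?D" unfolding A_def by (rule imod_left_module[OF v])
  have Nl: "left_module A ?N" unfolding A_def by (rule imod_left_module[OF iv_valid[OF v0]])
  interpret D: left_module A ?D by (rule Dl)
  interpret N: left_module A ?N by (rule Nl)
  note h = module_homD[OF r] and hz = module_hom_zero[OF Dl Nl r]
  have pA: "pel n i j c \<in> carrier A" for i j c by (simp add: A_def)
  have "w \<in> a_kernel ?D ?N r"
  proof (rule imod_submodule_supp[OF v module_hom_kernel_submodule[OF Dl Nl r, unfolded A_def]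
      w(1)])
    fix i j assume nz: "w (prod_encode (i, j)) \<noteq> 0"
    then have j: "j = a0" using level_zero[OF w(2)] v0 by fastforce
    have i: "i \<in> I" "a i \<le> a0" "a0 < b i" using nz imod_out[OF w(1), of i j] j by blast+
    have val: "1 \<le> a i" "a i < b i" "b i \<le> Suc n" using i(1) v by (auto simp: ivalid_def)
    \<comment> \<open>On a summand that still contains \<open>b0\<close> the path from
      \<open>a0\<close> to \<open>b0\<close> acts injectively, but it kills
      \<open>w\<close>.\<close>
    have "b i \<le> b0"
    proof (rule ccontr)
      assume "\<not> b i \<le> b0"
      then have "(pel n a0 b0 1 \<odot>\<^bsub>?D\<^esub> w) (prod_encode (i, b0)) = w (prod_encode (i, a0))"
        using i v0 val by (simp add: pel_smult)
      then show False using nz j by (simp add: w(3))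
    qed
    define y where "y = r (uv i (a i) 1)"
    note p = pel_one_uv[OF v i(1)]
    have yc: "y \<in> carrier ?N" unfolding y_def by (rule h(1)[OF p(4)])
    have ye: "pel n (a i) (a i) 1 \<odot>\<^bsub>?N\<^esub> y = y" using h(3)[OF pA p(4), of "a i" "a i" 1 1]
        by (simp add: y_def p(1))
    have y0: "y (prod_encode (k, l)) = 0" if "l \<noteq> a i" for k l
      using level_zero[OF ye _ _ that] val by simp
    \<comment> \<open>\<open>y\<close> lives at the vertex \<open>a i\<close>. Before
      \<open>a0\<close> the target has nothing there. If the starts agree, then
      \<open>b i < b0\<close>, and the path to \<open>b i\<close> kills \<open>y\<close> although it
      is injective on the target at \<open>a0\<close>.\<close>
    have "y = (\<lambda>_. 0)"
    proof (cases "a i < a0")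
      case True
      show ?thesis
      proof (rule imod_ext)
        fix k l
        show "y (prod_encode (k, l)) = 0"
          using y0[of l k] imod_out[OF yc, of k l] True by (cases "l = a i") simp_all
      qed
    next
      case False
      then have ai: "a i = a0" using i by simp
      then have bi: "b i < b0" using neg i(1) nz j \<open>b i \<le> b0\<close> by fastforce
      have "pel n (a i) (b i) 1 \<odot>\<^bsub>?N\<^esub> y = (\<lambda>_. 0)"
        using h(3)[OF pA p(4), of "a i" "b i" 1 1] hz by (simp add: y_def p(2))
      moreover have "(pel n (a i) (b i) 1 \<odot>\<^bsub>?N\<^esub> y) (prod_encode (0, b i)) = y (prod_encode (0, a i))"
        using val bi ai v0 by (simp add: pel_smult)
      ultimately have y1: "y (prod_encode (0, a i)) = 0" by simp
      show ?thesis
      proof (rule imod_ext)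
        fix k l
        show "y (prod_encode (k, l)) = 0"
          using y0[of l k] y1 imod_out[OF yc, of k l] by (cases "k = 0") auto
      qed
    qed
    then have "r (pel n (a i) a0 1 \<odot>\<^bsub>?D\<^esub> uv i (a i) 1) = \<zero>\<^bsub>?N\<^esub>"
      using h(3)[OF pA p(4), of "a i" a0 1 1] N.smult_r_null[OF pA] by (simp add: y_def)
    then show "uv i j 1 \<in> a_kernel ?D ?N r"
      using i j by (simp add: a_kernel_def' uv_carrier p(3))
  qed
  then show False using rw by (simp add: a_kernel_def')
qed

text \<open>Pulling the generator of the second module back along an isomorphism gives an element of
  the first that satisfies the same relation and has nonzero image;
  \<open>interval_component\<close> then forces the endpoints to agree.\<close>

lemma iv_iso_iff:
  assumes "1 \<le> a" "a < b" "b \<le> Suc n" "1 \<le> a'" "a' < b'" "b' \<le> Suc n"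
  shows "module_iso (algebra_A n) (iv n a b :: 'k::field rep) (iv n a' b') \<longleftrightarrow> a = a' \<and> b = b'"
proof
  let ?M = "iv n a b :: 'k rep" and ?N = "iv n a' b' :: 'k rep"
  note v = iv_valid[OF assms(1-3)] and v' = iv_valid[OF assms(4-6)]
  note M = imod_left_module[OF v] and N = imod_left_module[OF v']
  assume "module_iso (algebra_A n) ?M ?N"
  then obtain f where f: "f \<in> module_hom (algebra_A n) ?M ?N" "bij_betw f (carrier ?M) (carrier ?N)"
    by (auto simp: module_iso_def)
  define g where "g = (\<lambda>y\<in>carrier ?N. inv_into (carrier ?M) f y)"
  note g = module_hom_inv[OF M N f, folded g_def]
  have p: "uv 0 a' 1 \<in> carrier ?N" "pel n a' a' 1 \<odot>\<^bsub>?N\<^esub> uv 0 a' 1 = (uv 0 a' 1 :: nat \<Rightarrow> 'k)"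
    "pel n a' b' 1 \<odot>\<^bsub>?N\<^esub> uv 0 a' 1 = (\<lambda>_. 0 :: 'k)"
    using pel_one_uv[OF v', of 0] by auto
  have w: "g (uv 0 a' 1) \<in> carrier ?M" "pel n a' a' 1 \<odot>\<^bsub>?M\<^esub> g (uv 0 a' 1) = g (uv 0 a' 1)"
    "pel n a' b' 1 \<odot>\<^bsub>?M\<^esub> g (uv 0 a' 1) = (\<lambda>_. 0)"
    using module_homD(1)[OF g(1) p(1)] module_homD(3)[OF g(1) pel_carrier p(1), of a' a' 1]
      module_homD(3)[OF g(1) pel_carrier p(1), of a' b' 1] module_hom_zero[OF N M g(1)]
    by (simp_all add: p(2,3))
  have "uv 0 a' (1 :: 'k) (prod_encode (0, a')) \<noteq> 0" by simp
  then have "f (g (uv 0 a' 1)) \<noteq> (\<lambda>_. 0)" unfolding g(4)[OF p(1)] by metis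
  from interval_component[OF v assms(4-6) f(1) w this] show "a = a' \<and> b = b'" by auto
next
  assume "a = a' \<and> b = b'"
  then show "module_iso (algebra_A n) (iv n a b :: 'k::field rep) (iv n a' b')"
    using module_iso_refl[OF imod_left_module[OF iv_valid[OF assms(1-3)]]] by simp
qed

lemma iv_not_zero:
  assumes "1 \<le> a" "a < b" "b \<le> Suc n"
  shows "carrier (iv n a b :: 'k::field rep) \<noteq> {\<lambda>_. 0}"
proof -
  have "uv 0 a 1 \<in> carrier (iv n a b :: 'k rep)"
    using assms by (intro uv_carrier) auto
  moreover have "uv 0 a (1 :: 'k) \<noteq> (\<lambda>_. 0)"
    using uv_coeff[of 0 a "1 :: 'k" 0 a] by (metis zero_neq_one)
  ultimately show ?thesis by auto
qed

text \<open>The module is one-dimensional at the vertex \<open>a\<close> and generated there. If the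
  generator is written as a sum along a decomposition, one of the two parts has a nonzero coordinate
  at \<open>a\<close>; its summand contains a multiple of the generator and is everything.\<close>

lemma iv_indecomposable:
  assumes v0: "1 \<le> a" "a < b" "b \<le> Suc n"
  shows "indecomposable (algebra_A n) (iv n a b :: 'k::field rep)"
  unfolding indecomposable_def
proof (intro conjI allI impI)
  let ?A = "algebra_A n :: 'k path_alg"
  let ?M = "iv n a b :: 'k rep"
  show "carrier ?M \<noteq> {\<zero>\<^bsub>?M\<^esub>}" using iv_not_zero[OF v0] by simp
  note v = iv_valid[OF v0]
  note M = imod_left_module[OF v]
  interpret left_module ?A ?M by (rule M)
  note p = pel_one_uv[OF v, of 0, simplified]
  have whole: "N = carrier ?M" if N: "submodule N ?A ?M" "uv 0 a c \<in> N" "c \<noteq> 0" for N c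
  proof (rule imod_generated[OF v N(1)])
    have "pel n a a (1 / c) \<odot>\<^bsub>?M\<^esub> uv 0 a c = uv 0 a 1"
      using p(3)[of a "1 / c" c] v0 N(3) by simp
    then show "uv i ((\<lambda>_. a) i) 1 \<in> N" if "i \<in> {0}" for i
      using submoduleD(4)[OF N(1) pel_carrier N(2), of a a "1 / c"] that by simp
  qed
  fix B C assume dd: "direct_decomp ?A ?M B C"
  then have BC: "submodule B ?A ?M" "submodule C ?A ?M" "B \<inter> C = {\<zero>\<^bsub>?M\<^esub>}"
      by (auto simp: direct_decomp_def)
  obtain x y where xy: "x \<in> B" "y \<in> C" "uv 0 a 1 = x \<oplus>\<^bsub>?M\<^esub> y"
    using dd p(4)[of 1] unfolding direct_decomp_iff[OF M] by blast
  have lev: "pel n a a 1 \<odot>\<^bsub>?M\<^esub> z = uv 0 a (z (prod_encode (0, a)))" if "z \<in> carrier ?M" for z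
  proof (rule imod_ext)
    fix i j
    show "(pel n a a 1 \<odot>\<^bsub>?M\<^esub> z) (prod_encode (i, j)) = uv 0 a (z (prod_encode (0, a))) (prod_encode
        (i, j))"
      using v0 by (auto simp: pel_smult)
  qed
  have 1: "uv 0 a (x (prod_encode (0, a))) \<in> B"
    using submoduleD(4)[OF BC(1) pel_carrier xy(1), of a a 1] lev submoduleD(1)[OF BC(1) xy(1)]
        by simp
  have 2: "uv 0 a (y (prod_encode (0, a))) \<in> C"
    using submoduleD(4)[OF BC(2) pel_carrier xy(2), of a a 1] lev submoduleD(1)[OF BC(2) xy(2)]
        by simp
  have "x (prod_encode (0, a)) + y (prod_encode (0, a)) = 1"
    using fun_cong[OF xy(3), of "prod_encode (0, a)"] by simp
  then have "x (prod_encode (0, a)) \<noteq> 0 \<or> y (prod_encode (0, a)) \<noteq> 0" by auto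
  then have "B = carrier ?M \<or> C = carrier ?M" using whole[OF BC(1) 1] whole[OF BC(2) 2] by blast
  then show "B = {\<zero>\<^bsub>?M\<^esub>} \<or> C = {\<zero>\<^bsub>?M\<^esub>}"
    using BC(3) submoduleD(1)[OF BC(1)] submoduleD(1)[OF BC(2)] by blast
qed

section \<open>Partial sums and the classification of indecomposable modules\<close>

lemma imod_sub_carrier: "J \<subseteq> I \<Longrightarrow> carrier (imod n J a b) \<subseteq> carrier (imod n I a b)"
  by (auto simp: imod_carrier cells_def) blast

lemma imod_sub_smult:
  assumes "J \<subseteq> I" "f \<in> carrier (imod n J a b)"
  shows "x \<odot>\<^bsub>imod n I a b\<^esub> f = x \<odot>\<^bsub>imod n J a b\<^esub> f"
proof (rule imod_ext)
  fix i j
  show "(x \<odot>\<^bsub>imod n I a b\<^esub> f) (prod_encode (i, j)) = (x \<odot>\<^bsub>imod n J a b\<^esub> f) (prod_encode (i, j))"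
    using assms(1) imod_out[OF assms(2), of i] by (auto simp: imod_smult)
qed

lemma imod_sub_submodule:
  assumes "ivalid n I a b" "J \<subseteq> I"
  shows "submodule (carrier (imod n J a b)) (algebra_A n) (imod n I a b)"
proof -
  interpret left_module "algebra_A n" "imod n I a b" by (rule imod_left_module[OF assms(1)])
  have "ivalid n J a b" using assms by (auto simp: ivalid_def intro: finite_subset)
  then interpret J: left_module "algebra_A n" "imod n J a b" by (rule imod_left_module)
  show ?thesis
  proof (rule submoduleI)
    show "x \<oplus>\<^bsub>imod n I a b\<^esub> y \<in> carrier (imod n J a b)"
      if "x \<in> carrier (imod n J a b)" "y \<in> carrier (imod n J a b)" for x y
      using J.M.a_closed[OF that] by simp
    show "c \<odot>\<^bsub>imod n I a b\<^esub> x \<in> carrier (imod n J a b)"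
      if "c \<in> carrier (algebra_A n)" "x \<in> carrier (imod n J a b)" for c x
      using J.smult_closed[OF that] imod_sub_smult[OF assms(2) that(2)] by simp
    show "\<zero>\<^bsub>imod n I a b\<^esub> \<in> carrier (imod n J a b)" using J.M.zero_closed by simp
  qed (rule imod_sub_carrier[OF assms(2)])
qed

lemma imod_sub_iso:
  assumes "ivalid n I a b" "J \<subseteq> I"
  shows "module_iso (algebra_A n) (imod n J a b) (sub_module (imod n I a b) (carrier (imod n J a
      b)))"
proof -
  have vJ: "ivalid n J a b" using assms by (auto simp: ivalid_def intro: finite_subset)
  note S = submodule_left_module[OF imod_left_module[OF assms(1)] imod_sub_submodule[OF assms]]
  show ?thesis
  proof (rule module_isoI[OF imod_left_module[OF vJ] S])
    show "(\<lambda>x\<in>carrier (imod n J a b). x) \<in> module_hom (algebra_A n) (imod n J a b) (sub_module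
        (imod n I a b) (carrier (imod n J a b)))"
      by (rule left_module_homI[OF imod_left_module[OF vJ]]) (auto simp: imod_sub_smult[OF
          assms(2)])
    have "(\<lambda>x\<in>carrier (sub_module (imod n I a b) (carrier (imod n J a b))). x) \<in> module_hom
        (algebra_A n) (sub_module (imod n I a b) (carrier (imod n J a b))) (imod n J a b)"
      by (rule left_module_homI[OF S]) (auto simp: imod_sub_smult[OF assms(2)])
    then show "(\<lambda>x\<in>carrier (imod n J a b). x) \<in> module_hom (algebra_A n) (sub_module (imod n I a
        b) (carrier (imod n J a b))) (imod n J a b)"
      by simp
  qed auto
qed

lemma imod_sub_decomp:
  assumes "ivalid n I a b" "J \<subseteq> I"
  shows "direct_decomp (algebra_A n) (imod n I a b :: 'k::field rep)
    (carrier (imod n J a b)) (carrier (imod n (I - J) a b))"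
  unfolding direct_decomp_iff[OF imod_left_module[OF assms(1)]]
proof (intro conjI ballI)
  let ?A = "algebra_A n :: 'k path_alg"
  let ?I = "imod n I a b :: 'k rep"
  let ?J = "imod n J a b :: 'k rep"
  let ?K = "imod n (I - J) a b :: 'k rep"
  show "submodule (carrier ?J) ?A ?I"
    "submodule (carrier ?K) ?A ?I"
    using assms by (auto intro!: imod_sub_submodule)
  show "carrier ?J \<inter> carrier ?K \<subseteq> {\<zero>\<^bsub>?I\<^esub>}"
  proof
    fix f :: "nat \<Rightarrow> 'k" assume f: "f \<in> carrier ?J \<inter> carrier ?K"
    have "f = (\<lambda>_. 0)"
    proof (rule imod_ext)
      fix i j
      show "f (prod_encode (i, j)) = 0"
        using f imod_out[of f n J a b i j] imod_out[of f n "I - J" a b i j] by blast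
    qed
    then show "f \<in> {\<zero>\<^bsub>?I\<^esub>}" by simp
  qed
  fix f :: "nat \<Rightarrow> 'k" assume f: "f \<in> carrier ?I"
  let ?g = "\<lambda>S k. if fst (prod_decode k) \<in> S then f k else 0"
  have "?g S \<in> carrier (imod n S a b)" if "S \<subseteq> I" for S
    unfolding imod_carrier
  proof (intro allI impI)
    fix k assume k: "?g S k \<noteq> 0"
    obtain i l where il: "k = prod_encode (i, l)" by (metis prod_decode_inverse surj_pair)
    show "k \<in> cells S a b" using k imod_out[OF f, of i l] by (auto simp: il split: if_splits)
  qed
  moreover have "f = ?g J \<oplus>\<^bsub>?I\<^esub> ?g (I - J)"
  proof (rule imod_ext)
    fix i j
    show "f (prod_encode (i, j)) = (?g J \<oplus>\<^bsub>?I\<^esub> ?g (I - J)) (prod_encode (i, j))"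
      using imod_out[OF f, of i j] assms(2) by auto
  qed
  ultimately show "\<exists>x\<in>carrier ?J. \<exists>y\<in>carrier ?K. f = x \<oplus>\<^bsub>?I\<^esub> y"
    using assms(2) by blast
qed

text \<open>Both sides have the same presentation, so each generator can be sent to the other, and
  the two composites fix the generators.\<close>

lemma imod_single_iso:
  assumes v: "ivalid n {i} a b"
  shows "module_iso (algebra_A n) (imod n {i} a b :: 'k::field rep) (iv n (a i) (b i))"
proof -
  let ?A = "algebra_A n :: 'k path_alg"
  let ?M = "imod n {i} a b :: 'k rep" and ?N = "iv n (a i) (b i) :: 'k rep"
  have v': "ivalid n {0} (\<lambda>_. a i) (\<lambda>_. b i)" using v by (simp add: ivalid_def)
  note M = imod_left_module[OF v] and N = imod_left_module[OF v']
  note p = pel_one_uv[OF v, of i, simplified] and q = pel_one_uv[OF v', of 0, simplified]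
  obtain f where f: "f \<in> module_hom ?A ?M ?N" "f (uv i (a i) 1) = uv 0 (a i) 1"
    by (rule imod_hom_ex[OF v N, of "\<lambda>_. uv 0 (a i) 1"]) (auto simp: q)
  obtain g where g: "g \<in> module_hom ?A ?N ?M" "g (uv 0 (a i) 1) = uv i (a i) 1"
    by (rule imod_hom_ex[OF v' M, of "\<lambda>_. uv i (a i) 1"]) (auto simp: p)
  have c1: "compose (carrier ?M) g f = (\<lambda>x\<in>carrier ?M. x)"
    by (rule imod_hom_eqI[OF v M module_hom_compose[OF f(1) g(1) M] module_hom_id[OF M]])
      (use f g in \<open>auto simp: compose_def p\<close>)
  have gf: "g (f x) = x" if "x \<in> carrier ?M" for x
    using fun_cong[OF c1, of x] that by (simp add: compose_eq)
  have c2: "compose (carrier ?N) f g = (\<lambda>x\<in>carrier ?N. x)"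
    by (rule imod_hom_eqI[OF v' N module_hom_compose[OF g(1) f(1) N] module_hom_id[OF N]])
      (use f g in \<open>auto simp: compose_def q\<close>)
  have fg: "f (g x) = x" if "x \<in> carrier ?N" for x
    using fun_cong[OF c2, of x] that by (simp add: compose_eq)
  show ?thesis by (rule module_isoI[OF M N f(1) g(1)]) (erule gf, erule fg)
qed

lemma imod_component_nonzero:
  assumes "ivalid n I a b" "i \<in> I"
  shows "carrier (imod n I a b :: 'k::field rep) \<noteq> {\<lambda>_. 0}"
proof -
  have "uv i (a i) (1 :: 'k) \<noteq> (\<lambda>_. 0)" using uv_coeff[of i "a i" "1 :: 'k" i "a i"]
      by (metis zero_neq_one)
  then show ?thesis using pel_one_uv(4)[OF assms, of "1 :: 'k"] by auto
qed

text \<open>In a decomposition into intervals there is an index to split off, and indecomposability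
  makes its complement vanish.\<close>

lemma indecomposable_iso_iv:
  fixes n :: nat
  defines "A \<equiv> (algebra_A n :: 'k::field path_alg)"
  assumes fg: "fin_gen_module A M" and ind: "indecomposable A M"
  obtains a b where "1 \<le> a" "a < b" "b \<le> Suc n" "module_iso A (iv n a b) M"
proof -
  have M: "left_module A M" using fg by (simp add: fin_gen_module_def)
  obtain I a b where D: "ivalid n I a b" "module_iso A (imod n I a b) M"
    using fin_gen_decomposition[OF fg[unfolded A_def]] unfolding A_def by blast
  let ?D = "imod n I a b :: 'k rep"
  have Dl: "left_module A ?D" unfolding A_def by (rule imod_left_module[OF D(1)])
  have indD: "indecomposable A ?D" using indecomposable_iso[OF Dl M D(2)] ind by simp
  have "I \<noteq> {}"
  proof
    assume "I = {}"
    then have "carrier ?D = {\<zero>\<^bsub>?D\<^esub>}" by (auto simp: imod_carrier cells_def fun_eq_iff)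
    then show False using indD by (simp add: indecomposable_def)
  qed
  then obtain i where i: "i \<in> I" by blast
  have v: "ivalid n {i} a b" "ivalid n (I - {i}) a b" using D(1) i by (auto simp: ivalid_def)
  have "carrier (imod n {i} a b :: 'k rep) = {\<zero>\<^bsub>?D\<^esub>} \<or> carrier (imod n (I - {i}) a b :: 'k rep)
      = {\<zero>\<^bsub>?D\<^esub>}"
    using indD imod_sub_decomp[OF D(1), of "{i}"] i unfolding indecomposable_def A_def by blast
  then have "I - {i} = {}" using imod_component_nonzero[OF v(1)] imod_component_nonzero[OF v(2)]
      by fastforce
  then have I: "I = {i}" using i by auto
  have "module_iso A (iv n (a i) (b i)) ?D"
    unfolding I A_def
    using module_iso_sym[OF imod_left_module[OF v(1)] imod_left_module imod_single_iso[OF v(1)]]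
        v(1)
    by (simp add: ivalid_def)
  then have "module_iso A (iv n (a i) (b i)) M"
    by (rule module_iso_trans[OF _ D(2)]) (use v(1) in \<open>auto simp: A_def ivalid_def intro!:
        imod_left_module\<close>)
  then show thesis using that v(1) by (auto simp: ivalid_def)
qed

section \<open>Indecomposable summands and basic modules\<close>

text \<open>The universal property for modules that are merely isomorphic to a sum of intervals, as
  the terms of a chosen presentation and the projective part of a pair are.\<close>

lemma imod_iso_hom_ex:
  fixes n :: nat
  defines "A \<equiv> (algebra_A n :: 'k::field path_alg)"
  assumes v: "ivalid n I a b" and P: "left_module A P" and M: "left_module A M"
    and \<Psi>: "\<Psi> \<in> module_hom A (imod n I a b) P" "bij_betw \<Psi> (carrier (imod n I a b)) (carrier P)"
    and x: "\<And>i. i \<in> I \<Longrightarrow> x i \<in> carrier M" "\<And>i. i \<in> I \<Longrightarrow> pel n (a i) (a i) 1 \<odot>\<^bsub>M\<^esub> x i = x i"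
      "\<And>i. i \<in> I \<Longrightarrow> pel n (a i) (b i) 1 \<odot>\<^bsub>M\<^esub> x i = \<zero>\<^bsub>M\<^esub>"
  obtains \<Phi> where "\<Phi> \<in> module_hom A P M" "\<And>i. i \<in> I \<Longrightarrow> \<Phi> (\<Psi> (uv i (a i) 1)) = x i"
proof -
  have D: "left_module A (imod n I a b)" unfolding A_def by (rule imod_left_module[OF v])
  define g where "g = (\<lambda>y\<in>carrier P. inv_into (carrier (imod n I a b)) \<Psi> y)"
  note g = module_hom_inv[OF D P \<Psi>, folded g_def]
  obtain \<Phi> where \<Phi>: "\<Phi> \<in> module_hom A (imod n I a b) M" "\<And>i. i \<in> I \<Longrightarrow> \<Phi> (uv i (a i) 1) = x i"
    using imod_hom_ex[OF v M[unfolded A_def] x] unfolding A_def by blast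
  show thesis
  proof (rule that[OF module_hom_compose[OF g(1) \<Phi>(1) P]])
    fix i assume i: "i \<in> I"
    have "uv i (a i) 1 \<in> carrier (imod n I a b :: 'k rep)" by (rule pel_one_uv(4)[OF v i])
    then show "compose (carrier P) \<Phi> g (\<Psi> (uv i (a i) 1)) = x i"
      using module_homD(1)[OF \<Psi>(1)] \<Phi>(2)[OF i] g(3) by (simp add: compose_eq)
  qed
qed

lemma imod_iso_hom_eqI:
  fixes n :: nat
  defines "A \<equiv> (algebra_A n :: 'k::field path_alg)"
  assumes v: "ivalid n I a b" and P: "left_module A P" and M: "left_module A M"
    and \<Psi>: "\<Psi> \<in> module_hom A (imod n I a b) P" "\<Psi> ` carrier (imod n I a b) = carrier P"
    and f: "f \<in> module_hom A P M" and g: "g \<in> module_hom A P M"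
    and eq: "\<And>i. i \<in> I \<Longrightarrow> f (\<Psi> (uv i (a i) 1)) = g (\<Psi> (uv i (a i) 1))"
  shows "f = g"
proof (rule extensionalityI[OF module_homD(4)[OF f] module_homD(4)[OF g]])
  let ?D = "imod n I a b :: 'k rep"
  have D: "left_module A ?D" unfolding A_def by (rule imod_left_module[OF v])
  have "compose (carrier ?D) f \<Psi> = compose (carrier ?D) g \<Psi>"
  proof (rule imod_hom_eqI[OF v M[unfolded A_def]])
    fix i assume i: "i \<in> I"
    show "compose (carrier ?D) f \<Psi> (uv i (a i) 1) = compose (carrier ?D) g \<Psi> (uv i (a i) 1)"
      using eq[OF i] by (simp add: compose_eq pel_one_uv(4)[OF v i])
  qed (use module_hom_compose[OF \<Psi>(1) f D] module_hom_compose[OF \<Psi>(1) g D] in \<open>simp_all add: A_def\<close>)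
  then have e: "f (\<Psi> d) = g (\<Psi> d)" if "d \<in> carrier ?D" for d
    using that fun_cong[of _ _ d] by (metis compose_eq)
  fix x assume "x \<in> carrier P"
  then show "f x = g x" unfolding \<Psi>(2)[symmetric] using e by auto
qed

text \<open>Repackages a summand as a split embedding \<open>s\<close> of an interval module with
  retraction \<open>\<rho>\<close>. The image of the generator under \<open>s\<close> satisfies the
  relation of the interval and survives \<open>\<rho>\<close>, which is the input that the detection
  of components requires.\<close>

lemma indecomposable_summand:
  fixes n :: nat
  defines "A \<equiv> (algebra_A n :: 'k::field path_alg)"
  assumes fg: "fin_gen_module A M" and dd: "direct_decomp A M B C" and ind: "indecomposable A
      (sub_module M B)"
  obtains a b s \<rho> where "1 \<le> a" "a < b" "b \<le> Suc n" "module_iso A (iv n a b) (sub_module M B)"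
    "s \<in> module_hom A (iv n a b) M" "\<rho> \<in> module_hom A M (iv n a b)"
    "\<And>x. x \<in> carrier (iv n a b) \<Longrightarrow> s x \<in> B" "\<And>x. x \<in> carrier (iv n a b) \<Longrightarrow> \<rho> (s x) = x"
    "\<And>x. x \<in> C \<Longrightarrow> \<rho> x = (\<lambda>_. 0)"
proof -
  have M: "left_module A M" using fg by (simp add: fin_gen_module_def)
  have B: "submodule B A M" and C: "submodule C A M" using dd by (auto simp: direct_decomp_def)
  note SB = submodule_left_module[OF M B]
  obtain r where r: "r \<in> module_hom A M (sub_module M B)" "\<And>x. x \<in> B \<Longrightarrow> r x = x" "\<And>x. x \<in> C \<Longrightarrow> r x
      = \<zero>\<^bsub>M\<^esub>"
    using direct_decomp_projection[OF M dd] by blast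
  obtain a b where ab: "1 \<le> a" "a < b" "b \<le> Suc n" and iso: "module_iso A (iv n a b) (sub_module M
      B)"
    using indecomposable_iso_iv[OF fin_gen_module_summand[OF fg dd, unfolded A_def] ind[unfolded
        A_def]]
    unfolding A_def by blast
  let ?N = "iv n a b :: 'k rep"
  have N: "left_module A ?N" unfolding A_def by (rule imod_left_module[OF iv_valid[OF ab]])
  obtain s where s: "s \<in> module_hom A ?N (sub_module M B)" "bij_betw s (carrier ?N) (carrier
      (sub_module M B))"
    using iso by (auto simp: module_iso_def)
  define t where "t = (\<lambda>y\<in>carrier (sub_module M B). inv_into (carrier ?N) s y)"
  note t = module_hom_inv[OF N SB s, folded t_def]
  have sB: "s x \<in> B" if "x \<in> carrier ?N" for x using module_homD(1)[OF s(1) that] by simp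
  show thesis
  proof (rule that[OF ab iso module_hom_from_sub[OF s(1) B] module_hom_compose[OF r(1) t(1) M]])
    fix x assume x: "x \<in> carrier ?N"
    show "s x \<in> B" by (rule sB[OF x])
    show "compose (carrier M) t r (s x) = x"
      using submoduleD(1)[OF B sB[OF x]] r(2)[OF sB[OF x]] t(3)[OF x] by (simp add: compose_eq)
  next
    fix x assume x: "x \<in> C"
    show "compose (carrier M) t r x = (\<lambda>_. 0)"
      using submoduleD(1)[OF C x] r(3)[OF x] module_hom_zero[OF SB N t(1)] by (simp add: compose_eq)
  qed
qed

text \<open>The uniqueness half of the Krull--Schmidt theorem.\<close>

lemma detected_component:
  fixes n :: nat
  defines "A \<equiv> (algebra_A n :: 'k::field path_alg)"
  assumes v: "ivalid n I a b" and M: "left_module A M" and v0: "1 \<le> a0" "a0 < b0" "b0 \<le> Suc n"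
    and \<Phi>: "\<Phi> \<in> module_hom A (imod n I a b) M" "bij_betw \<Phi> (carrier (imod n I a b)) (carrier M)"
    and \<rho>: "\<rho> \<in> module_hom A M (iv n a0 b0)"
    and x: "x \<in> carrier (imod n I a b)" "pel n a0 a0 1 \<odot>\<^bsub>M\<^esub> \<Phi> x = \<Phi> x"
      "pel n a0 b0 1 \<odot>\<^bsub>M\<^esub> \<Phi> x = \<zero>\<^bsub>M\<^esub>" "\<rho> (\<Phi> x) \<noteq> (\<lambda>_. 0)"
  shows "\<exists>i\<in>I. a i = a0 \<and> b i = b0 \<and> x (prod_encode (i, a0)) \<noteq> 0"
proof -
  let ?D = "imod n I a b :: 'k rep"
  have D: "left_module A ?D" unfolding A_def by (rule imod_left_module[OF v])
  interpret D: left_module A ?D by (rule D)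
  have pA: "pel n i j c \<in> carrier A" for i j c by (simp add: A_def)
  have inj: "y = z" if "\<Phi> y = \<Phi> z" "y \<in> carrier ?D" "z \<in> carrier ?D" for y z
    using that \<Phi>(2) by (auto simp: bij_betw_def inj_on_def)
  have "pel n a0 a0 1 \<odot>\<^bsub>?D\<^esub> x = x"
    by (rule inj) (use module_homD(3)[OF \<Phi>(1) pA x(1)] x(1,2) pA D.smult_closed in auto)
  moreover have "pel n a0 b0 1 \<odot>\<^bsub>?D\<^esub> x = \<zero>\<^bsub>?D\<^esub>"
    by (rule inj) (use module_homD(3)[OF \<Phi>(1) pA x(1)] x(1,3) pA D.smult_closed D.M.zero_closed
        module_hom_zero[OF D M \<Phi>(1)] in auto)
  moreover have "compose (carrier ?D) \<rho> \<Phi> x \<noteq> (\<lambda>_. 0)" using x by (simp add: compose_eq)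
  ultimately show ?thesis
    using interval_component[OF v v0 module_hom_compose[OF \<Phi>(1) \<rho> D, unfolded A_def] x(1)] by simp
qed

text \<open>For one inclusion, a summand is detected among the intervals through its split
  embedding; for the other, the partial sums with a single index are transported along the
  isomorphism.\<close>

lemma summand_classes:
  fixes n :: nat
  defines "A \<equiv> (algebra_A n :: 'k::field path_alg)"
  assumes v: "ivalid n I a b" and M: "left_module A M" and iso: "module_iso A (imod n I a b) M"
  shows "{iso_class A (sub_module M B) | B. direct_summand A M B \<and> indecomposable A (sub_module M
      B)}
    = (\<lambda>i. iso_class A (iv n (a i) (b i))) ` I"
proof -
  let ?D = "imod n I a b :: 'k rep"
  have D: "left_module A ?D" unfolding A_def by (rule imod_left_module[OF v])
  interpret D: left_module A ?D by (rule D)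
  obtain \<Phi> where \<Phi>: "\<Phi> \<in> module_hom A ?D M" "bij_betw \<Phi> (carrier ?D) (carrier M)"
    using iso by (auto simp: module_iso_def)
  have surj: "\<Phi> ` carrier ?D = carrier M" using \<Phi>(2) by (simp add: bij_betw_def)
  have fg: "fin_gen_module A M"
    using fin_gen_module_surj[OF imod_fin_gen[OF v, where 'a = 'k] M[unfolded A_def] \<Phi>(1)[unfolded
        A_def] surj] by (simp add: A_def)
  show ?thesis
  proof (intro equalityI subsetI)
    fix c assume "c \<in> {iso_class A (sub_module M B) | B. direct_summand A M B
        \<and> indecomposable A (sub_module M B)}"
    then obtain B C where B: "c = iso_class A (sub_module M B)" "direct_decomp A M B C"
        "indecomposable A (sub_module M B)"
      by (auto simp: direct_summand_def)
    have SB: "left_module A (sub_module M B)"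
      using B(2) by (intro submodule_left_module[OF M]) (simp add: direct_decomp_def)
    from fg B(2,3) obtain a0 b0 s \<rho> where s: "1 \<le> a0" "a0 < b0" "b0 \<le> Suc n" "module_iso A (iv n
        a0 b0) (sub_module M B)"
      "s \<in> module_hom A (iv n a0 b0) M" "\<rho> \<in> module_hom A M (iv n a0 b0)"
      "\<And>x. x \<in> carrier (iv n a0 b0) \<Longrightarrow> \<rho> (s x) = x"
      unfolding A_def by (rule indecomposable_summand) blast
    note v0 = iv_valid[OF s(1-3)]
    have N: "left_module A (iv n a0 b0)" unfolding A_def by (rule imod_left_module[OF v0])
    have pA: "pel n i j c \<in> carrier A" for i j c by (simp add: A_def)
    let ?u = "uv 0 a0 1 :: nat \<Rightarrow> 'k"
    have u: "?u \<in> carrier (iv n a0 b0)" using s(1-3) by (simp add: uv_carrier)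
    \<comment> \<open>Seen in the sum of intervals, the image of the generator still satisfies the
      relation of the interval from \<open>a0\<close> to \<open>b0\<close> and survives
      \<open>\<rho>\<close>, so some index must carry exactly this interval.\<close>
    have "s ?u \<in> \<Phi> ` carrier ?D" unfolding surj by (rule module_homD(1)[OF s(5) u])
    then obtain x where x: "x \<in> carrier ?D" "\<Phi> x = s ?u" by auto
    note p = pel_one_uv[OF v0, of 0, simplified]
    have "?u \<noteq> (\<lambda>_. 0)" using uv_coeff[of 0 a0 "1 :: 'k" 0 a0] by (metis zero_neq_one)
    then have "\<exists>i\<in>I. a i = a0 \<and> b i = b0 \<and> x (prod_encode (i, a0)) \<noteq> 0"
      using x(2) s(7)[OF u] module_homD(3)[OF s(5) pA u, symmetric] module_hom_zero[OF N M s(5)]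
      by (intro detected_component[OF v M[unfolded A_def] s(1-3) \<Phi>(1)[unfolded A_def] \<Phi>(2)
          s(6)[unfolded A_def] x(1)])
        (simp_all add: p)
    then obtain i where "i \<in> I" "a i = a0" "b i = b0" by blast
    then show "c \<in> (\<lambda>i. iso_class A (iv n (a i) (b i))) ` I"
      using B(1) iso_class_eq_iff[OF N SB] s(4) by force
  next
    fix c assume "c \<in> (\<lambda>i. iso_class A (iv n (a i) (b i))) ` I"
    then obtain i where i: "i \<in> I" "c = iso_class A (iv n (a i) (b i))" by blast
    have val: "1 \<le> a i" "a i < b i" "b i \<le> Suc n" using v i by (auto simp: ivalid_def)
    have vi: "ivalid n {i} a b" using val by (simp add: ivalid_def)
    note viv = iv_valid[OF val]
    let ?S = "imod n {i} a b :: 'k rep"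
    let ?B = "\<Phi> ` carrier ?S"
    have sub: "submodule (carrier ?S) A ?D" unfolding A_def by (rule imod_sub_submodule[OF v])
        (use i in auto)
    have dd: "direct_decomp A M ?B (\<Phi> ` carrier (imod n (I - {i}) a b))"
      by (rule direct_decomp_transport[OF D M \<Phi>], unfold A_def, rule imod_sub_decomp[OF v]) (use i
          in auto)
    have B: "submodule ?B A M" using dd by (simp add: direct_decomp_def)
    note SB = submodule_left_module[OF M B]
    have S: "left_module A ?S" unfolding A_def by (rule imod_left_module[OF vi])
    have N: "left_module A (iv n (a i) (b i))" unfolding A_def by (rule imod_left_module[OF viv])
    have 1: "module_iso A (iv n (a i) (b i)) ?S"
      using module_iso_sym[OF S N] imod_single_iso[OF vi] unfolding A_def by blast
    have 2: "module_iso A ?S (sub_module ?D (carrier ?S))"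
      unfolding A_def by (rule imod_sub_iso[OF v]) (use i in auto)
    have 3: "module_iso A (sub_module ?D (carrier ?S)) (sub_module M ?B)"
      by (rule module_iso_image[OF D M \<Phi>(1) _ sub]) (use \<Phi>(2) in \<open>simp add: bij_betw_def\<close>)
    have 4: "module_iso A (iv n (a i) (b i)) (sub_module M ?B)"
      using module_iso_trans[OF module_iso_trans[OF 1 2 N] 3 N] .
    have "indecomposable A (sub_module M ?B)"
      using indecomposable_iso[OF N SB 4] iv_indecomposable[OF val, where 'k = 'k]
          by (simp add: A_def)
    moreover have "c = iso_class A (sub_module M ?B)" using iso_class_eq_iff[OF N SB] 4 i(2) by simp
    ultimately show "c \<in> {iso_class A (sub_module M B) | B. direct_summand A M B
        \<and> indecomposable A (sub_module M B)}"
      using dd by (auto simp: direct_summand_def)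
  qed
qed

text \<open>An elimination argument. Two isomorphic summands \<open>B\<close> and \<open>F\<close>
  give two embeddings of one interval module, and both images of the generator are detected at the
  same index, since only one index carries this interval. Cancelling that coordinate of the second
  image by a multiple of the first leaves an element that must still be detected, but no index
  remains for it.\<close>

lemma basic_distinct:
  fixes n :: nat
  defines "A \<equiv> (algebra_A n :: 'k::field path_alg)"
  assumes v: "ivalid n I a b" and M: "left_module A M" and iso: "module_iso A (imod n I a b) M"
    and dist: "\<And>i j. i \<in> I \<Longrightarrow> j \<in> I \<Longrightarrow> a i = a j \<Longrightarrow> b i = b j \<Longrightarrow> i = j"
  shows "basic A M"
  unfolding basic_def
proof (intro allI impI notI)
  fix B E F C
  assume "direct_decomp A M B E \<and> direct_decomp A (sub_module M E) F C
      \<and> indecomposable A (sub_module M B) \<and> indecomposable A (sub_module M F)"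
  then have dd: "direct_decomp A M B E" "direct_decomp A (sub_module M E) F C"
    and ind: "indecomposable A (sub_module M B)" "indecomposable A (sub_module M F)" by auto
  assume BF: "module_iso A (sub_module M B) (sub_module M F)"
  let ?D = "imod n I a b :: 'k rep"
  have D: "left_module A ?D" unfolding A_def by (rule imod_left_module[OF v])
  interpret D: left_module A ?D by (rule D)
  interpret M: left_module A M by (rule M)
  obtain \<Phi> where \<Phi>: "\<Phi> \<in> module_hom A ?D M" "bij_betw \<Phi> (carrier ?D) (carrier M)"
    using iso by (auto simp: module_iso_def)
  have surj: "\<Phi> ` carrier ?D = carrier M" using \<Phi>(2) by (simp add: bij_betw_def)
  have pA: "pel n i j c \<in> carrier A" for i j c by (simp add: A_def)
  have fg: "fin_gen_module A M"
    using fin_gen_module_surj[OF imod_fin_gen[OF v, where 'a = 'k] M[unfolded A_def] \<Phi>(1)[unfolded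
        A_def] surj] by (simp add: A_def)
  have B: "submodule B A M" and E: "submodule E A M" and F: "submodule F A (sub_module M E)"
    using dd by (auto simp: direct_decomp_def)
  note EM = submodule_left_module[OF M E] and BM = submodule_left_module[OF M B]
  have FM: "left_module A (sub_module M F)" using submodule_left_module[OF EM F] by simp
  note dd' = direct_decomp_sym[OF M dd(1)]
  have fgE: "fin_gen_module A (sub_module M E)" by (rule fin_gen_module_summand[OF fg dd'])
  obtain r where r: "r \<in> module_hom A M (sub_module M E)" "\<And>x. x \<in> E \<Longrightarrow> r x = x" "\<And>x. x \<in> B \<Longrightarrow> r x
      = \<zero>\<^bsub>M\<^esub>"
    using direct_decomp_projection[OF M dd'] by blast
  from fg dd(1) ind(1) obtain a0 b0 s \<rho> where s: "1 \<le> a0" "a0 < b0" "b0 \<le> Suc n" "module_iso A (iv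
      n a0 b0) (sub_module M B)"
    "s \<in> module_hom A (iv n a0 b0) M" "\<rho> \<in> module_hom A M (iv n a0 b0)"
    "\<And>x. x \<in> carrier (iv n a0 b0) \<Longrightarrow> s x \<in> B" "\<And>x. x \<in> carrier (iv n a0 b0) \<Longrightarrow> \<rho> (s x) = x"
    unfolding A_def by (rule indecomposable_summand) blast
  have ind2: "indecomposable A (sub_module (sub_module M E) F)" using ind(2) by simp
  from fgE dd(2) ind2 obtain a1 b1 s1 \<rho>1 where s1: "1 \<le> a1" "a1 < b1" "b1 \<le> Suc n" "module_iso A
      (iv n a1 b1) (sub_module (sub_module M E) F)"
    "s1 \<in> module_hom A (iv n a1 b1) (sub_module M E)" "\<rho>1 \<in> module_hom A (sub_module M E) (iv n a1
        b1)"
    "\<And>x. x \<in> carrier (iv n a1 b1) \<Longrightarrow> s1 x \<in> F" "\<And>x. x \<in> carrier (iv n a1 b1) \<Longrightarrow> \<rho>1 (s1 x) = x"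
    unfolding A_def by (rule indecomposable_summand) blast
  have N: "left_module A (iv n a0 b0)" unfolding A_def by (rule imod_left_module[OF iv_valid[OF
      s(1-3)]])
  have N1: "left_module A (iv n a1 b1)" unfolding A_def by (rule imod_left_module[OF iv_valid[OF
      s1(1-3)]])
  have iso1: "module_iso A (iv n a1 b1) (sub_module M F)" using s1(4) by simp
  have "module_iso A (iv n a0 b0) (iv n a1 b1)"
    using module_iso_trans[OF module_iso_trans[OF s(4) BF N] module_iso_sym[OF N1 FM iso1] N] .
  then have ab: "a1 = a0" "b1 = b0" using iv_iso_iff[OF s(1-3) s1(1-3)] unfolding A_def by auto
  note s1 = s1[unfolded ab]
  have \<rho>1: "compose (carrier M) \<rho>1 r \<in> module_hom A M (iv n a0 b0)" by (rule module_hom_compose[OF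
      r(1) s1(6) M])
  have s1': "s1 \<in> module_hom A (iv n a0 b0) M" by (rule module_hom_from_sub[OF s1(5) E])
  let ?u = "uv 0 a0 1 :: nat \<Rightarrow> 'k"
  have u: "?u \<in> carrier (iv n a0 b0)" using s(1-3) by (simp add: uv_carrier)
  have u0: "?u \<noteq> (\<lambda>_. 0)" using uv_coeff[of 0 a0 "1 :: 'k" 0 a0] by (metis zero_neq_one)
  note p = pel_one_uv[OF iv_valid[OF s(1-3)], of 0, simplified]
  have sc: "s ?u \<in> carrier M" "s1 ?u \<in> carrier M" using module_homD(1)[OF s(5) u]
      module_homD(1)[OF s1' u] by auto
  from sc[folded surj] obtain x y where x: "x \<in> carrier ?D" "\<Phi> x = s ?u"
    and y: "y \<in> carrier ?D" "\<Phi> y = s1 ?u" by auto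
  have se: "pel n a0 a0 1 \<odot>\<^bsub>M\<^esub> s ?u = s ?u" "pel n a0 b0 1 \<odot>\<^bsub>M\<^esub> s ?u = \<zero>\<^bsub>M\<^esub>"
    using module_homD(3)[OF s(5) pA u, symmetric] module_hom_zero[OF N M s(5)] by (simp_all add: p)
  have s1e: "pel n a0 a0 1 \<odot>\<^bsub>M\<^esub> s1 ?u = s1 ?u" "pel n a0 b0 1 \<odot>\<^bsub>M\<^esub> s1 ?u = \<zero>\<^bsub>M\<^esub>"
    using module_homD(3)[OF s1' pA u, symmetric] module_hom_zero[OF N M s1'] by (simp_all add: p)
  note dc = detected_component[OF v M[unfolded A_def] s(1-3) \<Phi>(1)[unfolded A_def] \<Phi>(2)]
  have "\<exists>i\<in>I. a i = a0 \<and> b i = b0 \<and> x (prod_encode (i, a0)) \<noteq> 0"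
    by (rule dc[OF s(6)[unfolded A_def] x(1)]) (use x(2) se s(8)[OF u] u0 in simp_all)
  then obtain i where i: "i \<in> I" "a i = a0" "b i = b0" "x (prod_encode (i, a0)) \<noteq> 0" by blast
  \<comment> \<open>\<open>c\<close> is chosen so that the coordinate of \<open>w\<close> at the
    index \<open>i\<close> vanishes.\<close>
  define c where "c = - (y (prod_encode (i, a0)) / x (prod_encode (i, a0)))"
  define w where "w = y \<oplus>\<^bsub>?D\<^esub> pel n a0 a0 c \<odot>\<^bsub>?D\<^esub> x"
  have px: "pel n a0 a0 c \<odot>\<^bsub>?D\<^esub> x \<in> carrier ?D" using D.smult_closed[OF pA x(1)] .
  have wc: "w \<in> carrier ?D" unfolding w_def by (rule D.M.a_closed[OF y(1) px])
  have \<Phi>w: "\<Phi> w = s1 ?u \<oplus>\<^bsub>M\<^esub> pel n a0 a0 c \<odot>\<^bsub>M\<^esub> s ?u"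
    unfolding w_def using module_homD(2)[OF \<Phi>(1) y(1) px] module_homD(3)[OF \<Phi>(1) pA x(1)] x(2)
        y(2) by simp
  have ps: "pel n a0 a0 c \<odot>\<^bsub>M\<^esub> s ?u \<in> carrier M" using M.smult_closed[OF pA sc(1)] .
  note pps = pel_pel_smult[OF M[unfolded A_def] sc(1)]
  have psB: "pel n a0 a0 c \<odot>\<^bsub>M\<^esub> s ?u \<in> B" using submoduleD(4)[OF B pA s(7)[OF u]] .
  \<comment> \<open>\<open>r\<close> kills the summand \<open>B\<close>, so adding a multiple of
    \<open>s ?u\<close> does not change the value of the composite of \<open>r\<close> and
    \<open>\<rho>1\<close>.\<close>
  have "\<exists>i\<in>I. a i = a0 \<and> b i = b0 \<and> w (prod_encode (i, a0)) \<noteq> 0"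
  proof (rule dc[OF \<rho>1[unfolded A_def] wc])
    show "pel n a0 a0 1 \<odot>\<^bsub>M\<^esub> \<Phi> w = \<Phi> w"
      unfolding \<Phi>w using M.smult_r_distr[OF pA sc(2) ps] s1e(1) pps[of a0 a0 a0 1 c] by simp
    have "pel n a0 b0 1 \<odot>\<^bsub>M\<^esub> (pel n a0 a0 c \<odot>\<^bsub>M\<^esub> s ?u) = pel n b0 b0 c \<odot>\<^bsub>M\<^esub> (pel n a0 b0 1 \<odot>\<^bsub>M\<^esub> s ?u)"
      using pps[of a0 a0 b0 1 c] pps[of a0 b0 b0 c 1] s(2) by simp
    also have "\<dots> = \<zero>\<^bsub>M\<^esub>" using se(2) M.smult_r_null[OF pA] by simp
    finally show "pel n a0 b0 1 \<odot>\<^bsub>M\<^esub> \<Phi> w = \<zero>\<^bsub>M\<^esub>"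
      unfolding \<Phi>w using M.smult_r_distr[OF pA sc(2) ps] s1e(2) by simp
    have "s1 ?u \<in> E" using module_homD(1)[OF s1(5) u] by simp
    have "r (\<Phi> w) = s1 ?u"
      unfolding \<Phi>w using module_homD(2)[OF r(1) sc(2) ps] r(2)[OF \<open>s1 ?u \<in> E\<close>] r(3)[OF psB] sc(2)
          by simp
    then have "compose (carrier M) \<rho>1 r (\<Phi> w) = ?u"
      using module_homD(1)[OF \<Phi>(1) wc] s1(8)[OF u] by (simp add: compose_eq)
    then show "compose (carrier M) \<rho>1 r (\<Phi> w) \<noteq> (\<lambda>_. 0)" using u0 by simp
  qed
  then obtain j where j: "j \<in> I" "a j = a0" "b j = b0" "w (prod_encode (j, a0)) \<noteq> 0" by blast
  then have "j = i" using dist i by metis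
  moreover have "w (prod_encode (i, a0)) = 0"
    using i s(1-3) by (simp add: w_def pel_smult c_def)
  ultimately show False using j(4) by simp
qed

section \<open>Projective covers and minimal presentations\<close>

abbreviation pmod :: "nat \<Rightarrow> nat set \<Rightarrow> (nat \<Rightarrow> nat) \<Rightarrow> 'k::field rep" where
  "pmod n I a \<equiv> imod n I a (\<lambda>_. Suc n)"

lemma pmod_valid: "ivalid n I a b \<Longrightarrow> ivalid n I a (\<lambda>_. Suc n)"
  by (force simp: ivalid_def)

lemma projective_section:
  fixes P X :: "('a, 'm) module"
  assumes "projective R P" "left_module R X" "g \<in> module_hom R X P" "g ` carrier X = carrier P"
  obtains s where "s \<in> module_hom R P X" "\<And>x. x \<in> carrier P \<Longrightarrow> g (s x) = x"
proof -
  have P: "left_module R P" using assms(1) by (simp add: projective_def)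
  have "\<exists>h\<in>module_hom R P X. \<forall>x\<in>carrier P. g (h x) = (\<lambda>x\<in>carrier P. x) x"
    using assms module_hom_id[OF P] P unfolding projective_def by blast
  then show thesis using that by force
qed

text \<open>A homomorphism from a sum of projectives amounts to a choice of elements at the starting
  vertices. Preimages of the required values therefore give a lift once they are multiplied by the
  vertex idempotents.\<close>

lemma pmod_projective:
  assumes v: "ivalid n I a (\<lambda>_. Suc n)"
  shows "projective (algebra_A n) (pmod n I a :: 'k::field rep)"
  unfolding projective_def
proof (intro conjI allI ballI impI)
  let ?A = "algebra_A n :: 'k path_alg"
  let ?P = "pmod n I a :: 'k rep"
  show P: "left_module ?A ?P" by (rule imod_left_module[OF v])
  fix X Y :: "'k rep" and g f
  assume g: "g \<in> module_hom ?A X Y" and f: "f \<in> module_hom ?A ?P Y"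
    and XY: "left_module ?A X \<and> left_module ?A Y \<and> g ` carrier X = carrier Y"
  then have X: "left_module ?A X" and Y: "left_module ?A Y" by auto
  interpret X: left_module ?A X by (rule X)
  define y where "y i = (SOME y. y \<in> carrier X \<and> g y = f (uv i (a i) 1))" for i
  have y: "y i \<in> carrier X" "g (y i) = f (uv i (a i) 1)" if "i \<in> I" for i
  proof -
    have "f (uv i (a i) 1) \<in> g ` carrier X"
      using XY module_homD(1)[OF f pel_one_uv(4)[OF v that]] by simp
    then have "\<exists>y. y \<in> carrier X \<and> g y = f (uv i (a i) 1)" by auto
    from someI_ex[OF this] show "y i \<in> carrier X" "g (y i) = f (uv i (a i) 1)" by (auto simp: y_def)
  qed
  obtain h where h: "h \<in> module_hom ?A ?P X" "\<And>i. i \<in> I \<Longrightarrow> h (uv i (a i) 1)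
      = pel n (a i) (a i) 1 \<odot>\<^bsub>X\<^esub> y i"
  proof (rule imod_hom_ex[OF v X, of "\<lambda>i. pel n (a i) (a i) 1 \<odot>\<^bsub>X\<^esub> y i"])
    fix i assume i: "i \<in> I"
    show 1: "pel n (a i) (a i) 1 \<odot>\<^bsub>X\<^esub> y i \<in> carrier X" using X.smult_closed[OF pel_carrier y(1)[OF
        i]] .
    show "pel n (a i) (a i) 1 \<odot>\<^bsub>X\<^esub> (pel n (a i) (a i) 1 \<odot>\<^bsub>X\<^esub> y i) = pel n (a i) (a i) 1 \<odot>\<^bsub>X\<^esub> y i"
      using pel_pel_smult[OF X y(1)[OF i], of "a i" "a i" "a i" 1 1] by simp
    show "pel n (a i) (Suc n) 1 \<odot>\<^bsub>X\<^esub> (pel n (a i) (a i) 1 \<odot>\<^bsub>X\<^esub> y i) = \<zero>\<^bsub>X\<^esub>"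
      using X.smult_l_null[OF 1] by (simp add: pel_out)
  qed auto
  have "compose (carrier ?P) g h = f"
  proof (rule imod_hom_eqI[OF v Y module_hom_compose[OF h(1) g P] f])
    fix i assume i: "i \<in> I"
    note u = pel_one_uv(1,4)[OF v i]
    show "compose (carrier ?P) g h (uv i (a i) 1) = f (uv i (a i) 1)"
      using h(2)[OF i] module_homD(3)[OF g pel_carrier y(1)[OF i]] y(2)[OF i]
        module_homD(3)[OF f pel_carrier u(2), of "a i" "a i" 1 1]
      by (simp add: compose_eq u)
  qed
  then show "\<exists>h\<in>module_hom ?A ?P X. \<forall>x\<in>carrier ?P. g (h x) = f x"
    using h(1) by (intro bexI[of _ h]) (auto simp: compose_eq dest: fun_cong)
qed

text \<open>In coordinates, the projective cover of a sum of interval modules: it forgets what lies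
  beyond the right ends.\<close>

definition cut :: "nat set \<Rightarrow> (nat \<Rightarrow> nat) \<Rightarrow> (nat \<Rightarrow> nat) \<Rightarrow> (nat \<Rightarrow> 'k::field) \<Rightarrow> nat \<Rightarrow> 'k" where
  "cut I a b f = (\<lambda>k. if k \<in> cells I a b then f k else 0)"

lemma cut_coeff: "cut I a b f (prod_encode (i, j)) = (if i \<in> I \<and> a i \<le> j
    \<and> j < b i then f (prod_encode (i, j)) else 0)"
  by (simp add: cut_def)

lemma cut_id: "f \<in> carrier (imod n I a b) \<Longrightarrow> cut I a b f = f"
  by (auto simp: cut_def imod_carrier fun_eq_iff)

lemma imod_into_pmod:
  assumes "ivalid n I a b"
  shows "carrier (imod n I a b) \<subseteq> carrier (pmod n I a)"
proof -
  have "cells I a b \<subseteq> cells I a (\<lambda>_. Suc n)" using assms by (force simp: cells_def ivalid_def)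
  then show ?thesis unfolding imod_carrier subset_iff by blast
qed

text \<open>Paths only lead forward, so a coordinate before \<open>b i\<close> never receives a
  contribution from one at or after \<open>b i\<close>, and forgetting the latter commutes with the
  action.\<close>

lemma cut_hom:
  assumes v: "ivalid n I a b"
  shows "(\<lambda>f\<in>carrier (pmod n I a). cut I a b f) \<in>
    module_hom (algebra_A n) (pmod n I a :: 'k::field rep) (imod n I a b)"
proof (rule left_module_homI[OF imod_left_module[OF pmod_valid[OF v]]])
  fix f g :: "nat \<Rightarrow> 'k" and x :: "(nat, nat) path \<Rightarrow> 'k"
  assume f: "f \<in> carrier (pmod n I a)" and x: "x \<in> carrier (algebra_A n)"
  show "cut I a b (x \<odot>\<^bsub>pmod n I a\<^esub> f) = x \<odot>\<^bsub>imod n I a b\<^esub> cut I a b f"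
  proof (rule imod_ext)
    fix i j
    have "x (pth l j) * f (prod_encode (i, l)) = x (pth l j) * cut I a b f (prod_encode (i, l))"
      if "i \<in> I" "a i \<le> j" "j < b i" for l
      using that algebra_A_out[OF x, of l j] imod_out[OF f, of i l]
      by (cases "l \<le> j") (auto simp: cut_coeff)
    then have "(\<Sum>l\<in>{1..n}. x (pth l j) * f (prod_encode (i, l))) = (\<Sum>l\<in>{1..n}. x (pth l j) * cut I
        a b f (prod_encode (i, l)))"
      if "i \<in> I" "a i \<le> j" "j < b i" using that by (intro sum.cong) auto
    then show "cut I a b (x \<odot>\<^bsub>pmod n I a\<^esub> f) (prod_encode (i, j)) = (x \<odot>\<^bsub>imod n I a b\<^esub> cut I a b f)
        (prod_encode (i, j))"
      using v unfolding cut_coeff[of _ _ _ "x \<odot>\<^bsub>pmod n I a\<^esub> f"] imod_smult by (auto simp: ivalid_def)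
  qed
qed (auto simp: cut_def imod_carrier)

lemma uv_cut: "i \<in> I \<Longrightarrow> a i \<le> j \<Longrightarrow> j < b i \<Longrightarrow> cut I a b (uv i j c) = uv i j c"
  by (rule imod_ext) (auto simp: cut_coeff)

lemma superfluous_cut:
  fixes n :: nat
  defines "A \<equiv> (algebra_A n :: 'k::field path_alg)"
  assumes v: "ivalid n I a b" and N: "submodule N A (pmod n I a)"
    and sum: "\<And>x. x \<in> carrier (pmod n I a) \<Longrightarrow>
      \<exists>y\<in>N. \<exists>z\<in>carrier (pmod n I a). cut I a b z = (\<lambda>_. 0) \<and> x = y \<oplus>\<^bsub>pmod n I a\<^esub> z"
  shows "N = carrier (pmod n I a)"
proof -
  let ?P = "pmod n I a :: 'k rep"
  note v' = pmod_valid[OF v]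
  interpret left_module A ?P unfolding A_def by (rule imod_left_module[OF v'])
  have "i \<in> I \<longrightarrow> uv i (a i) (1 :: 'k) \<in> N" for i
  proof (induction "a i" arbitrary: i rule: less_induct)
    case less
    show ?case
    proof
      assume i: "i \<in> I"
      let ?e = "pel n (a i) (a i) (1 :: 'k)" and ?u = "uv i (a i) (1 :: 'k)"
      have val: "1 \<le> a i" "a i \<le> n" using v i by (auto simp: ivalid_def)
      have eA: "?e \<in> carrier A" by (simp add: A_def)
      have "?u \<in> carrier ?P" by (rule pel_one_uv(4)[OF v' i])
      then obtain y z where y: "y \<in> N" and z: "z \<in> carrier ?P" "cut I a b z = (\<lambda>_. 0)"
        and u: "?u = y \<oplus>\<^bsub>?P\<^esub> z" using sum by blast
      have "?e \<odot>\<^bsub>?P\<^esub> z \<in> N"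
      proof (rule imod_submodule_supp[OF v' N[unfolded A_def]])
        show "?e \<odot>\<^bsub>?P\<^esub> z \<in> carrier ?P" by (rule smult_closed[OF eA z(1)])
        fix k l assume "(?e \<odot>\<^bsub>?P\<^esub> z) (prod_encode (k, l)) \<noteq> 0"
        then have l: "l = a i" "k \<in> I" "a k \<le> a i" and nz: "z (prod_encode (k, a i)) \<noteq> 0"
          using val by (auto simp: pel_smult split: if_splits)
        have "b k \<le> a i"
          using fun_cong[OF z(2), of "prod_encode (k, a i)"] nz l by (auto simp: cut_coeff split:
              if_splits)
        then have "a k < a i" using v l(2) by (force simp: ivalid_def)
        then have "uv k (a k) 1 \<in> N" using less l(2) by blast
        then show "uv k l 1 \<in> N"
          using imod_uv_gen[OF v' N[unfolded A_def] _ l(2)] l val by simp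
      qed
      moreover have "?e \<odot>\<^bsub>?P\<^esub> y \<in> N" by (rule submoduleD(4)[OF N eA y])
      moreover have "?u = ?e \<odot>\<^bsub>?P\<^esub> y \<oplus>\<^bsub>?P\<^esub> ?e \<odot>\<^bsub>?P\<^esub> z"
        using smult_r_distr[OF eA submoduleD(1)[OF N y] z(1)] u pel_one_uv(1)[OF v' i, where 'a
            = 'k] by simp
      ultimately show "?u \<in> N" using submoduleD(3)[OF N] by metis
    qed
  qed
  then show ?thesis using imod_generated[OF v' N[unfolded A_def]] by blast
qed

text \<open>The surjection \<open>cut\<close> from the projectives splits over \<open>P\<close>. The
  section lifts the generator \<open>i\<close> to an element with coordinate one at
  \<open>a i\<close> that is still killed by the path from \<open>a i\<close> to \<open>b i\<close>.
  If \<open>b i \<le> n\<close>, this path acts injectively on the projective summand, a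
  contradiction.\<close>

lemma projective_imp_pmod:
  fixes n :: nat
  defines "A \<equiv> (algebra_A n :: 'k::field path_alg)"
  assumes v: "ivalid n I a b" and P: "projective A (P :: 'k rep)"
    and iso: "module_iso A (imod n I a b) P" and i: "i \<in> I"
  shows "b i = Suc n"
proof (rule ccontr)
  assume "b i \<noteq> Suc n"
  have val: "1 \<le> a i" "a i < b i" "b i \<le> n" using v i \<open>b i \<noteq> Suc n\<close> by (force simp: ivalid_def)+
  let ?D = "imod n I a b :: 'k rep"
  let ?P = "pmod n I a :: 'k rep"
  have Pl: "left_module A P" using P by (simp add: projective_def)
  have D: "left_module A ?D" unfolding A_def by (rule imod_left_module[OF v])
  have Dp: "left_module A ?P" unfolding A_def by (rule imod_left_module[OF pmod_valid[OF v]])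
  obtain \<Phi> where \<Phi>: "\<Phi> \<in> module_hom A ?D P" "bij_betw \<Phi> (carrier ?D) (carrier P)"
    using iso by (auto simp: module_iso_def)
  have surj: "\<Phi> ` carrier ?D = carrier P" using \<Phi>(2) by (simp add: bij_betw_def)
  define g where "g = compose (carrier ?P) \<Phi> (\<lambda>f\<in>carrier ?P. cut I a b f)"
  have g: "g \<in> module_hom A ?P P" unfolding g_def A_def
    by (rule module_hom_compose[OF cut_hom[OF v] \<Phi>(1)[unfolded A_def] Dp[unfolded A_def]])
  have ge: "g x = \<Phi> (cut I a b x)" if "x \<in> carrier ?P" for x using that
      by (simp add: g_def compose_eq)
  have "carrier P \<subseteq> g ` carrier ?P"
  proof
    fix y assume "y \<in> carrier P"
    then obtain d where d: "d \<in> carrier ?D" "y = \<Phi> d" using surj by auto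
    then have "g d = y" using ge[of d] imod_into_pmod[OF v] cut_id[OF d(1)] by auto
    then show "y \<in> g ` carrier ?P" using d(1) imod_into_pmod[OF v] by blast
  qed
  then have gs: "g ` carrier ?P = carrier P" using module_homD(1)[OF g] by auto
  obtain s where s: "s \<in> module_hom A P ?P" "\<And>x. x \<in> carrier P \<Longrightarrow> g (s x) = x"
    using projective_section[OF P Dp g gs] by blast
  let ?u = "uv i (a i) 1 :: nat \<Rightarrow> 'k"
  note p = pel_one_uv[OF v i]
  define y where "y = s (\<Phi> ?u)"
  have \<Phi>u: "\<Phi> ?u \<in> carrier P" by (rule module_homD(1)[OF \<Phi>(1) p(4)])
  have yc: "y \<in> carrier ?P" unfolding y_def by (rule module_homD(1)[OF s(1) \<Phi>u])
  have cc: "cut I a b y \<in> carrier ?D" using module_homD(1)[OF cut_hom[OF v] yc] yc by simp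
  have "\<Phi> (cut I a b y) = \<Phi> ?u" using ge[OF yc] s(2)[OF \<Phi>u] by (simp add: y_def)
  then have "cut I a b y = ?u" using \<Phi>(2) cc p(4) unfolding bij_betw_def inj_on_def by blast
  then have "cut I a b y (prod_encode (i, a i)) = ?u (prod_encode (i, a i))" by (simp only:)
  then have y1: "y (prod_encode (i, a i)) = 1" using i val by (simp add: cut_coeff)
  have pA: "pel n j k c \<in> carrier A" for j k c by (simp add: A_def)
  have "pel n (a i) (b i) 1 \<odot>\<^bsub>?P\<^esub> y = s (\<Phi> (pel n (a i) (b i) 1 \<odot>\<^bsub>?D\<^esub> ?u))"
    unfolding y_def using module_homD(3)[OF s(1) pA \<Phi>u] module_homD(3)[OF \<Phi>(1) pA p(4)] by simp
  also have "\<dots> = (\<lambda>_. 0)"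
    using module_hom_zero[OF D Pl \<Phi>(1)] module_hom_zero[OF Pl Dp s(1)] by (simp add: p(2))
  finally have "(pel n (a i) (b i) 1 \<odot>\<^bsub>?P\<^esub> y) (prod_encode (i, b i)) = 0" by simp
  then show False using y1 i val by (simp add: pel_smult)
qed

text \<open>
  Lifting the generators gives a surjection from the sum of the projective covers of the summands
  onto \<open>P\<close>. It splits by projectivity, and its kernel is superfluous.
\<close>

lemma projective_cover_structure:
  fixes n :: nat
  defines "A \<equiv> (algebra_A n :: 'k::field path_alg)"
  assumes v: "ivalid n I a b" and X: "left_module A X"
    and \<Phi>: "\<Phi> \<in> module_hom A (imod n I a b) X" "bij_betw \<Phi> (carrier (imod n I a b)) (carrier X)"
    and pc: "projective_cover A P p (X :: 'k rep)"
  obtains \<Psi> where "\<Psi> \<in> module_hom A (pmod n I a) P" "bij_betw \<Psi> (carrier (pmod n I a)) (carrier P)"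
    "\<And>i. i \<in> I \<Longrightarrow> p (\<Psi> (uv i (a i) 1)) = \<Phi> (uv i (a i) 1)"
    "\<And>d. d \<in> carrier (pmod n I a) \<Longrightarrow> p (\<Psi> d) = \<Phi> (cut I a b d)"
proof -
  let ?D = "imod n I a b :: 'k rep"
  let ?P = "pmod n I a :: 'k rep"
  note v' = pmod_valid[OF v]
  have p: "p \<in> module_hom A P X" and psurj: "p ` carrier P = carrier X" and proj: "projective A P"
    and sup: "\<And>N. submodule N A P \<Longrightarrow> N <+>\<^bsub>P\<^esub> a_kernel P X p = carrier P \<Longrightarrow> N = carrier P"
    using pc by (auto simp: projective_cover_def)
  have P: "left_module A P" using proj by (simp add: projective_def)
  have D: "left_module A ?D" unfolding A_def by (rule imod_left_module[OF v])
  have Dp: "left_module A ?P" unfolding A_def by (rule imod_left_module[OF v'])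
  interpret P: left_module A P by (rule P)
  interpret Dp: left_module A ?P by (rule Dp)
  interpret X: left_module A X by (rule X)
  have pA: "pel n j k c \<in> carrier A" for j k c by (simp add: A_def)
  have surj: "\<Phi> ` carrier ?D = carrier X" using \<Phi>(2) by (simp add: bij_betw_def)
  define y where "y i = (SOME y. y \<in> carrier P \<and> p y = \<Phi> (uv i (a i) 1))" for i
  have y: "y i \<in> carrier P" "p (y i) = \<Phi> (uv i (a i) 1)" if "i \<in> I" for i
  proof -
    have "\<Phi> (uv i (a i) 1) \<in> p ` carrier P"
      unfolding psurj by (rule module_homD(1)[OF \<Phi>(1) pel_one_uv(4)[OF v that]])
    then have "\<exists>y. y \<in> carrier P \<and> p y = \<Phi> (uv i (a i) 1)" by auto
    from someI_ex[OF this] show "y i \<in> carrier P" "p (y i) = \<Phi> (uv i (a i) 1)" by (auto simp: y_def)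
  qed
  obtain \<Psi> where \<Psi>: "\<Psi> \<in> module_hom A ?P P" "\<And>i. i \<in> I \<Longrightarrow> \<Psi> (uv i (a i) 1) = pel n (a i) (a i) 1 \<odot>\<^bsub>P\<^esub>
      y i"
  proof (rule imod_hom_ex[OF v' P[unfolded A_def], of "\<lambda>i. pel n (a i) (a i) 1 \<odot>\<^bsub>P\<^esub> y i"])
    fix i assume i: "i \<in> I"
    show 1: "pel n (a i) (a i) 1 \<odot>\<^bsub>P\<^esub> y i \<in> carrier P" using P.smult_closed[OF pA y(1)[OF i]] .
    show "pel n (a i) (a i) 1 \<odot>\<^bsub>P\<^esub> (pel n (a i) (a i) 1 \<odot>\<^bsub>P\<^esub> y i) = pel n (a i) (a i) 1 \<odot>\<^bsub>P\<^esub> y i"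
      using pel_pel_smult[OF P[unfolded A_def] y(1)[OF i], of "a i" "a i" "a i" 1 1] by simp
    show "pel n (a i) (Suc n) 1 \<odot>\<^bsub>P\<^esub> (pel n (a i) (a i) 1 \<odot>\<^bsub>P\<^esub> y i) = \<zero>\<^bsub>P\<^esub>"
      using P.smult_l_null[OF 1] by (simp add: pel_out A_def)
  qed (auto simp: A_def)
  have p\<Psi>u: "p (\<Psi> (uv i (a i) 1)) = \<Phi> (uv i (a i) 1)" if i: "i \<in> I" for i
    using \<Psi>(2)[OF i] module_homD(3)[OF p pA y(1)[OF i]] y(2)[OF i]
      module_homD(3)[OF \<Phi>(1) pA pel_one_uv(4)[OF v i], of "a i" "a i" 1 1]
    by (simp add: pel_one_uv(1)[OF v i])
  have "compose (carrier ?P) p \<Psi> = compose (carrier ?P) \<Phi> (\<lambda>f\<in>carrier ?P. cut I a b f)"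
  proof (rule imod_hom_eqI[OF v' X[unfolded A_def]])
    show "compose (carrier ?P) p \<Psi> \<in> module_hom (algebra_A n) ?P X"
      using module_hom_compose[OF \<Psi>(1) p Dp] by (simp add: A_def)
    show "compose (carrier ?P) \<Phi> (\<lambda>f\<in>carrier ?P. cut I a b f) \<in> module_hom (algebra_A n) ?P X"
      using module_hom_compose[OF cut_hom[OF v] \<Phi>(1)[unfolded A_def] Dp[unfolded A_def]] .
    fix i assume i: "i \<in> I"
    have "cut I a b (uv i (a i) (1::'k)) = uv i (a i) 1" using v i by (intro uv_cut) (auto simp:
        ivalid_def)
    then show "compose (carrier ?P) p \<Psi> (uv i (a i) 1) = compose (carrier ?P) \<Phi> (\<lambda>f\<in>carrier ?P.
        cut I a b f) (uv i (a i) 1)"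
      using p\<Psi>u[OF i] by (simp add: compose_eq pel_one_uv(4)[OF v' i])
  qed
  note eq = this
  have p\<Psi>: "p (\<Psi> d) = \<Phi> (cut I a b d)" if "d \<in> carrier ?P" for d
    using fun_cong[OF eq, of d] that by (simp add: compose_eq)
  define Im where "Im = \<Psi> ` carrier ?P"
  have Im: "submodule Im A P" unfolding Im_def by (rule module_hom_image_submodule[OF Dp P \<Psi>(1)
      Dp.carrier_submodule])
  have "Im <+>\<^bsub>P\<^esub> a_kernel P X p = carrier P"
  proof
    show "Im <+>\<^bsub>P\<^esub> a_kernel P X p \<subseteq> carrier P"
      using submoduleD(1)[OF submodule_set_add[OF P Im module_hom_kernel_submodule[OF P X p]]]
          by blast
    show "carrier P \<subseteq> Im <+>\<^bsub>P\<^esub> a_kernel P X p"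
    proof
      fix x assume x: "x \<in> carrier P"
      have "p x \<in> \<Phi> ` carrier ?D" unfolding surj by (rule module_homD(1)[OF p x])
      then obtain d where d: "d \<in> carrier ?D" "p x = \<Phi> d" by auto
      have dP: "d \<in> carrier ?P" using d(1) imod_into_pmod[OF v] by blast
      have \<Psi>d: "\<Psi> d \<in> carrier P" by (rule module_homD(1)[OF \<Psi>(1) dP])
      have pd: "p (\<Psi> d) = p x" using p\<Psi>[OF dP] cut_id[OF d(1)] d(2) by simp
      have "p (x \<oplus>\<^bsub>P\<^esub> \<ominus>\<^bsub>P\<^esub> \<Psi> d) = \<zero>\<^bsub>X\<^esub>"
        using module_homD(2)[OF p x, of "\<ominus>\<^bsub>P\<^esub> \<Psi> d"] module_hom_neg[OF P X p \<Psi>d] \<Psi>d pd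
            module_homD(1)[OF p x]
        by (simp add: X.M.r_neg)
      then have "x \<oplus>\<^bsub>P\<^esub> \<ominus>\<^bsub>P\<^esub> \<Psi> d \<in> a_kernel P X p" using x \<Psi>d by (simp add: a_kernel_def')
      moreover have "x = \<Psi> d \<oplus>\<^bsub>P\<^esub> (x \<oplus>\<^bsub>P\<^esub> \<ominus>\<^bsub>P\<^esub> \<Psi> d)"
      proof -
        have "\<Psi> d \<oplus>\<^bsub>P\<^esub> (x \<oplus>\<^bsub>P\<^esub> \<ominus>\<^bsub>P\<^esub> \<Psi> d) = x \<oplus>\<^bsub>P\<^esub> (\<Psi> d \<oplus>\<^bsub>P\<^esub> \<ominus>\<^bsub>P\<^esub> \<Psi> d)"
          using x \<Psi>d by (simp add: P.M.a_lcomm)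
        then show ?thesis using x \<Psi>d by (simp add: P.M.r_neg)
      qed
      moreover have "\<Psi> d \<in> Im" using dP by (auto simp: Im_def)
      ultimately show "x \<in> Im <+>\<^bsub>P\<^esub> a_kernel P X p" unfolding set_add_def' by auto
    qed
  qed
  then have Pim: "\<Psi> ` carrier ?P = carrier P" using sup[OF Im] by (simp add: Im_def)
  obtain s where s: "s \<in> module_hom A P ?P" "\<And>x. x \<in> carrier P \<Longrightarrow> \<Psi> (s x) = x"
    using projective_section[OF proj Dp \<Psi>(1) Pim] by blast
  have "s ` carrier P = carrier ?P"
  proof (rule superfluous_cut[OF v module_hom_image_submodule[OF P Dp s(1) P.carrier_submodule,
      unfolded A_def]])
    fix x assume x: "x \<in> carrier ?P"
    define z where "z = s (\<Psi> x)"
    have \<Psi>x: "\<Psi> x \<in> carrier P" by (rule module_homD(1)[OF \<Psi>(1) x])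
    have z: "z \<in> carrier ?P" unfolding z_def by (rule module_homD(1)[OF s(1) \<Psi>x])
    have d: "x \<oplus>\<^bsub>?P\<^esub> \<ominus>\<^bsub>?P\<^esub> z \<in> carrier ?P" by (rule Dp.M.a_closed[OF x Dp.M.a_inv_closed[OF z]])
    have "\<Psi> (x \<oplus>\<^bsub>?P\<^esub> \<ominus>\<^bsub>?P\<^esub> z) = \<Psi> x \<oplus>\<^bsub>P\<^esub> \<ominus>\<^bsub>P\<^esub> \<Psi> z"
      using module_homD(2)[OF \<Psi>(1) x Dp.M.a_inv_closed[OF z]] module_hom_neg[OF Dp P \<Psi>(1) z]
          by (simp only:)
    also have "\<Psi> z = \<Psi> x" unfolding z_def by (rule s(2)[OF \<Psi>x])
    finally have "\<Psi> (x \<oplus>\<^bsub>?P\<^esub> \<ominus>\<^bsub>?P\<^esub> z) = \<zero>\<^bsub>P\<^esub>" using \<Psi>x by (simp only: P.M.r_neg)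
    then have "\<Phi> (cut I a b (x \<oplus>\<^bsub>?P\<^esub> \<ominus>\<^bsub>?P\<^esub> z)) = \<Phi> \<zero>\<^bsub>?D\<^esub>"
      using p\<Psi>[OF d] module_hom_zero[OF P X p] module_hom_zero[OF D X \<Phi>(1)] by (simp only:)
    moreover have "cut I a b (x \<oplus>\<^bsub>?P\<^esub> \<ominus>\<^bsub>?P\<^esub> z) \<in> carrier ?D" using module_homD(1)[OF cut_hom[OF v] d]
        d by (simp only: restrict_apply')
    moreover have "\<zero>\<^bsub>?D\<^esub> \<in> carrier ?D" by (simp add: imod_carrier)
    ultimately have "cut I a b (x \<oplus>\<^bsub>?P\<^esub> \<ominus>\<^bsub>?P\<^esub> z) = \<zero>\<^bsub>?D\<^esub>"
      using \<Phi>(2) unfolding bij_betw_def inj_on_def by blast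
    moreover have "x = z \<oplus>\<^bsub>?P\<^esub> (x \<oplus>\<^bsub>?P\<^esub> \<ominus>\<^bsub>?P\<^esub> z)"
      using x z Dp.M.a_lcomm[OF z x Dp.M.a_inv_closed[OF z]] Dp.M.r_neg[OF z] Dp.M.r_zero[OF x]
          by (simp only:)
    moreover have "z \<in> s ` carrier P" unfolding z_def using \<Psi>x by blast
    ultimately show "\<exists>y\<in>s ` carrier P. \<exists>z\<in>carrier ?P. cut I a b z = (\<lambda>_. 0) \<and> x = y \<oplus>\<^bsub>?P\<^esub> z"
      using d unfolding imod_simps(1) by blast
  qed
  then have "\<exists>x\<in>carrier P. d = s x" if "d \<in> carrier ?P" for d using that by blast
  then have s\<Psi>: "s (\<Psi> d) = d" if "d \<in> carrier ?P" for d using that s(2) by force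
  have "inj_on \<Psi> (carrier ?P)" by (rule inj_on_inverseI[of _ s]) (rule s\<Psi>)
  then show thesis using that[OF \<Psi>(1) _ p\<Psi>u p\<Psi>] Pim by (simp add: bij_betw_def)
qed

text \<open>
  The kernel of the projective cover of a sum of interval modules consists of the functions
  supported on the cells from \<open>b i\<close> to \<open>n\<close>, hence is itself of the form \<^term>\<open>pmod\<close>.
\<close>

abbreviation syz :: "nat \<Rightarrow> nat set \<Rightarrow> (nat \<Rightarrow> nat) \<Rightarrow> nat set" where
  "syz n I b \<equiv> {i \<in> I. b i \<le> n}"

lemma syz_valid: "ivalid n I a b \<Longrightarrow> ivalid n (syz n I b) b (\<lambda>_. Suc n)"
  by (force simp: ivalid_def)

lemma syz_carrier:
  assumes v: "ivalid n I a b"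
  shows "f \<in> carrier (pmod n (syz n I b) b :: 'k::field rep) \<longleftrightarrow>
    f \<in> carrier (pmod n I a) \<and> cut I a b f = (\<lambda>_. 0)"
proof (intro iffI conjI)
  assume f: "f \<in> carrier (pmod n (syz n I b) b :: 'k rep)"
  have "cells (syz n I b) b (\<lambda>_. Suc n) \<subseteq> cells I a (\<lambda>_. Suc n)"
    using v by (force simp: cells_def ivalid_def)
  then show "f \<in> carrier (pmod n I a)" using f unfolding imod_carrier subset_iff by blast
  show "cut I a b f = (\<lambda>_. 0)"
  proof (rule imod_ext)
    fix i j
    show "cut I a b f (prod_encode (i, j)) = 0" using imod_out[OF f, of i j]
        by (simp add: cut_coeff)
  qed
next
  assume f: "f \<in> carrier (pmod n I a) \<and> cut I a b f = (\<lambda>_. 0)"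
  show "f \<in> carrier (pmod n (syz n I b) b)"
    unfolding imod_carrier
  proof (intro allI impI)
    fix k assume k: "f k \<noteq> 0"
    obtain i j where ij: "k = prod_encode (i, j)" by (metis prod_decode_inverse surj_pair)
    have "i \<in> I" "a i \<le> j" "j < Suc n" using imod_out[of f n I a "\<lambda>_. Suc n" i j] f k
        by (auto simp: ij)
    moreover have "cut I a b f (prod_encode (i, j)) = 0" using f by simp
    ultimately show "k \<in> cells (syz n I b) b (\<lambda>_. Suc n)" using k
        by (auto simp: ij cut_coeff split: if_splits)
  qed
qed

lemma syz_smult:
  assumes v: "ivalid n I a b" and f: "f \<in> carrier (pmod n (syz n I b) b)" and x: "x \<in> carrier
      (algebra_A n)"
  shows "x \<odot>\<^bsub>pmod n I a\<^esub> f = x \<odot>\<^bsub>pmod n (syz n I b) b\<^esub> f"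
proof (rule imod_ext)
  fix i j
  have z: "x (pth l j) * f (prod_encode (i, l)) = 0" if "\<not> (i \<in> syz n I b \<and> b i \<le> j)" for l
    using that imod_out[OF f, of i l] algebra_A_out[OF x, of l j] by fastforce
  have s: "(\<Sum>l\<in>{1..n}. x (pth l j) * f (prod_encode (i, l))) = 0" if "\<not> (i \<in> syz n I b \<and> b i \<le> j)"
    unfolding z[OF that] by simp
  show "(x \<odot>\<^bsub>pmod n I a\<^esub> f) (prod_encode (i, j)) = (x \<odot>\<^bsub>pmod n (syz n I b) b\<^esub> f) (prod_encode (i, j))"
  proof (cases "i \<in> syz n I b \<and> b i \<le> j")
    case True
    then have "a i \<le> j" using v by (force simp: ivalid_def)
    then show ?thesis using True by (simp add: imod_smult)
  next
    case False
    then show ?thesis unfolding imod_smult s[OF False] by auto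
  qed
qed

lemma syz_incl_hom:
  assumes v: "ivalid n I a b"
  shows "(\<lambda>f\<in>carrier (pmod n (syz n I b) b). f) \<in>
    module_hom (algebra_A n) (pmod n (syz n I b) b :: 'k::field rep) (pmod n I a)"
proof (rule left_module_homI[OF imod_left_module[OF syz_valid[OF v]]])
  fix x :: "(nat, nat) path \<Rightarrow> 'k" and f :: "nat \<Rightarrow> 'k"
  assume x: "x \<in> carrier (algebra_A n)" and f: "f \<in> carrier (pmod n (syz n I b) b)"
  show "x \<odot>\<^bsub>pmod n (syz n I b) b\<^esub> f = x \<odot>\<^bsub>pmod n I a\<^esub> f" by (rule syz_smult[OF v f x, symmetric])
qed (simp_all add: syz_carrier[OF v])

text \<open>The kernel is itself presented as a sum of intervals, so
  \<open>projective_cover_structure\<close> can be applied a second time, to the other term of a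
  presentation. With the identity in place of \<open>\<Psi>\<close>, it also provides a cover of the
  kernel in the existence proof.\<close>

lemma projective_cover_kernel:
  fixes n :: nat
  defines "A \<equiv> (algebra_A n :: 'k::field path_alg)"
  assumes v: "ivalid n I a b" and X: "left_module A X" and P: "left_module A P"
    and \<Phi>: "\<Phi> \<in> module_hom A (imod n I a b) X" "bij_betw \<Phi> (carrier (imod n I a b)) (carrier X)"
    and \<Psi>: "\<Psi> \<in> module_hom A (pmod n I a) P" "bij_betw \<Psi> (carrier (pmod n I a)) (carrier P)"
    and p\<Psi>: "\<forall>d\<in>carrier (pmod n I a). p (\<Psi> d) = \<Phi> (cut I a b d)"
  defines "\<kappa> \<equiv> (\<lambda>d\<in>carrier (pmod n (syz n I b) b). \<Psi> d)"
  shows "\<kappa> \<in> module_hom A (pmod n (syz n I b) b) (sub_module P (a_kernel P X p))"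
    "bij_betw \<kappa> (carrier (pmod n (syz n I b) b)) (carrier (sub_module P (a_kernel P X p)))"
proof -
  let ?D = "imod n I a b :: 'k rep"
  let ?P = "pmod n I a :: 'k rep"
  let ?K = "pmod n (syz n I b) b :: 'k rep"
  have D: "left_module A ?D" unfolding A_def by (rule imod_left_module[OF v])
  have Dp: "left_module A ?P" unfolding A_def by (rule imod_left_module[OF pmod_valid[OF v]])
  have K: "left_module A ?K" unfolding A_def by (rule imod_left_module[OF syz_valid[OF v]])
  note sc = syz_carrier[OF v, where 'k = 'k]
  have surj: "\<Psi> ` carrier ?P = carrier P" and inj: "inj_on \<Psi> (carrier ?P)" using \<Psi>(2)
      by (simp_all add: bij_betw_def)
  have "\<Psi> d \<in> a_kernel P X p \<longleftrightarrow> d \<in> carrier ?K" if d: "d \<in> carrier ?P" for d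
  proof -
    have c: "cut I a b d \<in> carrier ?D" using module_homD(1)[OF cut_hom[OF v] d] d
        by (simp only: restrict_apply')
    have "\<Phi> (cut I a b d) = \<zero>\<^bsub>X\<^esub> \<longleftrightarrow> cut I a b d = \<zero>\<^bsub>?D\<^esub>"
      using module_hom_inj_iff[OF D X \<Phi>(1)] \<Phi>(2) c module_hom_zero[OF D X \<Phi>(1)]
          by (auto simp: bij_betw_def)
    then show ?thesis using sc d bspec[OF p\<Psi> d] module_homD(1)[OF \<Psi>(1) d]
        by (simp add: a_kernel_def')
  qed
  note ker = this
  have im: "\<Psi> ` carrier ?K = a_kernel P X p"
  proof (intro equalityI subsetI)
    fix y assume "y \<in> \<Psi> ` carrier ?K"
    then show "y \<in> a_kernel P X p" using ker sc by auto
  next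
    fix y assume y: "y \<in> a_kernel P X p"
    then have "y \<in> \<Psi> ` carrier ?P" unfolding surj by (simp add: a_kernel_def')
    then show "y \<in> \<Psi> ` carrier ?K" using ker y by auto
  qed
  have "compose (carrier ?K) \<Psi> (\<lambda>f\<in>carrier ?K. f) \<in> module_hom A ?K P"
    unfolding A_def by (rule module_hom_compose[OF syz_incl_hom[OF v] \<Psi>(1)[unfolded A_def]
        K[unfolded A_def]])
  then have "\<kappa> \<in> module_hom A ?K P" by (simp add: \<kappa>_def compose_def cong: restrict_cong)
  then show "\<kappa> \<in> module_hom A ?K (sub_module P (a_kernel P X p))"
    by (rule module_hom_into_sub) (use im in \<open>auto simp: \<kappa>_def\<close>)
  have "inj_on \<Psi> (carrier ?K)" using inj sc by (meson inj_on_subset subsetI)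
  then show "bij_betw \<kappa> (carrier ?K) (carrier (sub_module P (a_kernel P X p)))"
    using im by (simp add: \<kappa>_def bij_betw_def inj_on_restrict_eq)
qed

text \<open>Coordinates in which the presentation is diagonal: the projective at \<open>b i\<close>
  maps into the projective at \<open>a i\<close> along the path from \<open>a i\<close> to
  \<open>b i\<close>. The presentation is arbitrary because the one inside
  \<open>AR_translate\<close> is selected by a choice operator.\<close>

lemma minimal_presentation_structure:
  fixes n :: nat
  defines "A \<equiv> (algebra_A n :: 'k::field path_alg)"
  assumes v: "ivalid n I a b" and M: "left_module A M"
    and \<Phi>: "\<Phi> \<in> module_hom A (imod n I a b) M" "bij_betw \<Phi> (carrier (imod n I a b)) (carrier M)"
    and mp: "minimal_presentation A P1 f P0 p (M :: 'k rep)"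
  obtains \<Psi>0 \<Psi>1 where
    "\<Psi>0 \<in> module_hom A (pmod n I a) P0" "bij_betw \<Psi>0 (carrier (pmod n I a)) (carrier P0)"
    "\<Psi>1 \<in> module_hom A (pmod n (syz n I b) b) P1" "bij_betw \<Psi>1 (carrier (pmod n (syz n I b) b))
        (carrier P1)"
    "\<And>i. i \<in> syz n I b \<Longrightarrow> f (\<Psi>1 (uv i (b i) 1)) = pel n (a i) (b i) 1 \<odot>\<^bsub>P0\<^esub> \<Psi>0 (uv i (a i) 1)"
    "f \<in> module_hom A P1 P0" "left_module A P0" "left_module A P1"
proof -
  have pc: "projective_cover A P0 p M" "projective_cover A P1 f (sub_module P0 (a_kernel P0 M p))"
    using mp by (auto simp: minimal_presentation_def)
  have P0: "left_module A P0" and P1: "left_module A P1" using pc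
      by (auto simp: projective_cover_def projective_def)
  have p: "p \<in> module_hom A P0 M" and f: "f \<in> module_hom A P1 (sub_module P0 (a_kernel P0 M p))"
    using pc by (auto simp: projective_cover_def)
  have ker: "submodule (a_kernel P0 M p) A P0" by (rule module_hom_kernel_submodule[OF P0 M p])
  from pc(1) obtain \<Psi>0 where \<Psi>0: "\<Psi>0 \<in> module_hom A (pmod n I a) P0" "bij_betw \<Psi>0 (carrier (pmod n
      I a)) (carrier P0)"
    "\<forall>d\<in>carrier (pmod n I a). p (\<Psi>0 d) = \<Phi> (cut I a b d)"
    unfolding A_def by (rule projective_cover_structure[OF v M[unfolded A_def] \<Phi>(1)[unfolded
        A_def] \<Phi>(2)]) blast
  define \<kappa> where "\<kappa> = (\<lambda>d\<in>carrier (pmod n (syz n I b) b). \<Psi>0 d)"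
  note \<kappa> = projective_cover_kernel[where p = p and \<Psi> = \<Psi>0 and \<Phi> = \<Phi>, OF v M[unfolded A_def]
      P0[unfolded A_def] \<Phi>(1)[unfolded A_def] \<Phi>(2)
      \<Psi>0(1)[unfolded A_def] \<Psi>0(2,3), folded \<kappa>_def, folded A_def]
  note KM = submodule_left_module[OF P0 ker]
  note vs = syz_valid[OF v]
  from pc(2) obtain \<Psi>1 where \<Psi>1: "\<Psi>1 \<in> module_hom A (pmod n (syz n I b) b) P1"
    "bij_betw \<Psi>1 (carrier (pmod n (syz n I b) b)) (carrier P1)"
    "\<And>i. i \<in> syz n I b \<Longrightarrow> f (\<Psi>1 (uv i (b i) 1)) = \<kappa> (uv i (b i) 1)"
    unfolding A_def by (rule projective_cover_structure[OF vs KM[unfolded A_def] \<kappa>(1)[unfolded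
        A_def] \<kappa>(2)[unfolded A_def]]) blast
  have "f (\<Psi>1 (uv i (b i) 1)) = pel n (a i) (b i) 1 \<odot>\<^bsub>P0\<^esub> \<Psi>0 (uv i (a i) 1)" if i: "i \<in> syz n I b"
      for i
  proof -
    have iI: "i \<in> I" and bi: "b i \<le> n" "a i \<le> b i" using i v by (auto simp: ivalid_def)
    note u = pel_one_uv[OF pmod_valid[OF v] iI]
    \<comment> \<open>Inside the projective at \<open>a i\<close>, the first basis vector beyond the
      interval is the generator moved along the path to \<open>b i\<close>; this is where the path
      in the diagonal form comes from.\<close>
    have "\<kappa> (uv i (b i) 1) = \<Psi>0 (pel n (a i) (b i) 1 \<odot>\<^bsub>pmod n I a\<^esub> uv i (a i) 1)"
      using bi by (simp add: \<kappa>_def u(3) pel_one_uv(4)[OF vs i])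
    also have "\<dots> = pel n (a i) (b i) 1 \<odot>\<^bsub>P0\<^esub> \<Psi>0 (uv i (a i) 1)"
      by (rule module_homD(3)[OF \<Psi>0(1) _ u(4)]) (simp add: A_def)
    finally show ?thesis using \<Psi>1(3)[OF i] by simp
  qed
  then show thesis using that \<Psi>0 \<Psi>1 module_hom_from_sub[OF f ker] P0 P1 by blast
qed

text \<open>Needed because \<open>AR_translate\<close> selects its presentation with
  \<open>SOME\<close>; only existence guarantees that the selected tuple is a minimal
  presentation.\<close>

lemma minimal_presentation_ex:
  fixes n :: nat
  defines "A \<equiv> (algebra_A n :: 'k::field path_alg)"
  assumes v: "ivalid n I a b" and M: "left_module A M" and iso: "module_iso A (imod n I a b) M"
  shows "\<exists>P1 f P0 p. minimal_presentation A P1 f P0 p (M :: 'k rep)"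
proof -
  let ?D = "imod n I a b :: 'k rep"
  let ?P = "pmod n I a :: 'k rep"
  let ?K = "pmod n (syz n I b) b :: 'k rep"
  obtain \<Phi> where \<Phi>: "\<Phi> \<in> module_hom A ?D M" "bij_betw \<Phi> (carrier ?D) (carrier M)"
    using iso by (auto simp: module_iso_def)
  note vp = pmod_valid[OF v] and vs = syz_valid[OF v]
  have D: "left_module A ?D" unfolding A_def by (rule imod_left_module[OF v])
  have Dp: "left_module A ?P" unfolding A_def by (rule imod_left_module[OF vp])
  have K: "left_module A ?K" unfolding A_def by (rule imod_left_module[OF vs])
  define p where "p = compose (carrier ?P) \<Phi> (\<lambda>f\<in>carrier ?P. cut I a b f)"
  have p: "p \<in> module_hom A ?P M" unfolding p_def A_def
    by (rule module_hom_compose[OF cut_hom[OF v] \<Phi>(1)[unfolded A_def] Dp[unfolded A_def]])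
  have pe: "p x = \<Phi> (cut I a b x)" if "x \<in> carrier ?P" for x using that
      by (simp add: p_def compose_eq)
  have cutD: "cut I a b x \<in> carrier ?D" if "x \<in> carrier ?P" for x
    using module_homD(1)[OF cut_hom[OF v] that] that by (simp only: restrict_apply')
  have "p ` carrier ?P = carrier M"
  proof (intro equalityI subsetI)
    fix y assume "y \<in> carrier M"
    then have "y \<in> \<Phi> ` carrier ?D" using \<Phi>(2) by (simp add: bij_betw_def)
    then obtain d where d: "d \<in> carrier ?D" "y = \<Phi> d" by auto
    then show "y \<in> p ` carrier ?P" using pe[of d] imod_into_pmod[OF v] cut_id[OF d(1)] by force
  qed (use module_homD(1)[OF p] in auto)
  define \<iota> where "\<iota> = (\<lambda>d\<in>carrier ?K. (\<lambda>x\<in>carrier ?P. x) d)"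
  have bid: "bij_betw (\<lambda>x\<in>carrier ?P. x) (carrier ?P) (carrier ?P)"
    by (auto simp: bij_betw_def inj_on_def)
  note \<iota> = projective_cover_kernel[where p = p and \<Psi> = "\<lambda>x\<in>carrier ?P. x" and \<Phi> = \<Phi>,
      OF v M[unfolded A_def] Dp[unfolded A_def] \<Phi>(1)[unfolded A_def] \<Phi>(2)
      module_hom_id[OF Dp[unfolded A_def]] bid, folded \<iota>_def, folded A_def]
  have p\<iota>: "\<forall>d\<in>carrier ?P. p ((\<lambda>x\<in>carrier ?P. x) d) = \<Phi> (cut I a b d)" using pe by simp
  note \<iota> = \<iota>[OF p\<iota>]
  let ?N = "sub_module ?P (a_kernel ?P M p)"
  have ker: "submodule (a_kernel ?P M p) A ?P" by (rule module_hom_kernel_submodule[OF Dp M p])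
  have N: "left_module A ?N" by (rule submodule_left_module[OF Dp ker])
  interpret K: left_module A ?K by (rule K)
  have zs: "p x = \<zero>\<^bsub>M\<^esub> \<Longrightarrow> cut I a b x = (\<lambda>_. 0)" if "x \<in> carrier ?P" for x
    using module_hom_inj_iff[OF D M \<Phi>(1)] \<Phi>(2) cutD[OF that] pe[OF that]
        by (auto simp: bij_betw_def)
  have "projective_cover A ?P p M"
    unfolding projective_cover_def
  proof (intro conjI allI impI)
    show "fin_gen_module A ?P" unfolding A_def by (rule imod_fin_gen[OF vp])
    show "projective A ?P" unfolding A_def by (rule pmod_projective[OF vp])
    fix H assume H: "submodule H A ?P \<and> H <+>\<^bsub>?P\<^esub> a_kernel ?P M p = carrier ?P"
    show "H = carrier ?P"
    proof (rule superfluous_cut[OF v conjunct1[OF H, unfolded A_def]])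
      fix x assume "x \<in> carrier ?P"
      then have "x \<in> H <+>\<^bsub>?P\<^esub> a_kernel ?P M p" using H by simp
      then obtain y z where yz: "y \<in> H" "z \<in> a_kernel ?P M p" "x = y \<oplus>\<^bsub>?P\<^esub> z"
        unfolding set_add_def' by auto
      then show "\<exists>y\<in>H. \<exists>z\<in>carrier ?P. cut I a b z = (\<lambda>_. 0) \<and> x = y \<oplus>\<^bsub>?P\<^esub> z"
        using zs[of z] by (auto simp: a_kernel_def')
    qed
  qed fact+
  moreover have "projective_cover A ?K \<iota> ?N"
    unfolding projective_cover_def
  proof (intro conjI allI impI)
    show "fin_gen_module A ?K" unfolding A_def by (rule imod_fin_gen[OF vs])
    show "projective A ?K" unfolding A_def by (rule pmod_projective[OF vs])
    show "\<iota> \<in> module_hom A ?K ?N" by (rule \<iota>(1))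
    show "\<iota> ` carrier ?K = carrier ?N" using \<iota>(2) by (simp add: bij_betw_def)
    fix H assume H: "submodule H A ?K \<and> H <+>\<^bsub>?K\<^esub> a_kernel ?K ?N \<iota> = carrier ?K"
    \<comment> \<open>The second cover is an isomorphism, so its kernel is zero and adds nothing to
      \<open>H\<close>.\<close>
    have "a_kernel ?K ?N \<iota> \<subseteq> {\<zero>\<^bsub>?K\<^esub>}"
      using module_hom_inj_iff[OF K N \<iota>(1)] \<iota>(2) by (auto simp: bij_betw_def a_kernel_def')
    moreover note SH = submoduleD(1)[OF conjunct1[OF H]]
    have "x \<in> H" if "x \<in> carrier ?K" for x
    proof -
      have "x \<in> H <+>\<^bsub>?K\<^esub> a_kernel ?K ?N \<iota>" using H that by simp
      then obtain y z where yz: "y \<in> H" "z \<in> a_kernel ?K ?N \<iota>" "x = y \<oplus>\<^bsub>?K\<^esub> z"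
        unfolding set_add_def' by auto
      then have "z = \<zero>\<^bsub>?K\<^esub>" using calculation by blast
      then show ?thesis using yz SH[OF yz(1)] K.M.r_zero by simp
    qed
    then show "H = carrier ?K" using SH by blast
  qed
  ultimately show ?thesis unfolding minimal_presentation_def by blast
qed

section \<open>The Auslander--Reiten translation\<close>

lemma regular_module_simps [simp]:
  "carrier (regular_module \<Lambda>) = carrier \<Lambda>" "\<zero>\<^bsub>regular_module \<Lambda>\<^esub> = \<zero>\<^bsub>\<Lambda>\<^esub>"
  "x \<oplus>\<^bsub>regular_module \<Lambda>\<^esub> y = x \<oplus>\<^bsub>\<Lambda>\<^esub> y" "x \<odot>\<^bsub>regular_module \<Lambda>\<^esub> y = x \<otimes>\<^bsub>\<Lambda>\<^esub> y"
  by (auto simp: regular_module_def)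

lemma regular_left_module:
  assumes "ring \<Lambda>"
  shows "left_module \<Lambda> (regular_module \<Lambda>)"
proof -
  interpret ring \<Lambda> by fact
  show ?thesis
  proof (rule left_moduleI)
    fix x assume "x \<in> carrier (regular_module \<Lambda>)"
    then show "\<exists>y\<in>carrier (regular_module \<Lambda>). y \<oplus>\<^bsub>regular_module \<Lambda>\<^esub> x = \<zero>\<^bsub>regular_module \<Lambda>\<^esub>"
      by (intro bexI[of _ "\<ominus>\<^bsub>\<Lambda>\<^esub> x"]) (auto simp: l_neg)
  qed (auto simp: a_ac m_assoc l_distr r_distr ring_axioms)
qed

lemma hom_to_regular_simps [simp]:
  "carrier (hom_to_regular \<Lambda> P) = module_hom \<Lambda> P (regular_module \<Lambda>)"
  "\<zero>\<^bsub>hom_to_regular \<Lambda> P\<^esub> = (\<lambda>x\<in>carrier P. \<zero>\<^bsub>\<Lambda>\<^esub>)"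
  "\<phi> \<oplus>\<^bsub>hom_to_regular \<Lambda> P\<^esub> \<psi> = (\<lambda>x\<in>carrier P. \<phi> x \<oplus>\<^bsub>\<Lambda>\<^esub> \<psi> x)"
  "a \<odot>\<^bsub>hom_to_regular \<Lambda> P\<^esub> \<phi> = (\<lambda>x\<in>carrier P. \<phi> x \<otimes>\<^bsub>\<Lambda>\<^esub> a)"
  by (auto simp: hom_to_regular_def)

lemma dual_module_carrier:
  "\<phi> \<in> carrier (dual_module \<Lambda> N) \<longleftrightarrow> \<phi> \<in> extensional (carrier N) \<and>
    (\<forall>x\<in>carrier N. \<forall>y\<in>carrier N. \<phi> (x \<oplus>\<^bsub>N\<^esub> y) = \<phi> x + \<phi> y) \<and>
    (\<forall>c. \<forall>x\<in>carrier N. \<phi> ((c \<odot>\<^bsub>\<Lambda>\<^esub> \<one>\<^bsub>\<Lambda>\<^esub>) \<odot>\<^bsub>N\<^esub> x) = c * \<phi> x)"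
  by (simp add: dual_module_def)

lemma dual_module_ops:
  "\<zero>\<^bsub>dual_module \<Lambda> N\<^esub> = (\<lambda>x\<in>carrier N. 0)"
  "\<phi> \<oplus>\<^bsub>dual_module \<Lambda> N\<^esub> \<psi> = (\<lambda>x\<in>carrier N. \<phi> x + \<psi> x)"
  "a \<odot>\<^bsub>dual_module \<Lambda> N\<^esub> \<phi> = (\<lambda>x\<in>carrier N. \<phi> (a \<odot>\<^bsub>N\<^esub> x))"
  by (simp_all add: dual_module_def)

lemma hom_to_regular_closed:
  assumes P: "left_module \<Lambda> P" and f: "\<phi> \<in> module_hom \<Lambda> P (regular_module \<Lambda>)"
  shows "\<psi> \<in> module_hom \<Lambda> P (regular_module \<Lambda>) \<Longrightarrow> \<phi> \<oplus>\<^bsub>hom_to_regular \<Lambda> P\<^esub> \<psi> \<in> module_hom \<Lambda> P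
      (regular_module \<Lambda>)"
    "a \<in> carrier \<Lambda> \<Longrightarrow> a \<odot>\<^bsub>hom_to_regular \<Lambda> P\<^esub> \<phi> \<in> module_hom \<Lambda> P (regular_module \<Lambda>)"
proof -
  interpret left_module \<Lambda> P by fact
  note f = module_homD(1-3)[OF f, simplified]
  show "\<phi> \<oplus>\<^bsub>hom_to_regular \<Lambda> P\<^esub> \<psi> \<in> module_hom \<Lambda> P (regular_module \<Lambda>)" if "\<psi> \<in> module_hom \<Lambda> P
      (regular_module \<Lambda>)"
    unfolding hom_to_regular_simps
    by (rule left_module_homI[OF P]) (use f module_homD(1-3)[OF that, simplified] in \<open>auto simp:
        R.a_ac R.r_distr\<close>)
  show "a \<odot>\<^bsub>hom_to_regular \<Lambda> P\<^esub> \<phi> \<in> module_hom \<Lambda> P (regular_module \<Lambda>)" if "a \<in> carrier \<Lambda>"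
    unfolding hom_to_regular_simps
    by (rule left_module_homI[OF P]) (use f that in \<open>auto simp: R.m_assoc R.l_distr\<close>)
qed

lemma hom_to_regular_abelian_group:
  assumes P: "left_module \<Lambda> P"
  shows "abelian_group (hom_to_regular \<Lambda> P)"
proof -
  interpret left_module \<Lambda> P by fact
  let ?G = "hom_to_regular \<Lambda> P"
  have c: "\<phi> x \<in> carrier \<Lambda>" if "\<phi> \<in> carrier ?G" "x \<in> carrier P" for \<phi> x
    using module_homD(1)[of \<phi>] that by fastforce
  have e: "\<phi> \<in> extensional (carrier P)" if "\<phi> \<in> carrier ?G" for \<phi>
    using module_homD(4)[of \<phi>] that by fastforce
  show ?thesis
  proof (rule abelian_groupI)
    show "x \<oplus>\<^bsub>?G\<^esub> y \<in> carrier ?G" if "x \<in> carrier ?G" "y \<in> carrier ?G" for x y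
      using hom_to_regular_closed(1)[OF P] that unfolding hom_to_regular_simps(1) by blast
    show "\<zero>\<^bsub>?G\<^esub> \<in> carrier ?G" unfolding hom_to_regular_simps
      by (rule left_module_homI[OF P]) auto
    show "x \<oplus>\<^bsub>?G\<^esub> y \<oplus>\<^bsub>?G\<^esub> z = x \<oplus>\<^bsub>?G\<^esub> (y \<oplus>\<^bsub>?G\<^esub> z)" if "x \<in> carrier ?G" "y \<in> carrier ?G" "z \<in> carrier ?G"
        for x y z
      using c[OF that(1)] c[OF that(2)] c[OF that(3)] by (auto simp: R.a_assoc restrict_def
          fun_eq_iff)
    show "x \<oplus>\<^bsub>?G\<^esub> y = y \<oplus>\<^bsub>?G\<^esub> x" if "x \<in> carrier ?G" "y \<in> carrier ?G" for x y
      using c[OF that(1)] c[OF that(2)] by (auto simp: R.a_comm restrict_def fun_eq_iff)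
    show "\<zero>\<^bsub>?G\<^esub> \<oplus>\<^bsub>?G\<^esub> x = x" if "x \<in> carrier ?G" for x
      using c[OF that] e[OF that] by (intro extensionalityI[OF _ e[OF that]]) auto
    show "\<exists>y\<in>carrier ?G. y \<oplus>\<^bsub>?G\<^esub> x = \<zero>\<^bsub>?G\<^esub>" if "x \<in> carrier ?G" for x
    proof (rule bexI)
      show "(\<ominus>\<^bsub>\<Lambda>\<^esub> \<one>\<^bsub>\<Lambda>\<^esub>) \<odot>\<^bsub>?G\<^esub> x \<in> carrier ?G"
        using hom_to_regular_closed(2)[OF P] that unfolding hom_to_regular_simps(1) by blast
      show "(\<ominus>\<^bsub>\<Lambda>\<^esub> \<one>\<^bsub>\<Lambda>\<^esub>) \<odot>\<^bsub>?G\<^esub> x \<oplus>\<^bsub>?G\<^esub> x = \<zero>\<^bsub>?G\<^esub>"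
        using c[OF that] by (auto simp: R.r_minus R.l_neg restrict_def fun_eq_iff)
    qed
  qed
qed

text \<open>\<open>G\<close> is taken as an abelian group since it will be the set of homomorphisms
  into the algebra, whose scalars belong to the opposite algebra. In the last part a single scalar
  \<open>a\<close> acts: it preserves \<open>H\<close>, so the union in the definition of the action
  on cosets collapses to one coset.\<close>

lemma quotient_module_facts:
  fixes G :: "('l, 'g) module" and H :: "'g set"
  assumes "abelian_group G" and H: "H \<subseteq> carrier G" "\<zero>\<^bsub>G\<^esub> \<in> H" "\<forall>x\<in>H. \<forall>y\<in>H. x \<oplus>\<^bsub>G\<^esub> y \<in> H"
      "\<forall>x\<in>H. \<ominus>\<^bsub>G\<^esub> x \<in> H"
  defines "Q \<equiv> quotient_module G H"
  shows "carrier Q = (\<lambda>x. H +>\<^bsub>G\<^esub> x) ` carrier G" "\<zero>\<^bsub>Q\<^esub> = H"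
    "x \<in> carrier G \<Longrightarrow> y \<in> carrier G \<Longrightarrow> (H +>\<^bsub>G\<^esub> x) \<oplus>\<^bsub>Q\<^esub> (H +>\<^bsub>G\<^esub> y) = H +>\<^bsub>G\<^esub> (x \<oplus>\<^bsub>G\<^esub> y)"
    "x \<in> H \<Longrightarrow> H +>\<^bsub>G\<^esub> x = H"
    "x \<in> carrier G \<Longrightarrow> x \<in> H +>\<^bsub>G\<^esub> x"
    "z \<in> H +>\<^bsub>G\<^esub> x \<Longrightarrow> \<exists>h\<in>H. z = h \<oplus>\<^bsub>G\<^esub> x"
    "(\<And>h. h \<in> H \<Longrightarrow> a \<odot>\<^bsub>G\<^esub> h \<in> H) \<Longrightarrow> (\<And>h x. h \<in> carrier G \<Longrightarrow> x \<in> carrier G \<Longrightarrow> a \<odot>\<^bsub>G\<^esub> (h \<oplus>\<^bsub>G\<^esub> x) = a \<odot>\<^bsub>G\<^esub> h \<oplus>\<^bsub>G\<^esub> a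
        \<odot>\<^bsub>G\<^esub> x) \<Longrightarrow>
      (\<And>x. x \<in> carrier G \<Longrightarrow> a \<odot>\<^bsub>G\<^esub> x \<in> carrier G) \<Longrightarrow>
      x \<in> carrier G \<Longrightarrow> a \<odot>\<^bsub>Q\<^esub> (H +>\<^bsub>G\<^esub> x) = H +>\<^bsub>G\<^esub> (a \<odot>\<^bsub>G\<^esub> x)"
proof -
  interpret abelian_group G by fact
  have sg: "subgroup H (add_monoid G)"
    by (intro subgroup.intro) (use H in \<open>auto simp: a_inv_def\<close>)
  interpret H: additive_subgroup H G by (rule additive_subgroup.intro[OF sg])
  interpret H: abelian_subgroup H G by (rule abelian_subgroupI3[OF H.additive_subgroup_axioms
      abelian_group_axioms])
  have mem: "z \<in> H +>\<^bsub>G\<^esub> x \<longleftrightarrow> (\<exists>h\<in>H. z = h \<oplus>\<^bsub>G\<^esub> x)" for z x by (auto simp: a_r_coset_def')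
  show "carrier Q = (\<lambda>x. H +>\<^bsub>G\<^esub> x) ` carrier G"
    by (auto simp: Q_def quotient_module_def A_RCOSETS_def')
  show "\<zero>\<^bsub>Q\<^esub> = H" by (simp add: Q_def quotient_module_def)
  show "(H +>\<^bsub>G\<^esub> x) \<oplus>\<^bsub>Q\<^esub> (H +>\<^bsub>G\<^esub> y) = H +>\<^bsub>G\<^esub> (x \<oplus>\<^bsub>G\<^esub> y)" if "x \<in> carrier G" "y \<in> carrier G"
    using H.a_rcos_sum[OF that] by (simp add: Q_def quotient_module_def)
  show join: "H +>\<^bsub>G\<^esub> x = H" if "x \<in> H" for x
    using a_coset_join2[OF _ sg that] that H(1) by blast
  show "x \<in> H +>\<^bsub>G\<^esub> x" if "x \<in> carrier G" using that H(2) by (auto simp: mem intro!: bexI[of _ "\<zero>\<^bsub>G\<^esub>"])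
  show "\<exists>h\<in>H. z = h \<oplus>\<^bsub>G\<^esub> x" if "z \<in> H +>\<^bsub>G\<^esub> x" using that by (simp add: mem)
  assume aH: "\<And>h. h \<in> H \<Longrightarrow> a \<odot>\<^bsub>G\<^esub> h \<in> H"
    and ad: "\<And>h x. h \<in> carrier G \<Longrightarrow> x \<in> carrier G \<Longrightarrow> a \<odot>\<^bsub>G\<^esub> (h \<oplus>\<^bsub>G\<^esub> x) = a \<odot>\<^bsub>G\<^esub> h \<oplus>\<^bsub>G\<^esub> a \<odot>\<^bsub>G\<^esub> x"
    and ac: "\<And>x. x \<in> carrier G \<Longrightarrow> a \<odot>\<^bsub>G\<^esub> x \<in> carrier G" and x: "x \<in> carrier G"
  have "H +>\<^bsub>G\<^esub> (a \<odot>\<^bsub>G\<^esub> (h \<oplus>\<^bsub>G\<^esub> x)) = H +>\<^bsub>G\<^esub> (a \<odot>\<^bsub>G\<^esub> x)" if h: "h \<in> H" for h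
  proof -
    have hc: "h \<in> carrier G" using h H(1) by blast
    have "H +>\<^bsub>G\<^esub> (a \<odot>\<^bsub>G\<^esub> h \<oplus>\<^bsub>G\<^esub> a \<odot>\<^bsub>G\<^esub> x) = (H +>\<^bsub>G\<^esub> (a \<odot>\<^bsub>G\<^esub> h)) +>\<^bsub>G\<^esub> (a \<odot>\<^bsub>G\<^esub> x)"
      using a_coset_add_assoc[OF H(1) ac[OF hc] ac[OF x]] by simp
    then show ?thesis using join[OF aH[OF h]] ad[OF hc x] by simp
  qed
  then have eq: "H +>\<^bsub>G\<^esub> (a \<odot>\<^bsub>G\<^esub> z) = H +>\<^bsub>G\<^esub> (a \<odot>\<^bsub>G\<^esub> x)" if "z \<in> H +>\<^bsub>G\<^esub> x" for z
    using that unfolding mem by blast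
  have "a \<odot>\<^bsub>Q\<^esub> (H +>\<^bsub>G\<^esub> x) = (\<Union>z\<in>H +>\<^bsub>G\<^esub> x. H +>\<^bsub>G\<^esub> (a \<odot>\<^bsub>G\<^esub> z))"
    by (simp add: Q_def quotient_module_def)
  also have "\<dots> = (\<Union>z\<in>H +>\<^bsub>G\<^esub> x. H +>\<^bsub>G\<^esub> (a \<odot>\<^bsub>G\<^esub> x))"
    by (rule SUP_cong[OF refl eq])
  also have "\<dots> = H +>\<^bsub>G\<^esub> (a \<odot>\<^bsub>G\<^esub> x)" using H(2) mem[of "\<zero>\<^bsub>G\<^esub> \<oplus>\<^bsub>G\<^esub> x"] by fastforce
  finally show "a \<odot>\<^bsub>Q\<^esub> (H +>\<^bsub>G\<^esub> x) = H +>\<^bsub>G\<^esub> (a \<odot>\<^bsub>G\<^esub> x)" .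
qed

text \<open>In the dual, ground field scalars act through multiples of the unit. Their centrality is
  what makes the form constructed below linear in this sense.\<close>

lemma algebra_A_scalar:
  fixes x :: "(nat, nat) path \<Rightarrow> 'k::field"
  assumes "x \<in> carrier (algebra_A n)"
  shows "(c \<odot>\<^bsub>algebra_A n\<^esub> \<one>\<^bsub>algebra_A n\<^esub>) \<in> carrier (algebra_A n)"
    "x \<otimes>\<^bsub>algebra_A n\<^esub> (c \<odot>\<^bsub>algebra_A n\<^esub> \<one>\<^bsub>algebra_A n\<^esub>) = (c \<odot>\<^bsub>algebra_A n\<^esub> \<one>\<^bsub>algebra_A n\<^esub>) \<otimes>\<^bsub>algebra_A n\<^esub> x"
proof -
  let ?A = "algebra_A n :: 'k path_alg"
  interpret ring ?A by (rule algebra_A_ring)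
  have cl: "(\<lambda>\<pi>. c * y \<pi>) \<in> carrier ?A" if "y \<in> carrier ?A" for y :: "(nat, nat) path \<Rightarrow> 'k"
    using that unfolding algebra_A_carrier by auto
  show c1: "(c \<odot>\<^bsub>?A\<^esub> \<one>\<^bsub>?A\<^esub>) \<in> carrier ?A" unfolding algebra_A_simps by (rule cl[OF algebra_A_one(1)])
  have "x \<otimes>\<^bsub>?A\<^esub> (c \<odot>\<^bsub>?A\<^esub> \<one>\<^bsub>?A\<^esub>) = (\<lambda>\<pi>. c * (x \<otimes>\<^bsub>?A\<^esub> \<one>\<^bsub>?A\<^esub>) \<pi>)"
  proof (rule algebra_A_ext[of _ n])
    fix i j :: nat
    show "(x \<otimes>\<^bsub>?A\<^esub> (c \<odot>\<^bsub>?A\<^esub> \<one>\<^bsub>?A\<^esub>)) (pth i j) = c * (x \<otimes>\<^bsub>?A\<^esub> \<one>\<^bsub>?A\<^esub>) (pth i j)"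
      unfolding algebra_A_mult[OF assms c1] algebra_A_mult[OF assms algebra_A_one(1)]
          by (simp add: sum_distrib_left algebra_simps)
  qed (use assms c1 in \<open>auto intro!: cl m_closed\<close>)
  moreover have "(c \<odot>\<^bsub>?A\<^esub> \<one>\<^bsub>?A\<^esub>) \<otimes>\<^bsub>?A\<^esub> x = (\<lambda>\<pi>. c * (\<one>\<^bsub>?A\<^esub> \<otimes>\<^bsub>?A\<^esub> x) \<pi>)"
  proof (rule algebra_A_ext[of _ n])
    fix i j :: nat
    show "((c \<odot>\<^bsub>?A\<^esub> \<one>\<^bsub>?A\<^esub>) \<otimes>\<^bsub>?A\<^esub> x) (pth i j) = c * (\<one>\<^bsub>?A\<^esub> \<otimes>\<^bsub>?A\<^esub> x) (pth i j)"
      unfolding algebra_A_mult[OF c1 assms] algebra_A_mult[OF algebra_A_one(1) assms]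
          by (simp add: sum_distrib_left algebra_simps)
  qed (use assms c1 in \<open>auto intro!: cl m_closed\<close>)
  ultimately show "x \<otimes>\<^bsub>?A\<^esub> (c \<odot>\<^bsub>?A\<^esub> \<one>\<^bsub>?A\<^esub>) = (c \<odot>\<^bsub>?A\<^esub> \<one>\<^bsub>?A\<^esub>) \<otimes>\<^bsub>?A\<^esub> x" using assms by (simp only: l_one r_one)
qed

lemma imod_scalar:
  assumes v: "ivalid n I a b" and f: "f \<in> carrier (imod n I a b)"
  shows "((c \<odot>\<^bsub>algebra_A n\<^esub> \<one>\<^bsub>algebra_A n\<^esub>) \<odot>\<^bsub>imod n I a b\<^esub> f) k = c * f k"
proof -
  interpret left_module "algebra_A n" "imod n I a b" by (rule imod_left_module[OF v])
  obtain i j where k: "k = prod_encode (i, j)" by (metis prod_decode_inverse surj_pair)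
  have "((c \<odot>\<^bsub>algebra_A n\<^esub> \<one>\<^bsub>algebra_A n\<^esub>) \<odot>\<^bsub>imod n I a b\<^esub> f) k = c * (\<one>\<^bsub>algebra_A n\<^esub> \<odot>\<^bsub>imod n I a b\<^esub> f) k"
    unfolding k imod_smult by (simp add: sum_distrib_left mult.assoc)
  then show ?thesis using smult_one[OF f] by simp
qed

section \<open>Homomorphisms into the translate and rigidity\<close>

text \<open>For valid intervals, the excluded configuration is the numerical criterion for a nonzero
  homomorphism from the interval of \<open>j\<close> to the translate of the interval of
  \<open>i\<close>, which runs from \<open>a i + 1\<close> to \<open>b i\<close>: a tail of the
  translate is then a quotient of the interval of \<open>j\<close>.\<close>

definition compatible :: "nat set \<Rightarrow> (nat \<Rightarrow> nat) \<Rightarrow> (nat \<Rightarrow> nat) \<Rightarrow> bool" where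
  "compatible I a b \<longleftrightarrow> (\<forall>i\<in>I. \<forall>j\<in>I. \<not> (a i < a j \<and> a j \<le> b i \<and> b i < b j))"

text \<open>
  A homomorphism from \<open>M\<close> to \<open>D (Tr M)\<close> is a bilinear form \<open>B\<close> on \<open>M\<close> and \<open>Hom (P1, \<Lambda>)\<close> with
  \<open>B (\<alpha> m) \<phi> = B m (\<phi> \<alpha>)\<close> that vanishes on the image of \<open>Hom (P0, \<Lambda>)\<close>. It is determined
      by the values
  \<open>B y (\<psi> i)\<close> at the dual basis of \<open>P1\<close>, where \<open>y\<close> lies at the vertex \<open>b i\<close>. If the intervals are
  compatible then \<open>y\<close> comes from the vertex \<open>a i\<close>, and the path from \<open>a i\<close> to \<open>b i\<close> carries \<open>\<psi> i\<close>
  into the image of \<open>Hom (P0, \<Lambda>)\<close>. If the intervals \<open>i\<close> and \<open>j\<close> are incompatible then the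
  coordinate of the summand \<open>j\<close> at the vertex \<open>b i\<close> defines a nonzero form.
\<close>

lemma hom_to_tau_vanishes_iff:
  fixes n :: nat
  defines "A \<equiv> (algebra_A n :: 'k::field path_alg)"
  assumes v: "ivalid n I a b" and M: "left_module A M"
    and \<Phi>: "\<Phi> \<in> module_hom A (imod n I a b) M" "bij_betw \<Phi> (carrier (imod n I a b)) (carrier M)"
    and mp: "minimal_presentation A P1 f P0 p (M :: 'k rep)"
  shows "hom_vanishes A M (dual_module A (transpose_of A P1 f P0)) \<longleftrightarrow> compatible I a b"
proof -
  let ?D = "imod n I a b :: 'k rep"
  let ?P = "pmod n I a :: 'k rep"
  let ?K = "pmod n (syz n I b) b :: 'k rep"
  let ?R = "regular_module A"
  from mp obtain \<Psi>0 \<Psi>1 where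
    \<Psi>0: "\<Psi>0 \<in> module_hom A ?P P0" "bij_betw \<Psi>0 (carrier ?P) (carrier P0)" and
    \<Psi>1: "\<Psi>1 \<in> module_hom A ?K P1" "bij_betw \<Psi>1 (carrier ?K) (carrier P1)" and
    fq0: "\<And>i. i \<in> syz n I b \<Longrightarrow> f (\<Psi>1 (uv i (b i) 1)) = pel n (a i) (b i) 1 \<odot>\<^bsub>P0\<^esub> \<Psi>0 (uv i (a i) 1)" and
    f: "f \<in> module_hom A P1 P0" and P0: "left_module A P0" and P1: "left_module A P1"
    unfolding A_def by (rule minimal_presentation_structure[OF v M[unfolded A_def] \<Phi>(1)[unfolded
        A_def] \<Phi>(2)]) blast
  note vp = pmod_valid[OF v] and vs = syz_valid[OF v]
  have val: "1 \<le> a i" "a i < b i" "b i \<le> Suc n" if "i \<in> I" for i using that v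
      by (auto simp: ivalid_def)
  have vals: "i \<in> I" "1 \<le> b i" "b i \<le> n" "a i < b i" if "i \<in> syz n I b" for i using that val[of i]
      by auto
  have ring: "ring A" unfolding A_def by (rule algebra_A_ring)
  have D: "left_module A ?D" unfolding A_def by (rule imod_left_module[OF v])
  have Dp: "left_module A ?P" unfolding A_def by (rule imod_left_module[OF vp])
  have K: "left_module A ?K" unfolding A_def by (rule imod_left_module[OF vs])
  have R: "left_module A ?R" by (rule regular_left_module[OF ring])
  interpret M: left_module A M by (rule M)
  have pA: "pel n j k c \<in> carrier A" for j k c by (simp add: A_def)
  have pm: "pel n k l c \<otimes>\<^bsub>A\<^esub> pel n j k d = pel n j l (c * d)" if "j \<le> k" "k \<le> l" for j k l c d
    unfolding A_def by (rule pel_mult[OF that])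
  define q where "q i = \<Psi>1 (uv i (b i) 1)" for i
  define z where "z i = \<Psi>0 (uv i (a i) 1)" for i
  have qc: "q i \<in> carrier P1" if "i \<in> syz n I b" for i
    unfolding q_def by (rule module_homD(1)[OF \<Psi>1(1) pel_one_uv(4)[OF vs that]])
  have zc: "z i \<in> carrier P0" if "i \<in> I" for i
    unfolding z_def by (rule module_homD(1)[OF \<Psi>0(1) pel_one_uv(4)[OF vp that]])
  have fq: "f (q i) = pel n (a i) (b i) 1 \<odot>\<^bsub>P0\<^esub> z i" if "i \<in> syz n I b" for i
    using fq0[OF that] by (simp add: q_def z_def)
  have qe: "pel n (b i) (b i) 1 \<odot>\<^bsub>P1\<^esub> q i = q i" if "i \<in> syz n I b" for i
    unfolding q_def using module_homD(3)[OF \<Psi>1(1) pA pel_one_uv(4)[OF vs that], of "b i" "b i" 1 1]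
    by (simp add: pel_one_uv(1)[OF vs that])
  have \<Psi>1s: "\<Psi>1 ` carrier ?K = carrier P1" using \<Psi>1(2) by (simp add: bij_betw_def)
  define G where "G = hom_to_regular A P1"
  define G0 where "G0 = module_hom A P0 ?R"
  define H where "H = (\<lambda>\<phi>. compose (carrier P1) \<phi> f) ` G0"
  define T where "T = transpose_of A P1 f P0"
  have TQ: "T = quotient_module G H" by (simp add: T_def transpose_of_def G_def H_def G0_def)
  have Gc: "carrier G = module_hom A P1 ?R" by (simp add: G_def)
  have Gadd: "\<phi> \<oplus>\<^bsub>G\<^esub> \<psi> = (\<lambda>x\<in>carrier P1. \<phi> x \<oplus>\<^bsub>A\<^esub> \<psi> x)" for \<phi> \<psi> by (simp add: G_def)
  have Gsm: "\<alpha> \<odot>\<^bsub>G\<^esub> \<phi> = (\<lambda>x\<in>carrier P1. \<phi> x \<otimes>\<^bsub>A\<^esub> \<alpha>)" for \<phi> \<alpha> by (simp add: G_def)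
  have Gz: "\<zero>\<^bsub>G\<^esub> = (\<lambda>x\<in>carrier P1. \<zero>\<^bsub>A\<^esub>)" by (simp add: G_def)
  have G: "abelian_group G" unfolding G_def by (rule hom_to_regular_abelian_group[OF P1])
  interpret G: abelian_group G by (rule G)
  have Gsc: "\<alpha> \<odot>\<^bsub>G\<^esub> \<phi> \<in> carrier G" if "\<alpha> \<in> carrier A" "\<phi> \<in> carrier G" for \<alpha> \<phi>
    using hom_to_regular_closed(2)[OF P1] that unfolding Gc unfolding G_def by blast
  have Gv: "\<phi> x \<in> carrier A" if "\<phi> \<in> carrier G" "x \<in> carrier P1" for \<phi> x
    using module_homD(1)[of \<phi> A P1 ?R x] that unfolding Gc by simp
  have G0v: "\<phi> x \<in> carrier A" if "\<phi> \<in> G0" "x \<in> carrier P0" for \<phi> x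
    using module_homD(1)[of \<phi> A P0 ?R x] that unfolding G0_def by simp
  have fc: "f x \<in> carrier P0" if "x \<in> carrier P1" for x by (rule module_homD(1)[OF f that])
  have HG: "H \<subseteq> carrier G" unfolding H_def Gc G0_def using module_hom_compose[OF f _ P1] by blast
  have Hsm: "\<alpha> \<odot>\<^bsub>G\<^esub> h \<in> H" if \<alpha>: "\<alpha> \<in> carrier A" and h: "h \<in> H" for \<alpha> h
  proof -
    obtain \<phi> where \<phi>: "\<phi> \<in> G0" "h = compose (carrier P1) \<phi> f" using h by (auto simp: H_def)
    have "\<alpha> \<odot>\<^bsub>hom_to_regular A P0\<^esub> \<phi> \<in> G0" using hom_to_regular_closed(2)[OF P0] \<phi>(1) \<alpha>
        unfolding G0_def by blast
    moreover have "\<alpha> \<odot>\<^bsub>G\<^esub> h = compose (carrier P1) (\<alpha> \<odot>\<^bsub>hom_to_regular A P0\<^esub> \<phi>) f"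
      unfolding Gsm \<phi>(2) by (rule extensionalityI[where A = "carrier P1"]) (auto simp: compose_def
          fc)
    ultimately show ?thesis by (auto simp: H_def)
  qed
  have Hadd1: "h \<oplus>\<^bsub>G\<^esub> k \<in> H" if hk: "h \<in> H" "k \<in> H" for h k
  proof -
    obtain \<phi> \<psi> where \<phi>: "\<phi> \<in> G0" "h = compose (carrier P1) \<phi> f" and \<psi>: "\<psi> \<in> G0" "k
        = compose (carrier P1) \<psi> f"
      using hk by (auto simp: H_def)
    have "\<phi> \<oplus>\<^bsub>hom_to_regular A P0\<^esub> \<psi> \<in> G0" using hom_to_regular_closed(1)[OF P0] \<phi>(1) \<psi>(1)
        unfolding G0_def by blast
    moreover have "h \<oplus>\<^bsub>G\<^esub> k = compose (carrier P1) (\<phi> \<oplus>\<^bsub>hom_to_regular A P0\<^esub> \<psi>) f"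
      unfolding Gadd \<phi>(2) \<psi>(2) by (rule extensionalityI[where A
          = "carrier P1"]) (auto simp: compose_def fc)
    ultimately show ?thesis by (auto simp: H_def)
  qed
  have Hz: "\<zero>\<^bsub>G\<^esub> \<in> H"
  proof -
    have "\<zero>\<^bsub>hom_to_regular A P0\<^esub> \<in> G0"
      using abelian_monoid.zero_closed[OF abelian_group.axioms(1)[OF
          hom_to_regular_abelian_group[OF P0]]] by (simp add: G0_def)
    moreover have "\<zero>\<^bsub>G\<^esub> = compose (carrier P1) \<zero>\<^bsub>hom_to_regular A P0\<^esub> f"
      unfolding Gz by (rule extensionalityI[where A = "carrier P1"]) (auto simp: compose_def fc)
    ultimately show ?thesis by (auto simp: H_def)
  qed
  have Hneg1: "\<ominus>\<^bsub>G\<^esub> h \<in> H" if h: "h \<in> H" for h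
  proof -
    have hG: "h \<in> carrier G" using h HG by blast
    have "(\<ominus>\<^bsub>A\<^esub> \<one>\<^bsub>A\<^esub>) \<odot>\<^bsub>G\<^esub> h \<oplus>\<^bsub>G\<^esub> h = \<zero>\<^bsub>G\<^esub>"
      unfolding Gsm Gadd Gz by (rule extensionalityI[where A = "carrier P1"]) (auto simp: Gv[OF
          hG] M.R.r_minus M.R.l_neg)
    then have "\<ominus>\<^bsub>G\<^esub> h = (\<ominus>\<^bsub>A\<^esub> \<one>\<^bsub>A\<^esub>) \<odot>\<^bsub>G\<^esub> h"
      by (rule G.minus_equality) (use hG Gsc in auto)
    then show ?thesis using Hsm[OF _ h] by simp
  qed
  have Gsd: "\<alpha> \<odot>\<^bsub>G\<^esub> (\<phi> \<oplus>\<^bsub>G\<^esub> \<psi>) = \<alpha> \<odot>\<^bsub>G\<^esub> \<phi> \<oplus>\<^bsub>G\<^esub> \<alpha> \<odot>\<^bsub>G\<^esub> \<psi>" if "\<alpha> \<in> carrier A" "\<phi> \<in> carrier G" "\<psi> \<in> carrier G"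
      for \<alpha> \<phi> \<psi>
    unfolding Gsm Gadd by (rule extensionalityI[where A = "carrier P1"]) (auto simp: Gv that
        M.R.l_distr)
  define co where "co \<phi> = H +>\<^bsub>G\<^esub> \<phi>" for \<phi>
  have Hadd: "\<forall>x\<in>H. \<forall>y\<in>H. x \<oplus>\<^bsub>G\<^esub> y \<in> H" and Hneg: "\<forall>x\<in>H. \<ominus>\<^bsub>G\<^esub> x \<in> H"
    using Hadd1 Hneg1 by blast+
  note Q = quotient_module_facts[OF G HG Hz Hadd Hneg, folded TQ co_def]
  have Qsm: "\<alpha> \<odot>\<^bsub>T\<^esub> co \<phi> = co (\<alpha> \<odot>\<^bsub>G\<^esub> \<phi>)" if "\<alpha> \<in> carrier A" "\<phi> \<in> carrier G" for \<alpha> \<phi>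
    by (rule Q(7)) (use Hsm Gsd Gsc that in auto)
  \<comment> \<open>Dual basis elements: a homomorphism out of a projective can be prescribed on the
    generators, and the idempotent at \<open>b i\<close> is a permitted value because it lives at
    the vertex of the generator.\<close>
  have psi: "\<exists>\<psi>\<in>carrier G. \<forall>k\<in>syz n I b. \<psi> (q k) = (if k = i then pel n (b i) (b i) 1 else \<zero>\<^bsub>A\<^esub>)"
      for i
  proof -
    obtain \<psi> where "\<psi> \<in> module_hom A P1 ?R" "\<And>k. k \<in> syz n I b \<Longrightarrow> \<psi> (q k) = (if k
        = i then pel n (b i) (b i) 1 else \<zero>\<^bsub>A\<^esub>)"
      unfolding A_def q_def
    proof (rule imod_iso_hom_ex[OF vs P1[unfolded A_def] R[unfolded A_def] \<Psi>1(1)[unfolded A_def]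
        \<Psi>1(2),
        of "\<lambda>k. if k = i then pel n (b i) (b i) 1 else \<zero>\<^bsub>algebra_A n\<^esub>"], unfold A_def[symmetric]
            regular_module_simps)
      fix k assume k: "k \<in> syz n I b"
      show xc: "(if k = i then pel n (b i) (b i) 1 else \<zero>\<^bsub>A\<^esub>) \<in> carrier A" using pA by auto
      show "pel n (b k) (b k) 1 \<otimes>\<^bsub>A\<^esub> (if k = i then pel n (b i) (b i) 1 else \<zero>\<^bsub>A\<^esub>) = (if k
          = i then pel n (b i) (b i) 1 else \<zero>\<^bsub>A\<^esub>)"
        by (cases "k = i") (simp_all add: pm M.R.r_null[OF pA])
      have "pel n (b k) (Suc n) 1 = \<zero>\<^bsub>A\<^esub>" by (simp add: pel_out A_def)
      then show "pel n (b k) (Suc n) 1 \<otimes>\<^bsub>A\<^esub> (if k = i then pel n (b i) (b i) 1 else \<zero>\<^bsub>A\<^esub>) = \<zero>\<^bsub>A\<^esub>"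
        using M.R.l_null[OF xc] by simp
    qed blast
    then show ?thesis unfolding Gc by blast
  qed
  have phi: "\<exists>\<phi>\<in>G0. \<forall>k\<in>I. \<phi> (z k) = (if k = i then pel n (a i) (a i) 1 else \<zero>\<^bsub>A\<^esub>)" for i
  proof -
    obtain \<phi> where "\<phi> \<in> module_hom A P0 ?R" "\<And>k. k \<in> I \<Longrightarrow> \<phi> (z k) = (if k
        = i then pel n (a i) (a i) 1 else \<zero>\<^bsub>A\<^esub>)"
      unfolding A_def z_def
    proof (rule imod_iso_hom_ex[OF vp P0[unfolded A_def] R[unfolded A_def] \<Psi>0(1)[unfolded A_def]
        \<Psi>0(2),
        of "\<lambda>k. if k = i then pel n (a i) (a i) 1 else \<zero>\<^bsub>algebra_A n\<^esub>"], unfold A_def[symmetric]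
            regular_module_simps)
      fix k assume k: "k \<in> I"
      show xc: "(if k = i then pel n (a i) (a i) 1 else \<zero>\<^bsub>A\<^esub>) \<in> carrier A" using pA by auto
      show "pel n (a k) (a k) 1 \<otimes>\<^bsub>A\<^esub> (if k = i then pel n (a i) (a i) 1 else \<zero>\<^bsub>A\<^esub>) = (if k
          = i then pel n (a i) (a i) 1 else \<zero>\<^bsub>A\<^esub>)"
        by (cases "k = i") (simp_all add: pm M.R.r_null[OF pA])
      have "pel n (a k) (Suc n) 1 = \<zero>\<^bsub>A\<^esub>" by (simp add: pel_out A_def)
      then show "pel n (a k) (Suc n) 1 \<otimes>\<^bsub>A\<^esub> (if k = i then pel n (a i) (a i) 1 else \<zero>\<^bsub>A\<^esub>) = \<zero>\<^bsub>A\<^esub>"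
        using M.R.l_null[OF xc] by simp
    qed blast
    then show ?thesis unfolding G0_def by blast
  qed
  have vanish: "hom_vanishes A M (dual_module A T)" if comp: "compatible I a b"
    unfolding hom_vanishes_def
  proof (intro ballI)
    fix \<theta> m0 assume \<theta>: "\<theta> \<in> module_hom A M (dual_module A T)" and m0: "m0 \<in> carrier M"
    define B where "B m \<phi> = \<theta> m (co \<phi>)" for m \<phi>
    have coT: "co \<phi> \<in> carrier T" if "\<phi> \<in> carrier G" for \<phi> using Q(1) that by blast
    have \<theta>c: "\<theta> m \<in> carrier (dual_module A T)" if "m \<in> carrier M" for m
        by (rule module_homD(1)[OF \<theta> that])
    have B_add: "B m (\<phi> \<oplus>\<^bsub>G\<^esub> \<psi>) = B m \<phi> + B m \<psi>" if "m \<in> carrier M" "\<phi> \<in> carrier G" "\<psi> \<in> carrier G"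
        for m \<phi> \<psi>
      using \<theta>c[OF that(1)] coT[OF that(2)] coT[OF that(3)] Q(3)[OF that(2,3)]
      unfolding B_def dual_module_def by (simp add: Q(3)[OF that(2,3), symmetric])
    have B_bal: "B (\<alpha> \<odot>\<^bsub>M\<^esub> m) \<phi> = B m (\<alpha> \<odot>\<^bsub>G\<^esub> \<phi>)" if "\<alpha> \<in> carrier A" "m \<in> carrier M" "\<phi> \<in> carrier G"
        for \<alpha> m \<phi>
      using module_homD(3)[OF \<theta> that(1,2)] coT[OF that(3)] Qsm[OF that(1,3)]
      by (simp add: B_def dual_module_def)
    \<comment> \<open>\<open>h\<close> and \<open>h + h\<close> have the same coset, so additivity
      forces the value to be zero.\<close>
    have B_H: "B m h = 0" if "m \<in> carrier M" "h \<in> H" for m h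
    proof -
      have hG: "h \<in> carrier G" using that(2) HG by blast
      have "B m (h \<oplus>\<^bsub>G\<^esub> h) = B m h + 0" unfolding B_def using Q(4)[OF that(2)] Q(4)[OF Hadd1[OF
          that(2,2)]] by simp
      then show ?thesis unfolding B_add[OF that(1) hG hG] by (rule add_left_imp_eq)
    qed
    have key: "B y \<psi> = 0" if i: "i \<in> syz n I b" and \<psi>: "\<psi> \<in> carrier G" "\<forall>k\<in>syz n I b. \<psi> (q k)
        = (if k = i then pel n (b i) (b i) 1 else \<zero>\<^bsub>A\<^esub>)"
      and y: "y \<in> carrier M" "pel n (b i) (b i) 1 \<odot>\<^bsub>M\<^esub> y = y" for i \<psi> y
    proof -
      note vi = vals[OF i]
      have "y \<in> \<Phi> ` carrier ?D" using y(1) \<Phi>(2) by (simp add: bij_betw_def)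
      then obtain d where d: "d \<in> carrier ?D" "y = \<Phi> d" by auto
      interpret D: left_module A ?D by (rule D)
      have "\<Phi> (pel n (b i) (b i) 1 \<odot>\<^bsub>?D\<^esub> d) = \<Phi> d" using module_homD(3)[OF \<Phi>(1) pA d(1)] y(2) d(2)
          by simp
      then have de: "pel n (b i) (b i) 1 \<odot>\<^bsub>?D\<^esub> d = d"
        using \<Phi>(2) d(1) D.smult_closed[OF pA d(1)] unfolding bij_betw_def inj_on_def by blast
      have d0: "d (prod_encode (k, l)) = 0" if "l \<noteq> b i" for k l
        using level_zero[OF de vi(2,3) that] .
      define d' where "d' k = (if snd (prod_decode k) = a i then d (prod_encode (fst (prod_decode
          k), b i)) else 0)" for k
      have d': "d' (prod_encode (k, l)) = (if l = a i then d (prod_encode (k, b i)) else 0)"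
          for k l by (simp add: d'_def)
      have d'c: "d' \<in> carrier ?D" unfolding imod_carrier
      proof (intro allI impI)
        fix k assume k: "d' k \<noteq> 0"
        obtain s l where sl: "k = prod_encode (s, l)" by (metis prod_decode_inverse surj_pair)
        have l: "l = a i" "d (prod_encode (s, b i)) \<noteq> 0" using k
            by (auto simp: sl d' split: if_splits)
        then have s: "s \<in> I" "a s \<le> b i" "b i < b s" using imod_out[OF d(1), of s "b i"] by blast+
        \<comment> \<open>The interval of \<open>s\<close> contains \<open>b i\<close>, that is,
          \<open>a s \<le> b i < b s\<close>. Compatibility with \<open>i\<close> rules out
          \<open>a i < a s\<close>, so \<open>a i\<close> belongs to this interval too and the
          coordinate can be moved back.\<close>
        then have "a s \<le> a i" using comp vi(1) unfolding compatible_def by (meson not_less)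
        then show "k \<in> cells I a b" using s vi l by (simp add: sl)
      qed
      have "pel n (a i) (b i) 1 \<odot>\<^bsub>?D\<^esub> d' = d"
      proof (rule imod_ext)
        fix k l
        show "(pel n (a i) (b i) 1 \<odot>\<^bsub>?D\<^esub> d') (prod_encode (k, l)) = d (prod_encode (k, l))"
          using vi val[OF vi(1)] imod_out[OF d(1), of k l] d0[of l k] by (auto simp: pel_smult d')
      qed
      then have y': "y = pel n (a i) (b i) 1 \<odot>\<^bsub>M\<^esub> \<Phi> d'" using module_homD(3)[OF \<Phi>(1) pA d'c, of "a
          i" "b i" 1] d(2) by simp
      obtain \<phi> where \<phi>: "\<phi> \<in> G0" "\<forall>k\<in>I. \<phi> (z k) = (if k = i then pel n (a i) (a i) 1 else \<zero>\<^bsub>A\<^esub>)"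
          using phi by blast
      \<comment> \<open>Both sides are compared on the generators of \<open>P1\<close>. At
        \<open>q i\<close> each gives the path from \<open>a i\<close> to \<open>b i\<close>, once
        as a right factor of an idempotent and once through the diagonal form of \<open>f\<close>;
        elsewhere both vanish.\<close>
      have "pel n (a i) (b i) 1 \<odot>\<^bsub>G\<^esub> \<psi> = compose (carrier P1) \<phi> f"
      proof (rule imod_iso_hom_eqI[OF vs P1[unfolded A_def] R[unfolded A_def] \<Psi>1(1)[unfolded
          A_def] \<Psi>1s])
        show "pel n (a i) (b i) 1 \<odot>\<^bsub>G\<^esub> \<psi> \<in> module_hom (algebra_A n) P1 (regular_module (algebra_A n))"
          using Gsc[OF pA \<psi>(1)] unfolding Gc unfolding A_def .
        show "compose (carrier P1) \<phi> f \<in> module_hom (algebra_A n) P1 (regular_module (algebra_A n))"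
          using module_hom_compose[OF f \<phi>(1)[unfolded G0_def] P1] unfolding A_def .
        fix k assume k: "k \<in> syz n I b"
        have 1: "\<phi> (f (q k)) = pel n (a k) (b k) 1 \<otimes>\<^bsub>A\<^esub> \<phi> (z k)"
          using fq[OF k] module_homD(3)[OF \<phi>(1)[unfolded G0_def] pA zc[OF vals(1)[OF k]]] by simp
        have 2: "(pel n (a i) (b i) 1 \<odot>\<^bsub>G\<^esub> \<psi>) (q k) = \<psi> (q k) \<otimes>\<^bsub>A\<^esub> pel n (a i) (b i) 1" using qc[OF k]
            by (simp add: Gsm)
        have "\<psi> (q k) \<otimes>\<^bsub>A\<^esub> pel n (a i) (b i) 1 = pel n (a k) (b k) 1 \<otimes>\<^bsub>A\<^esub> \<phi> (z k)"
        proof (cases "k = i")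
          case True
          then show ?thesis using bspec[OF \<psi>(2) k] bspec[OF \<phi>(2) vals(1)[OF k]] vi by (simp add: pm)
        next
          case False
          then show ?thesis using bspec[OF \<psi>(2) k] bspec[OF \<phi>(2) vals(1)[OF k]] M.R.l_null[OF pA]
              M.R.r_null[OF pA] by simp
        qed
        then show "(pel n (a i) (b i) 1 \<odot>\<^bsub>G\<^esub> \<psi>) (\<Psi>1 (uv k (b k) 1)) = compose (carrier P1) \<phi> f (\<Psi>1
            (uv k (b k) 1))"
          using 1 2 qc[OF k] by (simp add: q_def compose_eq)
      qed
      then have "pel n (a i) (b i) 1 \<odot>\<^bsub>G\<^esub> \<psi> \<in> H" using \<phi>(1) by (auto simp: H_def)
      then show ?thesis unfolding y' using B_bal[OF pA module_homD(1)[OF \<Phi>(1) d'c] \<psi>(1)] B_H[OF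
          module_homD(1)[OF \<Phi>(1) d'c]] by simp
    qed
    \<comment> \<open>\<open>J\<close> bounds the generators of \<open>P1\<close> on which
      \<open>\<phi>\<close> may be nonzero. Each round clears one of them by adding a multiple of a
      dual basis element, on which the form vanishes.\<close>
    have ind: "finite J \<Longrightarrow> J \<subseteq> syz n I b \<Longrightarrow> (\<forall>\<phi>\<in>carrier G. (\<forall>k\<in>syz n I b - J. \<phi> (q k) = \<zero>\<^bsub>A\<^esub>)
        \<longrightarrow> (\<forall>m\<in>carrier M. B m \<phi> = 0))" for J
    proof (induction J rule: finite_induct)
      case empty
      show ?case
      proof (intro ballI impI)
        fix \<phi> m assume \<phi>: "\<phi> \<in> carrier G" "\<forall>k\<in>syz n I b - {}. \<phi> (q k) = \<zero>\<^bsub>A\<^esub>" and m: "m \<in> carrier M"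
        have "\<phi> = \<zero>\<^bsub>G\<^esub>"
        proof (rule imod_iso_hom_eqI[OF vs P1[unfolded A_def] R[unfolded A_def] \<Psi>1(1)[unfolded
            A_def] \<Psi>1s])
          show "\<phi> \<in> module_hom (algebra_A n) P1 (regular_module (algebra_A n))" "\<zero>\<^bsub>G\<^esub> \<in> module_hom
              (algebra_A n) P1 (regular_module (algebra_A n))"
            using \<phi>(1) G.zero_closed unfolding Gc unfolding A_def by auto
          fix k assume k: "k \<in> syz n I b"
          then show "\<phi> (\<Psi>1 (uv k (b k) 1)) = \<zero>\<^bsub>G\<^esub> (\<Psi>1 (uv k (b k) 1))"
            using \<phi>(2) qc[OF k] by (simp add: Gz q_def)
        qed
        then show "B m \<phi> = 0" using B_H[OF m Hz] by simp
      qed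
    next
      case (insert i J)
      show ?case
      proof (intro ballI impI)
        fix \<phi> m assume \<phi>: "\<phi> \<in> carrier G" "\<forall>k\<in>syz n I b - insert i J. \<phi> (q k) = \<zero>\<^bsub>A\<^esub>" and m: "m \<in>
            carrier M"
        have i: "i \<in> syz n I b" using insert.prems by auto
        obtain \<psi> where \<psi>: "\<psi> \<in> carrier G" "\<forall>k\<in>syz n I b. \<psi> (q k) = (if k
            = i then pel n (b i) (b i) 1 else \<zero>\<^bsub>A\<^esub>)" using psi by blast
        \<comment> \<open>\<open>\<psi> (q i)\<close> is the idempotent at \<open>b i\<close>, which
          fixes \<open>\<phi> (q i)\<close> from the left, so adding the multiple of
          \<open>\<psi>\<close> by \<open>\<beta>\<close> cancels the value at \<open>q i\<close>.
          Balancing moves \<open>\<beta>\<close> to the module argument, where it produces an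
          element at the vertex \<open>b i\<close>, as \<open>key\<close> demands.\<close>
        define \<beta> where "\<beta> = \<ominus>\<^bsub>A\<^esub> \<phi> (q i)"
        have \<phi>q: "\<phi> (q i) \<in> carrier A" by (rule Gv[OF \<phi>(1) qc[OF i]])
        have \<beta>: "\<beta> \<in> carrier A" using \<phi>q by (simp add: \<beta>_def)
        have "pel n (b i) (b i) 1 \<otimes>\<^bsub>A\<^esub> \<phi> (q i) = \<phi> (q i)"
          using module_homD(3)[OF \<phi>(1)[unfolded Gc] pA qc[OF i], of "b i" "b i" 1] qe[OF i] by simp
        then have e\<beta>: "pel n (b i) (b i) 1 \<otimes>\<^bsub>A\<^esub> \<beta> = \<beta>" using M.R.r_minus[OF pA \<phi>q]
            by (simp add: \<beta>_def)
        have B\<beta>: "B m (\<beta> \<odot>\<^bsub>G\<^esub> \<psi>) = 0"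
        proof -
          have "B (\<beta> \<odot>\<^bsub>M\<^esub> m) \<psi> = 0"
          proof (rule key[OF i \<psi>])
            show "\<beta> \<odot>\<^bsub>M\<^esub> m \<in> carrier M" using \<beta> m by simp
            show "pel n (b i) (b i) 1 \<odot>\<^bsub>M\<^esub> (\<beta> \<odot>\<^bsub>M\<^esub> m) = \<beta> \<odot>\<^bsub>M\<^esub> m" using M.smult_assoc1[OF pA \<beta> m] e\<beta>
                by metis
          qed
          then show ?thesis using B_bal[OF \<beta> m \<psi>(1)] by simp
        qed
        have \<beta>\<psi>: "\<beta> \<odot>\<^bsub>G\<^esub> \<psi> \<in> carrier G" by (rule Gsc[OF \<beta> \<psi>(1)])
        have "\<forall>k\<in>syz n I b - J. (\<phi> \<oplus>\<^bsub>G\<^esub> \<beta> \<odot>\<^bsub>G\<^esub> \<psi>) (q k) = \<zero>\<^bsub>A\<^esub>"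
        proof
          fix k assume k: "k \<in> syz n I b - J"
          then have k': "k \<in> syz n I b" by blast
          have ev: "(\<phi> \<oplus>\<^bsub>G\<^esub> \<beta> \<odot>\<^bsub>G\<^esub> \<psi>) (q k) = \<phi> (q k) \<oplus>\<^bsub>A\<^esub> \<psi> (q k) \<otimes>\<^bsub>A\<^esub> \<beta>" using qc[OF k']
              by (simp add: Gadd Gsm)
          show "(\<phi> \<oplus>\<^bsub>G\<^esub> \<beta> \<odot>\<^bsub>G\<^esub> \<psi>) (q k) = \<zero>\<^bsub>A\<^esub>"
          proof (cases "k = i")
            case True
            then have "\<psi> (q k) \<otimes>\<^bsub>A\<^esub> \<beta> = \<ominus>\<^bsub>A\<^esub> \<phi> (q k)" using bspec[OF \<psi>(2) k'] e\<beta> by (simp add: \<beta>_def)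
            then show ?thesis unfolding ev using M.R.r_neg[OF \<phi>q] True by simp
          next
            case False
            then have "\<phi> (q k) = \<zero>\<^bsub>A\<^esub>" "\<psi> (q k) = \<zero>\<^bsub>A\<^esub>" using \<phi>(2) \<psi>(2) k by auto
            then show ?thesis unfolding ev using M.R.l_null[OF \<beta>] M.R.l_zero[OF M.R.zero_closed]
                by (simp only:)
          qed
        qed
        then have "B m (\<phi> \<oplus>\<^bsub>G\<^esub> \<beta> \<odot>\<^bsub>G\<^esub> \<psi>) = 0"
          using insert.IH insert.prems G.a_closed[OF \<phi>(1) \<beta>\<psi>] m by blast
        then show "B m \<phi> = 0" using B_add[OF m \<phi>(1) \<beta>\<psi>] B\<beta> by simp
      qed
    qed
    have "finite (syz n I b)" using v by (simp add: ivalid_def)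
    then have all: "B m \<phi> = 0" if "m \<in> carrier M" "\<phi> \<in> carrier G" for m \<phi>
        using ind[of "syz n I b"] that by blast
    have "\<theta> m0 X = 0" if X: "X \<in> carrier T" for X
    proof -
      obtain \<phi> where "\<phi> \<in> carrier G" "X = co \<phi>" using X Q(1) by blast
      then show ?thesis using all[OF m0] by (simp add: B_def)
    qed
    moreover have "\<theta> m0 \<in> extensional (carrier T)" using \<theta>c[OF m0] by (simp add: dual_module_def)
    ultimately show "\<theta> m0 = \<zero>\<^bsub>dual_module A T\<^esub>"
      unfolding dual_module_def by (auto intro!: extensionalityI[where A = "carrier T"])
  qed
  have nonvanish: "\<not> hom_vanishes A M (dual_module A T)" if ij: "i \<in> I" "j \<in> I" "a i < a j" "a j \<le>
      b i" "b i < b j" for i j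
  proof -
    have i: "i \<in> syz n I b" using ij val[OF ij(2)] by auto
    note vi = vals[OF i]
    define g where "g = (\<lambda>y\<in>carrier M. inv_into (carrier ?D) \<Phi> y)"
    note g = module_hom_inv[OF D M \<Phi>, folded g_def]
    note gh = module_homD[OF g(1)]
    define \<omega> where "\<omega> m = g m (prod_encode (j, b i))" for m
    have \<omega>_add: "\<omega> (m \<oplus>\<^bsub>M\<^esub> m') = \<omega> m + \<omega> m'" if "m \<in> carrier M" "m' \<in> carrier M" for m m'
      using gh(2)[OF that] by (simp add: \<omega>_def)
    \<comment> \<open>The form evaluates \<open>\<phi>\<close> at a single generator of
      \<open>P1\<close> and lets the value act on \<open>m\<close>; balancing is then associativity
      of the action.\<close>
    define F where "F m \<phi> = \<omega> (\<phi> (q i) \<odot>\<^bsub>M\<^esub> m)" for m \<phi>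
    have \<phi>q: "\<phi> (q i) \<in> carrier A" if "\<phi> \<in> carrier G" for \<phi> by (rule Gv[OF that qc[OF i]])
    have F_add: "F m (\<phi> \<oplus>\<^bsub>G\<^esub> \<psi>) = F m \<phi> + F m \<psi>" if "m \<in> carrier M" "\<phi> \<in> carrier G" "\<psi> \<in> carrier G"
        for m \<phi> \<psi>
      using M.smult_l_distr[OF \<phi>q[OF that(2)] \<phi>q[OF that(3)] that(1)] \<phi>q that qc[OF i]
      by (simp add: F_def Gadd \<omega>_add)
    have F_add': "F (m \<oplus>\<^bsub>M\<^esub> m') \<phi> = F m \<phi> + F m' \<phi>" if "m \<in> carrier M" "m' \<in> carrier M" "\<phi> \<in> carrier
        G" for m m' \<phi>
      using M.smult_r_distr[OF \<phi>q[OF that(3)] that(1,2)] \<phi>q[OF that(3)] that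
          by (simp add: F_def \<omega>_add)
    have F_bal: "F (\<alpha> \<odot>\<^bsub>M\<^esub> m) \<phi> = F m (\<alpha> \<odot>\<^bsub>G\<^esub> \<phi>)" if "\<alpha> \<in> carrier A" "m \<in> carrier M" "\<phi> \<in> carrier G"
        for \<alpha> m \<phi>
      using M.smult_assoc1[OF \<phi>q[OF that(3)] that(1,2)] qc[OF i] by (simp add: F_def Gsm)
    \<comment> \<open>For a homomorphism that factors through \<open>f\<close>, the value at
      \<open>q i\<close> is a multiple of the path from \<open>a i\<close> to \<open>b i\<close>.
      The coordinate in the summand \<open>j\<close> thus comes from the vertex \<open>a i\<close>,
      where this summand is zero because \<open>a i < a j\<close>.\<close>
    have F_H: "F m h = 0" if m: "m \<in> carrier M" and h: "h \<in> H" for m h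
    proof -
      obtain \<phi> where \<phi>: "\<phi> \<in> G0" "h = compose (carrier P1) \<phi> f" using h by (auto simp: H_def)
      have \<phi>z: "\<phi> (z i) \<in> carrier A" by (rule G0v[OF \<phi>(1) zc[OF ij(1)]])
      have "h (q i) = pel n (a i) (b i) 1 \<otimes>\<^bsub>A\<^esub> \<phi> (z i)"
        using \<phi>(2) qc[OF i] fq[OF i] module_homD(3)[OF \<phi>(1)[unfolded G0_def] pA zc[OF ij(1)]]
            by (simp add: compose_eq)
      then have "h (q i) \<odot>\<^bsub>M\<^esub> m = pel n (a i) (b i) 1 \<odot>\<^bsub>M\<^esub> (\<phi> (z i) \<odot>\<^bsub>M\<^esub> m)"
          using M.smult_assoc1[OF pA \<phi>z m] by simp
      moreover have c: "\<phi> (z i) \<odot>\<^bsub>M\<^esub> m \<in> carrier M" using \<phi>z m by simp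
      ultimately have "g (h (q i) \<odot>\<^bsub>M\<^esub> m) = pel n (a i) (b i) 1 \<odot>\<^bsub>?D\<^esub> g (\<phi> (z i) \<odot>\<^bsub>M\<^esub> m)"
          using gh(3)[OF pA c] by simp
      then have "F m h = (pel n (a i) (b i) 1 \<odot>\<^bsub>?D\<^esub> g (\<phi> (z i) \<odot>\<^bsub>M\<^esub> m)) (prod_encode (j, b i))"
          by (simp add: F_def \<omega>_def)
      also have "\<dots> = g (\<phi> (z i) \<odot>\<^bsub>M\<^esub> m) (prod_encode (j, a i))" using vi val[OF ij(1)] ij
          by (simp add: pel_smult)
      also have "\<dots> = 0" using imod_out[OF gh(1)[OF c], of j "a i"] ij(3) by simp
      finally show ?thesis .
    qed
    have F_scal: "F m ((c \<odot>\<^bsub>A\<^esub> \<one>\<^bsub>A\<^esub>) \<odot>\<^bsub>G\<^esub> \<phi>) = c * F m \<phi>" if "m \<in> carrier M" "\<phi> \<in> carrier G" for c m \<phi>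
    proof -
      note x = \<phi>q[OF that(2)]
      note s = algebra_A_scalar[OF x[unfolded A_def], of c, folded A_def]
      have xm: "\<phi> (q i) \<odot>\<^bsub>M\<^esub> m \<in> carrier M" using x that(1) by simp
      have "((c \<odot>\<^bsub>A\<^esub> \<one>\<^bsub>A\<^esub>) \<odot>\<^bsub>G\<^esub> \<phi>) (q i) \<odot>\<^bsub>M\<^esub> m = (c \<odot>\<^bsub>A\<^esub> \<one>\<^bsub>A\<^esub>) \<odot>\<^bsub>M\<^esub> (\<phi> (q i) \<odot>\<^bsub>M\<^esub> m)"
        unfolding M.smult_assoc1[OF s(1) x that(1), symmetric] s(2)[symmetric] using qc[OF i]
            by (simp add: Gsm)
      then have "g (((c \<odot>\<^bsub>A\<^esub> \<one>\<^bsub>A\<^esub>) \<odot>\<^bsub>G\<^esub> \<phi>) (q i) \<odot>\<^bsub>M\<^esub> m) = (c \<odot>\<^bsub>A\<^esub> \<one>\<^bsub>A\<^esub>) \<odot>\<^bsub>?D\<^esub> g (\<phi> (q i) \<odot>\<^bsub>M\<^esub> m)"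
        using gh(3)[OF s(1) xm] by simp
      then show ?thesis unfolding F_def \<omega>_def using imod_scalar[OF v gh(1)[OF xm], of c]
          unfolding A_def by simp
    qed
    \<comment> \<open>The form lives on homomorphisms, but the dual consists of functionals on
      cosets. By \<open>F_H\<close> any representative gives the same value.\<close>
    define rep where "rep X = (SOME \<phi>. \<phi> \<in> X)" for X :: "((nat \<Rightarrow> 'k) \<Rightarrow> (nat, nat) path \<Rightarrow> 'k) set"
    have F_rep: "F m (rep (co \<phi>)) = F m \<phi>" if "m \<in> carrier M" "\<phi> \<in> carrier G" for m \<phi>
    proof -
      have "rep (co \<phi>) \<in> co \<phi>" unfolding rep_def using Q(5)[OF that(2)] by (rule someI[where P
          = "\<lambda>\<phi>'. \<phi>' \<in> co \<phi>"])
      then obtain h where h: "h \<in> H" "rep (co \<phi>) = h \<oplus>\<^bsub>G\<^esub> \<phi>" using Q(6) by blast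
      have hG: "h \<in> carrier G" using h(1) HG by blast
      show ?thesis unfolding h(2) using F_add[OF that(1) hG that(2)] F_H[OF that(1) h(1)] by simp
    qed
    define \<theta> where "\<theta> = (\<lambda>m\<in>carrier M. \<lambda>X\<in>carrier T. F m (rep X))"
    have coT: "co \<phi> \<in> carrier T" if "\<phi> \<in> carrier G" for \<phi> using Q(1) that by blast
    have \<theta>co: "\<theta> m (co \<phi>) = F m \<phi>" if "m \<in> carrier M" "\<phi> \<in> carrier G" for m \<phi>
      using that coT F_rep by (simp add: \<theta>_def)
    have "\<theta> \<in> module_hom A M (dual_module A T)"
      unfolding \<theta>_def
    proof (rule left_module_homI[OF M, where F = "\<lambda>m. \<lambda>X\<in>carrier T. F m (rep X)"])
      fix m assume m: "m \<in> carrier M"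
      let ?t = "\<lambda>X\<in>carrier T. F m (rep X)"
      have tco: "?t (co \<phi>) = F m \<phi>" if "\<phi> \<in> carrier G" for \<phi>
        unfolding restrict_apply'[OF coT[OF that]] by (rule F_rep[OF m that])
      show "?t \<in> carrier (dual_module A T)"
        unfolding dual_module_carrier
      proof (intro conjI ballI allI)
        fix X Y assume XY: "X \<in> carrier T" "Y \<in> carrier T"
        obtain \<phi> where X: "\<phi> \<in> carrier G" "X = co \<phi>" using XY(1) Q(1) by blast
        obtain \<psi> where Y: "\<psi> \<in> carrier G" "Y = co \<psi>" using XY(2) Q(1) by blast
        show "?t (X \<oplus>\<^bsub>T\<^esub> Y) = ?t X + ?t Y"
          unfolding X(2) Y(2) Q(3)[OF X(1) Y(1)] tco[OF X(1)] tco[OF Y(1)] tco[OF G.a_closed[OF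
              X(1) Y(1)]]
          by (rule F_add[OF m X(1) Y(1)])
      next
        fix c X assume "X \<in> carrier T"
        then obtain \<phi> where X: "\<phi> \<in> carrier G" "X = co \<phi>" using Q(1) by blast
        have s: "c \<odot>\<^bsub>A\<^esub> \<one>\<^bsub>A\<^esub> \<in> carrier A" using algebra_A_scalar(1)[OF \<phi>q[OF X(1), unfolded A_def], of
            c] by (simp add: A_def)
        show "?t ((c \<odot>\<^bsub>A\<^esub> \<one>\<^bsub>A\<^esub>) \<odot>\<^bsub>T\<^esub> X) = c * ?t X"
          unfolding X(2) Qsm[OF s X(1)] tco[OF X(1)] tco[OF Gsc[OF s X(1)]]
          by (rule F_scal[OF m X(1)])
      qed (rule restrict_extensional)
    next
      fix m m' assume m: "m \<in> carrier M" "m' \<in> carrier M"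
      show "(\<lambda>X\<in>carrier T. F (m \<oplus>\<^bsub>M\<^esub> m') (rep X)) = (\<lambda>X\<in>carrier T. F m (rep X)) \<oplus>\<^bsub>dual_module A T\<^esub>
          (\<lambda>X\<in>carrier T. F m' (rep X))"
      proof (rule extensionalityI[where A = "carrier T"])
        fix X assume X: "X \<in> carrier T"
        then obtain \<phi> where \<phi>: "\<phi> \<in> carrier G" "X = co \<phi>" using Q(1) by blast
        show "(\<lambda>X\<in>carrier T. F (m \<oplus>\<^bsub>M\<^esub> m') (rep X)) X = ((\<lambda>X\<in>carrier T. F m (rep X)) \<oplus>\<^bsub>dual_module A
            T\<^esub> (\<lambda>X\<in>carrier T. F m' (rep X))) X"
          using X F_rep[OF m(1) \<phi>(1)] F_rep[OF m(2) \<phi>(1)] F_rep[OF M.M.a_closed[OF m] \<phi>(1)]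
              F_add'[OF m \<phi>(1)]
          by (simp add: \<phi>(2) dual_module_ops)
      qed (auto simp: dual_module_ops)
    next
      fix \<alpha> m assume \<alpha>: "\<alpha> \<in> carrier A" and m: "m \<in> carrier M"
      show "(\<lambda>X\<in>carrier T. F (\<alpha> \<odot>\<^bsub>M\<^esub> m) (rep X)) = \<alpha> \<odot>\<^bsub>dual_module A T\<^esub> (\<lambda>X\<in>carrier T. F m (rep X))"
      proof (rule extensionalityI[where A = "carrier T"])
        fix X assume X: "X \<in> carrier T"
        then obtain \<phi> where \<phi>: "\<phi> \<in> carrier G" "X = co \<phi>" using Q(1) by blast
        show "(\<lambda>X\<in>carrier T. F (\<alpha> \<odot>\<^bsub>M\<^esub> m) (rep X)) X = (\<alpha> \<odot>\<^bsub>dual_module A T\<^esub> (\<lambda>X\<in>carrier T. F m (rep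
            X))) X"
          using X F_rep[OF m Gsc[OF \<alpha> \<phi>(1)]] F_rep[OF M.smult_closed[OF \<alpha> m] \<phi>(1)] F_bal[OF \<alpha> m
              \<phi>(1)] coT[OF Gsc[OF \<alpha> \<phi>(1)]]
          by (simp add: \<phi>(2) dual_module_ops Qsm[OF \<alpha> \<phi>(1)])
      qed (auto simp: dual_module_ops)
    qed
    moreover
    \<comment> \<open>The inequalities \<open>a j \<le> b i\<close> and \<open>b i < b j\<close> say
      that \<open>b i\<close> lies in the interval of \<open>j\<close>, so this is a basis vector of
      \<open>?D\<close>. Together with the dual basis element of \<open>i\<close> it gives the form
      the value one.\<close>
    let ?u = "uv j (b i) 1 :: nat \<Rightarrow> 'k"
    have u: "?u \<in> carrier ?D" using ij by (intro uv_carrier) auto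
    have \<Phi>u: "\<Phi> ?u \<in> carrier M" by (rule module_homD(1)[OF \<Phi>(1) u])
    obtain \<psi> where \<psi>: "\<psi> \<in> carrier G" "\<psi> (q i) = pel n (b i) (b i) 1" using psi[of i] i by auto
    have "g (pel n (b i) (b i) 1 \<odot>\<^bsub>M\<^esub> \<Phi> ?u) = pel n (b i) (b i) 1 \<odot>\<^bsub>?D\<^esub> ?u"
      using gh(3)[OF pA \<Phi>u] g(3)[OF u] by simp
    then have "F (\<Phi> ?u) \<psi> = 1" using vi ij by (simp add: F_def \<omega>_def \<psi>(2) pel_smult)
    then have "\<theta> (\<Phi> ?u) (co \<psi>) \<noteq> 0" using \<theta>co[OF \<Phi>u \<psi>(1)] by simp
    then have "\<theta> (\<Phi> ?u) \<noteq> \<zero>\<^bsub>dual_module A T\<^esub>" using coT[OF \<psi>(1)] by (auto simp: dual_module_def)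
    ultimately show ?thesis using \<Phi>u unfolding hom_vanishes_def by blast
  qed
  show ?thesis unfolding T_def[symmetric] using vanish nonvanish unfolding compatible_def by blast
qed

theorem tau_rigid_iff:
  fixes n :: nat
  defines "A \<equiv> (algebra_A n :: 'k::field path_alg)"
  assumes v: "ivalid n I a b" and M: "left_module A M"
    and iso: "module_iso A (imod n I a b) (M :: 'k rep)"
  shows "tau_rigid A M \<longleftrightarrow> compatible I a b"
proof -
  let ?D = "imod n I a b :: 'k rep"
  obtain \<Phi> where \<Phi>: "\<Phi> \<in> module_hom A ?D M" "bij_betw \<Phi> (carrier ?D) (carrier M)"
    using iso by (auto simp: module_iso_def)
  have surj: "\<Phi> ` carrier ?D = carrier M" using \<Phi>(2) by (simp add: bij_betw_def)
  have fg: "fin_gen_module A M"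
    using fin_gen_module_surj[OF imod_fin_gen[OF v, where 'a = 'k] M[unfolded A_def] \<Phi>(1)[unfolded
        A_def] surj] by (simp add: A_def)
  define S where "S = (SOME (P1, f, P0, p). minimal_presentation A P1 f P0 p M)"
  obtain P1 f P0 p where S: "S = (P1, f, P0, p)" by (metis prod_cases4)
  \<comment> \<open>Existence turns the tuple selected by \<open>SOME\<close> into a minimal
    presentation, and the criterion holds for every such presentation.\<close>
  have ex: "\<exists>x. (\<lambda>(P1, f, P0, p). minimal_presentation A P1 f P0 p M) x"
    using minimal_presentation_ex[OF v M[unfolded A_def] iso[unfolded A_def]] unfolding A_def
        by auto
  have "(\<lambda>(P1, f, P0, p). minimal_presentation A P1 f P0 p M) S"
    unfolding S_def by (rule someI_ex[OF ex])
  then have mp: "minimal_presentation A P1 f P0 p M" by (simp add: S)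
  have "AR_translate A M = dual_module A (transpose_of A P1 f P0)"
    unfolding AR_translate_def S_def[symmetric] S by simp
  then show ?thesis unfolding tau_rigid_def
    using fg hom_to_tau_vanishes_iff[OF v M[unfolded A_def] \<Phi>(1)[unfolded A_def] \<Phi>(2) mp[unfolded
        A_def]] by (simp add: A_def)
qed

section \<open>The two complexes\<close>

lemma trivial_iso:
  assumes "left_module R M" "left_module R N" "carrier M = {\<zero>\<^bsub>M\<^esub>}" "carrier N = {\<zero>\<^bsub>N\<^esub>}"
  shows "module_iso R M N"
proof -
  interpret M: left_module R M by fact
  interpret N: left_module R N by fact
  show ?thesis
  proof (rule module_isoI[OF assms(1,2)])
    show "(\<lambda>x\<in>carrier M. \<zero>\<^bsub>N\<^esub>) \<in> module_hom R M N" by (rule left_module_homI[OF assms(1)]) auto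
    show "(\<lambda>x\<in>carrier N. \<zero>\<^bsub>M\<^esub>) \<in> module_hom R N M" by (rule left_module_homI[OF assms(2)]) auto
  qed (use assms(3,4) in auto)
qed

text \<open>Brings the external sum of the two components of a pair, whose carrier consists of
  pairs, under the criterion \<open>basic_distinct\<close> for sums of intervals.\<close>

lemma imod_sum_iso:
  fixes n :: nat
  defines "A \<equiv> (algebra_A n :: 'k::field path_alg)"
  assumes v: "ivalid n (I \<union> J) a b" and disj: "I \<inter> J = {}"
  shows "module_iso A (imod n (I \<union> J) a b) (direct_sum (imod n I a b) (imod n J a b))"
proof -
  let ?U = "imod n (I \<union> J) a b :: 'k rep"
  let ?I = "imod n I a b :: 'k rep"
  let ?J = "imod n J a b :: 'k rep"
  have vI: "ivalid n I a b" and vJ: "ivalid n J a b" using v by (auto simp: ivalid_def)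
  have U: "left_module A ?U" and I: "left_module A ?I" and J: "left_module A ?J"
    unfolding A_def by (rule imod_left_module[OF v] imod_left_module[OF vI] imod_left_module[OF
        vJ])+
  interpret U: left_module A ?U by (rule U)
  have S: "left_module A (direct_sum ?I ?J)" by (rule direct_sum_left_module[OF I J])
  have IU: "x \<in> carrier ?U" if "x \<in> carrier ?I" for x using imod_sub_carrier[of I "I \<union> J" n a b]
      that by blast
  have JU: "x \<in> carrier ?U" if "x \<in> carrier ?J" for x using imod_sub_carrier[of J "I \<union> J" n a b]
      that by blast
  let ?f = "\<lambda>p\<in>carrier (direct_sum ?I ?J). fst p \<oplus>\<^bsub>?U\<^esub> snd p"
  have f: "?f \<in> module_hom A (direct_sum ?I ?J) ?U"
  proof (rule left_module_homI[OF S])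
    fix \<alpha> p assume \<alpha>: "\<alpha> \<in> carrier A" and "p \<in> carrier (direct_sum ?I ?J)"
    then have p: "fst p \<in> carrier ?I" "snd p \<in> carrier ?J" by (auto simp del: imod_simps)
    have "\<alpha> \<odot>\<^bsub>?U\<^esub> (fst p \<oplus>\<^bsub>?U\<^esub> snd p) = \<alpha> \<odot>\<^bsub>?U\<^esub> fst p \<oplus>\<^bsub>?U\<^esub> \<alpha> \<odot>\<^bsub>?U\<^esub> snd p"
      by (rule U.smult_r_distr[OF \<alpha> IU[OF p(1)] JU[OF p(2)]])
    then show "fst (\<alpha> \<odot>\<^bsub>direct_sum ?I ?J\<^esub> p) \<oplus>\<^bsub>?U\<^esub> snd (\<alpha> \<odot>\<^bsub>direct_sum ?I ?J\<^esub> p) = \<alpha> \<odot>\<^bsub>?U\<^esub> (fst p \<oplus>\<^bsub>?U\<^esub> snd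
        p)"
      using imod_sub_smult[OF _ p(1), of "I \<union> J" \<alpha>] imod_sub_smult[OF _ p(2), of "I \<union> J" \<alpha>] by simp
  next
    fix p assume "p \<in> carrier (direct_sum ?I ?J)"
    then show "fst p \<oplus>\<^bsub>?U\<^esub> snd p \<in> carrier ?U" using U.M.a_closed IU JU by auto
  qed (auto simp: fun_eq_iff)
  have "inj_on ?f (carrier (direct_sum ?I ?J))"
    unfolding module_hom_inj_iff[OF S U f]
  proof (intro ballI impI)
    fix p assume p: "p \<in> carrier (direct_sum ?I ?J)" and "?f p = \<zero>\<^bsub>?U\<^esub>"
    then have z: "fst p k + snd p k = 0" for k by (simp add: fun_eq_iff)
    have p': "fst p \<in> carrier ?I" "snd p \<in> carrier ?J" using p by auto
    have "fst p (prod_encode (i, j)) = 0 \<and> snd p (prod_encode (i, j)) = 0" for i j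
      using z[of "prod_encode (i, j)"] imod_out[OF p'(1), of i j] imod_out[OF p'(2), of i j] disj
          by fastforce
    then have "fst p = (\<lambda>_. 0)" "snd p = (\<lambda>_. 0)" by (auto intro!: imod_ext)
    then show "p = \<zero>\<^bsub>direct_sum ?I ?J\<^esub>" by (simp add: prod_eq_iff)
  qed
  moreover have "?f ` carrier (direct_sum ?I ?J) = carrier ?U"
  proof (intro equalityI subsetI)
    fix x assume "x \<in> carrier ?U"
    moreover have "I \<union> J - I = J" using disj by blast
    ultimately obtain y z where yz: "y \<in> carrier ?I" "z \<in> carrier ?J" "x = y \<oplus>\<^bsub>?U\<^esub> z"
      using imod_sub_decomp[OF v, of I, where 'k = 'k] unfolding direct_decomp_iff[OF U[unfolded
          A_def]] by auto
    then show "x \<in> ?f ` carrier (direct_sum ?I ?J)" by (intro image_eqI[of _ _ "(y, z)"]) auto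
  next
    fix x assume "x \<in> ?f ` carrier (direct_sum ?I ?J)"
    then show "x \<in> carrier ?U" using module_homD(1)[OF f] by blast
  qed
  ultimately have "module_iso A (direct_sum ?I ?J) ?U"
    unfolding module_iso_def using f by (intro bexI[OF _ f]) (simp add: bij_betw_def)
  then show ?thesis by (rule module_iso_sym[OF S U])
qed

text \<open>Homomorphisms from the projective at \<open>c\<close> correspond to the elements of
  \<open>M\<close> at the vertex \<open>c\<close>, and such a nonzero element exists iff some
  interval of \<open>M\<close> contains \<open>c\<close>.\<close>

lemma hom_vanishes_pmod_iff:
  fixes n :: nat
  defines "A \<equiv> (algebra_A n :: 'k::field path_alg)"
  assumes v: "ivalid n I a b" and vP: "ivalid n J c (\<lambda>_. Suc n)" and M: "left_module A M" and P:
      "left_module A P"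
    and isoM: "module_iso A (imod n I a b) M" and isoP: "module_iso A (pmod n J c) P"
  shows "hom_vanishes A P M \<longleftrightarrow> (\<forall>i\<in>I. \<forall>j\<in>J. \<not> (a i \<le> c j \<and> c j < b i))"
proof -
  let ?D = "imod n I a b :: 'k rep"
  let ?P = "pmod n J c :: 'k rep"
  interpret M: left_module A M by (rule M)
  have D: "left_module A ?D" unfolding A_def by (rule imod_left_module[OF v])
  obtain \<Phi> where \<Phi>: "\<Phi> \<in> module_hom A ?D M" "bij_betw \<Phi> (carrier ?D) (carrier M)"
    using isoM by (auto simp: module_iso_def)
  obtain \<Psi> where \<Psi>: "\<Psi> \<in> module_hom A ?P P" "bij_betw \<Psi> (carrier ?P) (carrier P)"
    using isoP by (auto simp: module_iso_def)
  have \<Psi>s: "\<Psi> ` carrier ?P = carrier P" using \<Psi>(2) by (simp add: bij_betw_def)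
  define g where "g = (\<lambda>y\<in>carrier M. inv_into (carrier ?D) \<Phi> y)"
  note g = module_hom_inv[OF D M \<Phi>, folded g_def]
  have pA: "pel n j k c \<in> carrier A" for j k c by (simp add: A_def)
  have val: "1 \<le> c j" "c j \<le> n" if "j \<in> J" for j using that vP by (auto simp: ivalid_def)
  have uc: "\<Psi> (uv j (c j) 1) \<in> carrier P" if "j \<in> J" for j
    by (rule module_homD(1)[OF \<Psi>(1) pel_one_uv(4)[OF vP that]])
  show ?thesis
  proof
    assume van: "hom_vanishes A P M"
    show "\<forall>i\<in>I. \<forall>j\<in>J. \<not> (a i \<le> c j \<and> c j < b i)"
    proof (intro ballI notI)
      fix i j assume i: "i \<in> I" and j: "j \<in> J" and ij: "a i \<le> c j \<and> c j < b i"
      let ?u = "uv i (c j) 1 :: nat \<Rightarrow> 'k"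
      have u: "?u \<in> carrier ?D" using i ij by (intro uv_carrier) auto
      have \<Phi>u: "\<Phi> ?u \<in> carrier M" by (rule module_homD(1)[OF \<Phi>(1) u])
      have e: "pel n (c j) (c j) 1 \<odot>\<^bsub>?D\<^esub> ?u = ?u" using val[OF j] i ij by (simp add: pel_smult_uv)
      obtain f where f: "f \<in> module_hom A P M" "\<And>k. k \<in> J \<Longrightarrow> f (\<Psi> (uv k (c k) 1)) = (if k
          = j then \<Phi> ?u else \<zero>\<^bsub>M\<^esub>)"
        unfolding A_def
      proof (rule imod_iso_hom_ex[OF vP P[unfolded A_def] M[unfolded A_def] \<Psi>(1)[unfolded A_def]
          \<Psi>(2), of "\<lambda>k. if k = j then \<Phi> ?u else \<zero>\<^bsub>M\<^esub>"])
        fix k assume k: "k \<in> J"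
        show xc: "(if k = j then \<Phi> ?u else \<zero>\<^bsub>M\<^esub>) \<in> carrier M" using \<Phi>u by simp
        show "pel n (c k) (c k) 1 \<odot>\<^bsub>M\<^esub> (if k = j then \<Phi> ?u else \<zero>\<^bsub>M\<^esub>) = (if k = j then \<Phi> ?u else \<zero>\<^bsub>M\<^esub>)"
          using module_homD(3)[OF \<Phi>(1) pA u, of "c j" "c j" 1] e M.smult_r_null[OF pA] by simp
        show "pel n (c k) (Suc n) 1 \<odot>\<^bsub>M\<^esub> (if k = j then \<Phi> ?u else \<zero>\<^bsub>M\<^esub>) = \<zero>\<^bsub>M\<^esub>"
          using M.smult_l_null[OF xc] by (simp add: pel_out A_def)
      qed blast
      have "\<Phi> ?u = \<zero>\<^bsub>M\<^esub>" using van f(1) f(2)[OF j] uc[OF j] unfolding hom_vanishes_def by auto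
      then have "?u = \<zero>\<^bsub>?D\<^esub>" using \<Phi>(2) u module_hom_inj_iff[OF D M \<Phi>(1)] by (auto simp: bij_betw_def)
      then have "?u (prod_encode (i, c j)) = 0" by simp
      then show False by (simp del: prod_encode_eq)
    qed
  next
    assume no: "\<forall>i\<in>I. \<forall>j\<in>J. \<not> (a i \<le> c j \<and> c j < b i)"
    show "hom_vanishes A P M"
      unfolding hom_vanishes_def
    proof (intro ballI)
      fix f x assume f: "f \<in> module_hom A P M" and x: "x \<in> carrier P"
      have zh: "(\<lambda>x\<in>carrier P. \<zero>\<^bsub>M\<^esub>) \<in> module_hom A P M"
        by (rule left_module_homI[OF P]) (use M.smult_r_null in auto)
      have "f = (\<lambda>x\<in>carrier P. \<zero>\<^bsub>M\<^esub>)"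
      proof (rule imod_iso_hom_eqI[OF vP P[unfolded A_def] M[unfolded A_def] \<Psi>(1)[unfolded A_def]
          \<Psi>s f[unfolded A_def] zh[unfolded A_def]])
        fix j assume j: "j \<in> J"
        define y where "y = f (\<Psi> (uv j (c j) 1))"
        have yc: "y \<in> carrier M" unfolding y_def by (rule module_homD(1)[OF f uc[OF j]])
        have "pel n (c j) (c j) 1 \<odot>\<^bsub>P\<^esub> \<Psi> (uv j (c j) 1) = \<Psi> (uv j (c j) 1)"
          using module_homD(3)[OF \<Psi>(1) pA pel_one_uv(4)[OF vP j], of "c j" "c j" 1 1]
              by (simp add: pel_one_uv(1)[OF vP j])
        then have "pel n (c j) (c j) 1 \<odot>\<^bsub>M\<^esub> y = y" using module_homD(3)[OF f pA uc[OF j], of "c j"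
            "c j" 1] by (simp add: y_def)
        then have e: "pel n (c j) (c j) 1 \<odot>\<^bsub>?D\<^esub> g y = g y" using module_homD(3)[OF g(1) pA yc, of "c
            j" "c j" 1] by simp
        have "g y = (\<lambda>_. 0)"
        proof (rule imod_ext)
          fix i l
          show "g y (prod_encode (i, l)) = 0"
            using level_zero[OF e val[OF j], of l i] imod_out[OF module_homD(1)[OF g(1) yc], of i
                l] no j by (cases "l = c j") auto
        qed
        then have "y = \<Phi> \<zero>\<^bsub>?D\<^esub>" using g(4)[OF yc] by simp
        then show "f (\<Psi> (uv j (c j) 1)) = (\<lambda>x\<in>carrier P. \<zero>\<^bsub>M\<^esub>) (\<Psi> (uv j (c j) 1))"
          using module_hom_zero[OF D M \<Phi>(1)] uc[OF j] by (simp add: y_def)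
      qed
      then show "f x = \<zero>\<^bsub>M\<^esub>" using x by simp
    qed
  qed
qed

section \<open>Noncrossing families of intervals and the complex of rigid modules\<close>

definition intervals :: "nat \<Rightarrow> (nat \<times> nat) set" where
  "intervals n = {(a, b). 1 \<le> a \<and> a < b \<and> b \<le> Suc n}"

definition noncrossing :: "(nat \<times> nat) set \<Rightarrow> bool" where
  "noncrossing S \<longleftrightarrow> (\<forall>s\<in>S. \<forall>t\<in>S. \<not> (fst s < fst t \<and> fst t \<le> snd s \<and> snd s < snd t))"

definition cls :: "nat \<Rightarrow> nat \<times> nat \<Rightarrow> 'k::field rep set" where
  "cls n s = iso_class (algebra_A n) (iv n (fst s) (snd s))"

text \<open>An interval serves as the index of its own summand.\<close>

definition smod :: "nat \<Rightarrow> (nat \<times> nat) set \<Rightarrow> 'k::field rep" where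
  "smod n S = imod n (prod_encode ` S) (\<lambda>i. fst (prod_decode i)) (\<lambda>i. snd (prod_decode i))"

lemma finite_intervals: "finite (intervals n)"
  by (rule finite_subset[of _ "{1..n} \<times> {1..Suc n}"]) (auto simp: intervals_def)

lemma smod_valid:
  assumes "S \<subseteq> intervals n"
  shows "ivalid n (prod_encode ` S) (\<lambda>i. fst (prod_decode i)) (\<lambda>i. snd (prod_decode i))"
  using assms finite_subset[OF assms finite_intervals] by (auto simp: ivalid_def intervals_def)

lemma smod_left_module: "S \<subseteq> intervals n \<Longrightarrow> left_module (algebra_A n) (smod n S)"
  unfolding smod_def by (rule imod_left_module[OF smod_valid])

lemma smod_summand_classes:
  fixes n :: nat
  defines "A \<equiv> (algebra_A n :: 'k::field path_alg)"
  assumes S: "S \<subseteq> intervals n"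
  shows "{iso_class A (sub_module (smod n S) B) | B. direct_summand A (smod n S) B
      \<and> indecomposable A (sub_module (smod n S) B)}
    = cls n ` S"
proof -
  note M = smod_left_module[OF S]
  have "{iso_class A (sub_module (smod n S) B) | B. direct_summand A (smod n S) B
      \<and> indecomposable A (sub_module (smod n S) B)}
    = (\<lambda>i. iso_class A (iv n (fst (prod_decode i)) (snd (prod_decode i)))) ` prod_encode ` S"
    unfolding A_def
    by (rule summand_classes[OF smod_valid[OF S] M]) (use module_iso_refl[OF M] in \<open>simp add:
        smod_def\<close>)
  then show ?thesis by (simp add: image_image cls_def A_def)
qed

lemma smod_tau_rigid_iff:
  assumes S: "S \<subseteq> intervals n"
  shows "tau_rigid (algebra_A n) (smod n S :: 'k::field rep) \<longleftrightarrow> noncrossing S"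
proof -
  note M = smod_left_module[OF S]
  have "tau_rigid (algebra_A n) (smod n S :: 'k rep) \<longleftrightarrow>
    compatible (prod_encode ` S) (\<lambda>i. fst (prod_decode i)) (\<lambda>i. snd (prod_decode i))"
    by (rule tau_rigid_iff[OF smod_valid[OF S] M]) (use module_iso_refl[OF M] in \<open>simp add:
        smod_def\<close>)
  also have "\<dots> \<longleftrightarrow> noncrossing S" by (auto simp: compatible_def noncrossing_def)
  finally show ?thesis .
qed

text \<open>Repetitions among the intervals disappear in the image set. Both the classes of the
  summands and rigidity can be read from this set, which becomes the simplex of a rigid
  \<open>M\<close>.\<close>

lemma decomposition_intervals:
  fixes n :: nat
  defines "A \<equiv> (algebra_A n :: 'k::field path_alg)"
  assumes v: "ivalid n I a b" and M: "left_module A M"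
    and iso: "module_iso A (imod n I a b) (M :: 'k rep)"
  shows "(\<lambda>i. (a i, b i)) ` I \<subseteq> intervals n"
    "{iso_class A (sub_module M B) | B. direct_summand A M B \<and> indecomposable A (sub_module M B)}
      = cls n ` (\<lambda>i. (a i, b i)) ` I"
    "tau_rigid A M \<longleftrightarrow> noncrossing ((\<lambda>i. (a i, b i)) ` I)"
proof -
  show "(\<lambda>i. (a i, b i)) ` I \<subseteq> intervals n" using v by (auto simp: ivalid_def intervals_def)
  show "{iso_class A (sub_module M B) | B. direct_summand A M B \<and> indecomposable A (sub_module M B)}
      = cls n ` (\<lambda>i. (a i, b i)) ` I"
    using summand_classes[OF v M[unfolded A_def] iso[unfolded A_def]]
        by (simp add: A_def cls_def image_image)
  show "tau_rigid A M \<longleftrightarrow> noncrossing ((\<lambda>i. (a i, b i)) ` I)"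
    using tau_rigid_iff[OF v M[unfolded A_def] iso[unfolded A_def]]
        by (simp add: A_def compatible_def noncrossing_def)
qed

lemma iv_left_module: "s \<in> intervals n \<Longrightarrow> left_module (algebra_A n) (iv n (fst s) (snd s))"
  by (rule imod_left_module[OF iv_valid]) (auto simp: intervals_def)

lemma iv_tau_rigid:
  assumes "s \<in> intervals n"
  shows "tau_rigid (algebra_A n) (iv n (fst s) (snd s) :: 'k::field rep)"
proof -
  have v: "ivalid n {0} (\<lambda>_. fst s) (\<lambda>_. snd s)" using assms
      by (auto simp: ivalid_def intervals_def)
  note M = iv_left_module[OF assms]
  show ?thesis using tau_rigid_iff[OF v M module_iso_refl[OF M]] by (simp add: compatible_def)
qed

lemma cls_eq_iff:
  assumes "s \<in> intervals n" "t \<in> intervals n"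
  shows "(cls n s :: 'k::field rep set) = cls n t \<longleftrightarrow> s = t"
proof -
  have "(cls n s :: 'k rep set) = cls n t \<longleftrightarrow>
      module_iso (algebra_A n) (iv n (fst s) (snd s) :: 'k rep) (iv n (fst t) (snd t))"
    unfolding cls_def by (rule iso_class_eq_iff[OF iv_left_module[OF assms(1)] iv_left_module[OF
        assms(2)]])
  also have "\<dots> \<longleftrightarrow> fst s = fst t \<and> snd s = snd t"
    by (rule iv_iso_iff) (use assms in \<open>auto simp: intervals_def\<close>)
  finally show ?thesis by (simp add: prod_eq_iff)
qed

text \<open>A noncrossing set \<open>S\<close> is realised by \<open>smod n S\<close>. There every
  interval indexes its own summand, so the intervals are distinct by construction and the module is
  basic.\<close>

theorem tau_tilting_complex_algebra_A:
  "tau_tilting_complex (algebra_A n :: 'k::field path_alg) =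
    (cls n ` intervals n, (\<lambda>S. cls n ` S) ` {S. S \<subseteq> intervals n \<and> noncrossing S})"
  (is "tau_tilting_complex ?A = _")
proof -
  have "{iso_class ?A M | M. tau_rigid ?A M \<and> indecomposable ?A M} = cls n ` intervals n"
  proof (intro equalityI subsetI)
    fix c assume "c \<in> {iso_class ?A M | M. tau_rigid ?A M \<and> indecomposable ?A M}"
    then obtain M where c: "c = iso_class ?A M" "tau_rigid ?A M" "indecomposable ?A M" by blast
    have fg: "fin_gen_module ?A M" using c(2) by (simp add: tau_rigid_def)
    then have M: "left_module ?A M" by (simp add: fin_gen_module_def)
    obtain a b where ab: "1 \<le> a" "a < b" "b \<le> Suc n" "module_iso ?A (iv n a b) M"
      using indecomposable_iso_iv[OF fg c(3)] by blast
    then have s: "(a, b) \<in> intervals n" by (simp add: intervals_def)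
    have "c = cls n (a, b)" using iso_class_eq_iff[OF iv_left_module[OF s] M] ab(4) c(1)
        by (simp add: cls_def)
    then show "c \<in> cls n ` intervals n" using s by blast
  next
    fix c :: "'k rep set" assume "c \<in> cls n ` intervals n"
    then obtain s where s: "s \<in> intervals n" "c = cls n s" by blast
    then show "c \<in> {iso_class ?A M | M. tau_rigid ?A M \<and> indecomposable ?A M}"
      using iv_tau_rigid[OF s(1), where 'k = 'k] iv_indecomposable[of "fst s" "snd s" n, where 'k
          = 'k]
      unfolding cls_def by (auto simp: intervals_def)
  qed
  moreover have "{{iso_class ?A (sub_module M B) | B. direct_summand ?A M B
      \<and> indecomposable ?A (sub_module M B)} | M.
      tau_rigid ?A M \<and> basic ?A M} = (\<lambda>S. cls n ` S) ` {S. S \<subseteq> intervals n \<and> noncrossing S}"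
  proof (intro equalityI subsetI)
    fix \<sigma> assume "\<sigma> \<in> {{iso_class ?A (sub_module M B) | B. direct_summand ?A M B
        \<and> indecomposable ?A (sub_module M B)} | M.
      tau_rigid ?A M \<and> basic ?A M}"
    then obtain M where \<sigma>: "\<sigma> = {iso_class ?A (sub_module M B) | B. direct_summand ?A M B
        \<and> indecomposable ?A (sub_module M B)}"
      and r: "tau_rigid ?A M" by blast
    have fg: "fin_gen_module ?A M" using r by (simp add: tau_rigid_def)
    then have M: "left_module ?A M" by (simp add: fin_gen_module_def)
    obtain I a b where D: "ivalid n I a b" "module_iso ?A (imod n I a b) M"
        using fin_gen_decomposition[OF fg] by blast
    note di = decomposition_intervals[OF D(1) M D(2)]
    show "\<sigma> \<in> (\<lambda>S. cls n ` S) ` {S. S \<subseteq> intervals n \<and> noncrossing S}"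
      using di r unfolding \<sigma> by blast
  next
    fix \<sigma> :: "'k rep set set" assume "\<sigma> \<in> (\<lambda>S. cls n ` S) ` {S. S \<subseteq> intervals n \<and> noncrossing S}"
    then obtain S where S: "S \<subseteq> intervals n" "noncrossing S" "\<sigma> = cls n ` S" by blast
    have "basic ?A (smod n S)"
      by (rule basic_distinct[OF smod_valid[OF S(1)] smod_left_module[OF S(1)]])
        (use module_iso_refl[OF smod_left_module[OF S(1)]] in \<open>auto simp: smod_def\<close>)
    then show "\<sigma> \<in> {{iso_class ?A (sub_module M B) | B. direct_summand ?A M B
        \<and> indecomposable ?A (sub_module M B)} | M.
      tau_rigid ?A M \<and> basic ?A M}"
      using smod_tau_rigid_iff[OF S(1), where 'k = 'k] S smod_summand_classes[OF S(1), where 'k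
          = 'k] by blast
  qed
  ultimately show ?thesis unfolding tau_tilting_complex_def by blast
qed

section \<open>Classes of indecomposable pairs and the complex of pairs\<close>

definition zcls :: "nat \<Rightarrow> 'k::field rep set" where
  "zcls n = iso_class (algebra_A n) (smod n {})"

lemma smod_empty:
  "carrier (smod n {} :: 'k::field rep) = {\<zero>\<^bsub>smod n {}\<^esub>}"
  by (auto simp: smod_def imod_carrier cells_def fun_eq_iff)

lemma zcls_eqI:
  assumes "left_module (algebra_A n) M" "carrier M = {\<zero>\<^bsub>M\<^esub>}"
  shows "iso_class (algebra_A n) M = (zcls n :: 'k::field rep set)"
proof -
  have Z: "left_module (algebra_A n) (smod n {} :: 'k rep)" by (rule smod_left_module) simp
  show ?thesis unfolding zcls_def iso_class_eq_iff[OF assms(1) Z]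
    by (rule trivial_iso[OF assms(1) Z assms(2) smod_empty])
qed

text \<open>The class of a pair is a product of two classes, and such a product determines its
  factors when neither is empty.\<close>

lemma zcls_nonempty: "(zcls n :: 'k::field rep set) \<noteq> {}"
proof -
  have Z: "left_module (algebra_A n) (smod n {} :: 'k rep)" by (rule smod_left_module) simp
  show ?thesis using Z module_iso_refl[OF Z] by (auto simp: zcls_def iso_class_def)
qed

lemma cls_nonempty:
  assumes "s \<in> intervals n"
  shows "(cls n s :: 'k::field rep set) \<noteq> {}"
proof -
  have M: "left_module (algebra_A n) (iv n (fst s) (snd s) :: 'k rep)"
    by (rule iv_left_module[OF assms])
  show ?thesis using M module_iso_refl[OF M] by (auto simp: cls_def iso_class_def)
qed

text \<open>Separates the two kinds of vertices: if a product \<open>cls m s \<times> zcls m\<close>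
  were also of the form \<open>zcls m \<times> cls m t\<close>, the first factors would
  agree.\<close>

lemma cls_neq_zcls:
  assumes "s \<in> intervals n"
  shows "(cls n s :: 'k::field rep set) \<noteq> zcls n"
proof
  let ?M = "iv n (fst s) (snd s) :: 'k rep"
  let ?Z = "smod n {} :: 'k rep"
  have M: "left_module (algebra_A n) ?M" by (rule iv_left_module[OF assms])
  have Z: "left_module (algebra_A n) ?Z" by (rule smod_left_module) simp
  have ind: "indecomposable (algebra_A n) ?M" by (rule iv_indecomposable) (use assms in \<open>auto
      simp: intervals_def\<close>)
  assume "(cls n s :: 'k rep set) = zcls n"
  then have "module_iso (algebra_A n) ?M ?Z" using iso_class_eq_iff[OF M Z]
      by (simp add: cls_def zcls_def)
  then have "indecomposable (algebra_A n) ?Z" using indecomposable_iso[OF M Z] ind by simp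
  then show False using smod_empty[of n, where 'k = 'k] by (simp add: indecomposable_def)
qed

text \<open>An indecomposable pair has a zero component, so the vertices of a simplex are the
  summands of \<open>M\<close> paired with zero together with the summands of \<open>P\<close>
  paired with zero.\<close>

lemma pair_summand_classes:
  fixes n :: nat
  defines "A \<equiv> (algebra_A n :: 'k::field path_alg)"
  assumes M: "left_module A (M :: 'k rep)" and P: "left_module A P"
  shows "{pair_iso_class A (sub_module M B) (sub_module P C) | B C. direct_summand A M B
      \<and> direct_summand A P C \<and>
      indecomposable A (direct_sum (sub_module M B) (sub_module P C))} =
    (\<lambda>X. X \<times> zcls n) ` {iso_class A (sub_module M B) | B. direct_summand A M B
        \<and> indecomposable A (sub_module M B)} \<union>
    (\<lambda>Y. zcls n \<times> Y) ` {iso_class A (sub_module P C) | C. direct_summand A P C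
        \<and> indecomposable A (sub_module P C)}"
    (is "?L = ?R1 \<union> ?R2")
proof -
  have sub: "left_module A (sub_module N B)" if "left_module A N" "direct_summand A N B"
    for N :: "'k rep" and B
    using that submodule_left_module unfolding direct_summand_def direct_decomp_def by blast
  \<comment> \<open>Provides the zero partner: the definition of the complex takes both components
    of a vertex from summands, and the zero submodule is one.\<close>
  have zero: "direct_summand A N {\<zero>\<^bsub>N\<^esub>}" if N: "left_module A N" for N :: "'k rep"
  proof -
    interpret N: left_module A N by (rule N)
    have "direct_decomp A N {\<zero>\<^bsub>N\<^esub>} (carrier N)"
      unfolding direct_decomp_iff[OF N] using N.zero_submodule N.carrier_submodule by auto
    then show ?thesis by (auto simp: direct_summand_def)
  qed
  have zc: "iso_class A (sub_module N B) = zcls n" if "left_module A N" "direct_summand A N B" "B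
      = {\<zero>\<^bsub>N\<^esub>}"
    for N :: "'k rep" and B
    unfolding A_def by (rule zcls_eqI) (use sub[OF that(1,2)] that(3) in \<open>auto simp: A_def\<close>)
  show ?thesis
  proof (intro equalityI subsetI)
    fix x assume "x \<in> ?L"
    then obtain B C where x: "x = iso_class A (sub_module M B) \<times> iso_class A (sub_module P C)"
      and BC: "direct_summand A M B" "direct_summand A P C" "indecomposable A (direct_sum
          (sub_module M B) (sub_module P C))"
      by (auto simp: pair_iso_class_def)
    from BC(3) have "(indecomposable A (sub_module M B) \<and> C = {\<zero>\<^bsub>P\<^esub>}) \<or> (B = {\<zero>\<^bsub>M\<^esub>}
        \<and> indecomposable A (sub_module P C))"
      using indecomposable_direct_sum_iff[OF sub[OF M BC(1)] sub[OF P BC(2)]] by simp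
    then show "x \<in> ?R1 \<union> ?R2" using x BC zc[OF M BC(1)] zc[OF P BC(2)] by blast
  next
    fix x assume "x \<in> ?R1 \<union> ?R2"
    then show "x \<in> ?L"
    proof
      assume "x \<in> ?R1"
      then obtain B where B: "x = iso_class A (sub_module M B) \<times> zcls n" "direct_summand A M B"
          "indecomposable A (sub_module M B)" by blast
      have "indecomposable A (direct_sum (sub_module M B) (sub_module P {\<zero>\<^bsub>P\<^esub>}))"
        using indecomposable_direct_sum_iff[OF sub[OF M B(2)] sub[OF P zero[OF P]]] B(3) by simp
      moreover have "x = pair_iso_class A (sub_module M B) (sub_module P {\<zero>\<^bsub>P\<^esub>})"
        using B(1) zc[OF P zero[OF P]] by (simp add: pair_iso_class_def)
      ultimately show "x \<in> ?L" using B(2) zero[OF P] by blast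
    next
      assume "x \<in> ?R2"
      then obtain C where C: "x = zcls n \<times> iso_class A (sub_module P C)" "direct_summand A P C"
          "indecomposable A (sub_module P C)" by blast
      have "indecomposable A (direct_sum (sub_module M {\<zero>\<^bsub>M\<^esub>}) (sub_module P C))"
        using indecomposable_direct_sum_iff[OF sub[OF M zero[OF M]] sub[OF P C(2)]] C(3) by simp
      moreover have "x = pair_iso_class A (sub_module M {\<zero>\<^bsub>M\<^esub>}) (sub_module P C)"
        using C(1) zc[OF M zero[OF M]] by (simp add: pair_iso_class_def)
      ultimately show "x \<in> ?L" using C(2) zero[OF M] by blast
    qed
  qed
qed

text \<open>
  The interval \<open>(a, b)\<close> of \<open>A\<^bsub>m + 1\<^esub>\<close> that is not maximal corresponds to the module of the same
  interval over \<open>A\<^bsub>m\<^esub>\<close> if it does not reach the last vertex, and to the shifted projective at the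
  vertex \<open>a - 1\<close> if it does.
\<close>

definition pair_cls :: "nat \<Rightarrow> nat \<times> nat \<Rightarrow> ('k::field rep \<times> 'k rep) set" where
  "pair_cls m s = (if snd s \<le> Suc m then cls m s \<times> zcls m else zcls m \<times> cls m (fst s - 1, Suc m))"

abbreviation apex :: "nat \<Rightarrow> nat \<times> nat" where
  "apex m \<equiv> (1, Suc (Suc m))"

definition shifted :: "nat \<Rightarrow> nat \<Rightarrow> nat \<times> nat" where
  "shifted m c = (Suc c, Suc (Suc m))"

text \<open>The intervals that appear on passing from \<open>m\<close> to \<open>Suc m\<close> all
  end at the last possible place. Apart from the apex they start at \<open>2\<close> or later, and
  the start minus one is a vertex of the smaller quiver.\<close>

lemma intervals_split:
  "intervals (Suc m) - {apex m} = intervals m \<union> shifted m ` {1..m}"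
proof (intro equalityI subsetI)
  fix s assume s: "s \<in> intervals (Suc m) - {apex m}"
  obtain a b where ab: "s = (a, b)" by (cases s)
  show "s \<in> intervals m \<union> shifted m ` {1..m}"
  proof (cases "b \<le> Suc m")
    case True
    then show ?thesis using s ab by (auto simp: intervals_def)
  next
    case False
    then have b: "b = Suc (Suc m)" "a \<noteq> 1" "1 \<le> a" "a \<le> Suc m" using s ab
        by (auto simp: intervals_def)
    then have "s = shifted m (a - 1)" "a - 1 \<in> {1..m}" by (auto simp: shifted_def ab)
    then show ?thesis by blast
  qed
qed (auto simp: intervals_def shifted_def)

lemma pair_cls_intervals: "s \<in> intervals m \<Longrightarrow>
    (pair_cls m s :: ('k::field rep \<times> 'k rep) set) = cls m s \<times> zcls m"
  by (auto simp: pair_cls_def intervals_def)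

lemma pair_cls_shifted: "pair_cls m (shifted m c) = zcls m \<times> cls m (c, Suc m)"
  by (simp add: pair_cls_def shifted_def)

lemma pair_cls_image:
  assumes "S \<subseteq> intervals m"
  shows "pair_cls m ` (S \<union> shifted m ` C) =
    (\<lambda>s. cls m s \<times> (zcls m :: 'k::field rep set)) ` S \<union> (\<lambda>c. zcls m \<times> cls m (c, Suc m)) ` C"
proof -
  have "pair_cls m ` S = (\<lambda>s. cls m s \<times> (zcls m :: 'k rep set)) ` S"
    by (rule image_cong[OF refl pair_cls_intervals]) (use assms in auto)
  then show ?thesis by (simp only: image_Un image_image pair_cls_shifted)
qed

lemma pair_cls_inj: "inj_on (pair_cls m :: _ \<Rightarrow> ('k::field rep \<times> _) set) (intervals (Suc m) - {apex
    m})"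
proof (rule inj_onI)
  note ne = zcls_nonempty[of m, where 'k = 'k] cls_nonempty[where n = m and 'k
      = 'k] cls_neq_zcls[where n = m and 'k = 'k]
  have sh: "(c, Suc m) \<in> intervals m" if "c \<in> {1..m}" for c using that by (auto simp: intervals_def)
  fix s t assume "s \<in> intervals (Suc m) - {apex m}" "t \<in> intervals (Suc m) - {apex m}"
    and eq: "(pair_cls m s :: ('k rep \<times> _) set) = pair_cls m t"
  then have st: "s \<in> intervals m \<union> shifted m ` {1..m}" "t \<in> intervals m \<union> shifted m ` {1..m}"
    unfolding intervals_split by blast+
  show "s = t"
  proof (cases "s \<in> intervals m")
    case s: True
    show ?thesis
    proof (cases "t \<in> intervals m")
      case t: True
      then show ?thesis using eq ne s cls_eq_iff[OF s t, where 'k = 'k]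
          by (auto simp: pair_cls_intervals times_eq_iff)
    next
      case False
      then obtain d where "d \<in> {1..m}" "t = shifted m d" using st by blast
      then show ?thesis using eq ne s sh by (auto simp: pair_cls_intervals pair_cls_shifted
          times_eq_iff)
    qed
  next
    case False
    then obtain c where c: "c \<in> {1..m}" "s = shifted m c" using st by blast
    show ?thesis
    proof (cases "t \<in> intervals m")
      case t: True
      then show ?thesis using eq ne c sh by (auto simp: pair_cls_intervals pair_cls_shifted
          times_eq_iff)
    next
      case False
      then obtain d where d: "d \<in> {1..m}" "t = shifted m d" using st by blast
      then show ?thesis using eq ne c sh cls_eq_iff[OF sh[OF c(1)] sh[OF d(1)], where 'k = 'k]
        by (auto simp: pair_cls_shifted times_eq_iff)
    qed
  qed
qed

text \<open>The shift by one in \<open>shifted\<close> turns the crossing condition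
  \<open>fst s < Suc c \<le> snd s\<close> into \<open>fst s \<le> c < snd s\<close>, which says
  that the interval contains the vertex \<open>c\<close>. Two shifted projectives share their right
  end and cannot cross. The apex starts first and ends last, so it crosses nothing.\<close>

lemma noncrossing_split:
  assumes "S \<subseteq> intervals m" "C \<subseteq> {1..m}"
  shows "noncrossing (S \<union> shifted m ` C) \<longleftrightarrow> noncrossing S \<and> (\<forall>s\<in>S. \<forall>c\<in>C. \<not> (fst s \<le> c \<and> c < snd s))"
    "noncrossing (insert (apex m) (S \<union> shifted m ` C)) \<longleftrightarrow> noncrossing (S \<union> shifted m ` C)"
proof -
  have b: "snd s \<le> Suc m" "1 \<le> fst s" if "s \<in> S" for s using that assms(1)
      by (auto simp: intervals_def)
  have "fst s < Suc c \<and> Suc c \<le> snd s \<and> snd s < Suc (Suc m) \<longleftrightarrow> fst s \<le> c \<and> c < snd s" if "s \<in> S"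
      for s c
    using b[OF that] by auto
  moreover have "\<not> Suc (Suc m) < snd s" if "s \<in> S" for s using b[OF that] by simp
  ultimately show "noncrossing (S \<union> shifted m ` C) \<longleftrightarrow> noncrossing S \<and> (\<forall>s\<in>S. \<forall>c\<in>C. \<not> (fst s \<le> c
      \<and> c < snd s))"
    unfolding noncrossing_def shifted_def by (simp add: ball_Un ball_simps) blast
  have T: "1 \<le> fst t \<and> snd t \<le> Suc (Suc m)" if "t \<in> insert (apex m) (S \<union> shifted m ` C)" for t
    using that b[of t] by (auto simp: shifted_def)
  have "\<not> (fst s < fst t \<and> fst t \<le> snd s \<and> snd s < snd t)"
    if "s = apex m \<or> t = apex m" "s \<in> insert (apex m) (S \<union> shifted m ` C)" "t \<in> insert (apex m) (S
        \<union> shifted m ` C)" for s t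
    using T[OF that(2)] T[OF that(3)] that(1) by auto
  then show "noncrossing (insert (apex m) (S \<union> shifted m ` C)) \<longleftrightarrow> noncrossing (S \<union> shifted m ` C)"
    unfolding noncrossing_def by blast
qed

text \<open>A noncrossing family splits into intervals of \<open>m\<close>, which form
  \<open>M\<close>, and shifted projectives, which form \<open>P\<close>. The noncrossing condition
  splits accordingly into rigidity of \<open>M\<close> and the vanishing of homomorphisms from
  \<open>P\<close> to \<open>M\<close>.\<close>

theorem support_tau_tilting_complex_algebra_A:
  "support_tau_tilting_complex (algebra_A m :: 'k::field path_alg) =
    (pair_cls m ` (intervals (Suc m) - {apex m}),
     (\<lambda>S. pair_cls m ` S) ` {S. S \<subseteq> intervals (Suc m) - {apex m} \<and> noncrossing S})"
  (is "support_tau_tilting_complex ?A = _")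
proof -
  let ?V = "{pair_iso_class ?A M P | M P. tau_rigid_pair ?A M P \<and> indecomposable ?A (direct_sum M
      P)}"
  let ?sc = "\<lambda>M P. {pair_iso_class ?A (sub_module M B) (sub_module P C) | B C. direct_summand ?A M
      B \<and> direct_summand ?A P C \<and>
      indecomposable ?A (direct_sum (sub_module M B) (sub_module P C))}"
  let ?Z = "smod m {} :: 'k rep"
  have Z: "left_module ?A ?Z" by (rule smod_left_module) simp
  note Zc = smod_empty[of m, where 'k = 'k]
  have sh: "(c, Suc m) \<in> intervals m" if "c \<in> {1..m}" for c using that by (auto simp: intervals_def)
  have "?V = pair_cls m ` (intervals (Suc m) - {apex m})"
  proof (intro equalityI subsetI)
    fix x assume "x \<in> ?V"
    then obtain M P where x: "x = pair_iso_class ?A M P" "tau_rigid_pair ?A M P" "indecomposable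
        ?A (direct_sum M P)" by blast
    have fgM: "fin_gen_module ?A M" and fgP: "fin_gen_module ?A P" and proj: "projective ?A P"
      using x(2) by (auto simp: tau_rigid_pair_def tau_rigid_def)
    have M: "left_module ?A M" and P: "left_module ?A P" using fgM fgP
        by (auto simp: fin_gen_module_def)
    from x(3) consider "indecomposable ?A M" "carrier P = {\<zero>\<^bsub>P\<^esub>}" | "carrier M = {\<zero>\<^bsub>M\<^esub>}"
        "indecomposable ?A P"
      unfolding indecomposable_direct_sum_iff[OF M P] by blast
    then show "x \<in> pair_cls m ` (intervals (Suc m) - {apex m})"
    proof cases
      case 1
      obtain a b where ab: "1 \<le> a" "a < b" "b \<le> Suc m" "module_iso ?A (iv m a b) M"
        using indecomposable_iso_iv[OF fgM 1(1)] by blast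
      then have s: "(a, b) \<in> intervals m" by (simp add: intervals_def)
      have "iso_class ?A M = cls m (a, b)" using iso_class_eq_iff[OF iv_left_module[OF s] M] ab(4)
          by (simp add: cls_def)
      then have "x = pair_cls m (a, b)" using x(1) zcls_eqI[OF P 1(2)]
          by (simp add: pair_iso_class_def pair_cls_intervals[OF s])
      then show ?thesis unfolding intervals_split using s by blast
    next
      case 2
      obtain a b where ab: "1 \<le> a" "a < b" "b \<le> Suc m" "module_iso ?A (iv m a b) P"
        using indecomposable_iso_iv[OF fgP 2(2)] by blast
      have b: "b = Suc m" using projective_imp_pmod[OF iv_valid[OF ab(1-3)] proj ab(4), of 0]
          by simp
      have s: "(a, Suc m) \<in> intervals m" "a \<in> {1..m}" using ab b by (auto simp: intervals_def)
      have "iso_class ?A P = cls m (a, Suc m)" using iso_class_eq_iff[OF iv_left_module[OF s(1)]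
          P] ab(4) b by (simp add: cls_def)
      then have "x = pair_cls m (shifted m a)" using x(1) zcls_eqI[OF M 2(1)]
          by (simp add: pair_iso_class_def pair_cls_shifted)
      then show ?thesis unfolding intervals_split using s(2) by blast
    qed
  next
    fix x :: "('k rep \<times> 'k rep) set"
    assume "x \<in> pair_cls m ` (intervals (Suc m) - {apex m})"
    then consider s where "s \<in> intervals m" "x = pair_cls m s" | c where "c \<in> {1..m}" "x
        = pair_cls m (shifted m c)"
      unfolding intervals_split by blast
    then show "x \<in> ?V"
    proof cases
      case 1
      let ?M = "iv m (fst s) (snd s) :: 'k rep"
      have M: "left_module ?A ?M" by (rule iv_left_module[OF 1(1)])
      have v0: "ivalid m {} (\<lambda>i. fst (prod_decode i)) (\<lambda>_. Suc m)" by (simp add: ivalid_def)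
      \<comment> \<open>The zero module is an empty sum of projectives, hence a legitimate second
        component.\<close>
      have Zp: "?Z = pmod m {} (\<lambda>i. fst (prod_decode i))" by (simp add: smod_def imod_def cells_def)
      have "indecomposable ?A ?M" using 1(1) by (intro iv_indecomposable) (auto simp: intervals_def)
      then have "indecomposable ?A (direct_sum ?M ?Z)" using indecomposable_direct_sum_iff[OF M Z]
          Zc by simp
      moreover have "hom_vanishes ?A ?Z ?M"
        using module_hom_zero[OF Z M] Zc by (auto simp: hom_vanishes_def)
      moreover have "fin_gen_module ?A ?Z" "projective ?A ?Z"
        unfolding Zp by (rule imod_fin_gen[OF v0], rule pmod_projective[OF v0])
      ultimately have "tau_rigid_pair ?A ?M ?Z \<and> indecomposable ?A (direct_sum ?M ?Z)"
        using iv_tau_rigid[OF 1(1), where 'k = 'k] by (simp add: tau_rigid_pair_def)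
      moreover have "x = pair_iso_class ?A ?M ?Z"
        using 1 by (simp add: pair_iso_class_def pair_cls_intervals cls_def zcls_def)
      ultimately show ?thesis by blast
    next
      case 2
      note s = sh[OF 2(1)]
      let ?P = "iv m c (Suc m) :: 'k rep"
      have vP: "ivalid m {0} (\<lambda>_. c) (\<lambda>_. Suc m)" using 2(1) by (simp add: ivalid_def)
      have P: "left_module ?A ?P" by (rule imod_left_module[OF vP])
      have "indecomposable ?A ?P" using 2(1) by (intro iv_indecomposable) auto
      then have "indecomposable ?A (direct_sum ?Z ?P)" using indecomposable_direct_sum_iff[OF Z P]
          Zc by simp
      moreover have "hom_vanishes ?A ?P ?Z"
        using module_homD(1)[of _ ?A ?P ?Z] Zc by (fastforce simp: hom_vanishes_def)
      moreover have "tau_rigid ?A ?Z" using smod_tau_rigid_iff[of "{}" m, where 'k = 'k]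
          by (simp add: noncrossing_def)
      ultimately have "tau_rigid_pair ?A ?Z ?P \<and> indecomposable ?A (direct_sum ?Z ?P)"
        using imod_fin_gen[OF vP] pmod_projective[OF vP] by (simp add: tau_rigid_pair_def)
      moreover have "x = pair_iso_class ?A ?Z ?P"
        using 2 by (simp add: pair_iso_class_def pair_cls_shifted cls_def zcls_def)
      ultimately show ?thesis by blast
    qed
  qed
  moreover have "{?sc M P | M P. tau_rigid_pair ?A M P \<and> basic ?A (direct_sum M P)} =
    (\<lambda>S. pair_cls m ` S) ` {S. S \<subseteq> intervals (Suc m) - {apex m} \<and> noncrossing S}"
  proof (intro equalityI subsetI)
    fix \<sigma> assume "\<sigma> \<in> {?sc M P | M P. tau_rigid_pair ?A M P \<and> basic ?A (direct_sum M P)}"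
    then obtain M P where \<sigma>: "\<sigma> = ?sc M P" and r: "tau_rigid_pair ?A M P" by blast
    have fgM: "fin_gen_module ?A M" and fgP: "fin_gen_module ?A P" and proj: "projective ?A P"
      and rigid: "tau_rigid ?A M" and van: "hom_vanishes ?A P M"
      using r by (auto simp: tau_rigid_pair_def tau_rigid_def)
    have M: "left_module ?A M" and P: "left_module ?A P" using fgM fgP
        by (auto simp: fin_gen_module_def)
    obtain I a b where D: "ivalid m I a b" "module_iso ?A (imod m I a b) M"
        using fin_gen_decomposition[OF fgM] by blast
    obtain J c d where E: "ivalid m J c d" "module_iso ?A (imod m J c d) P"
        using fin_gen_decomposition[OF fgP] by blast
    \<comment> \<open>Projectivity of \<open>P\<close> forces every interval in its decomposition to
      reach the end.\<close>
    have d: "d j = Suc m" if "j \<in> J" for j by (rule projective_imp_pmod[OF E(1) proj E(2) that])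
    have eq: "imod m J c d = pmod m J c" using d by (simp add: imod_def cells_def cong: conj_cong)
    have E': "ivalid m J c (\<lambda>_. Suc m)" "module_iso ?A (pmod m J c) P"
      using pmod_valid[OF E(1)] E(2) unfolding eq by simp_all
    let ?S = "(\<lambda>i. (a i, b i)) ` I"
    note di = decomposition_intervals[OF D(1) M D(2)] and dj = decomposition_intervals[OF E'(1) P
        E'(2)]
    have C: "c ` J \<subseteq> {1..m}" using E'(1) by (auto simp: ivalid_def)
    have "\<sigma> = (\<lambda>s. cls m s \<times> zcls m) ` ?S \<union> (\<lambda>c. zcls m \<times> cls m (c, Suc m)) ` c ` J"
      unfolding \<sigma> pair_summand_classes[OF M P] di(2) dj(2) by (simp add: image_image)
    also have "\<dots> = pair_cls m ` (?S \<union> shifted m ` c ` J)"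
      by (rule pair_cls_image[OF di(1), symmetric])
    finally have "\<sigma> = pair_cls m ` (?S \<union> shifted m ` c ` J)" .
    moreover have "?S \<union> shifted m ` c ` J \<subseteq> intervals (Suc m) - {apex m}"
      unfolding intervals_split using di(1) C by blast
    moreover have "noncrossing (?S \<union> shifted m ` c ` J)"
      unfolding noncrossing_split(1)[OF di(1) C]
      using di(3) rigid van hom_vanishes_pmod_iff[OF D(1) E'(1) M P D(2) E'(2)] by auto
    ultimately show "\<sigma> \<in> (\<lambda>S. pair_cls m ` S) ` {S. S \<subseteq> intervals (Suc m) - {apex m}
        \<and> noncrossing S}" by blast
  next
    fix \<sigma> :: "('k rep \<times> 'k rep) set set"
    assume "\<sigma> \<in> (\<lambda>S. pair_cls m ` S) ` {S. S \<subseteq> intervals (Suc m) - {apex m} \<and> noncrossing S}"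
    then obtain U where U: "U \<subseteq> intervals m \<union> shifted m ` {1..m}" "noncrossing U" "\<sigma>
        = pair_cls m ` U"
      unfolding intervals_split by blast
    define S where "S = U \<inter> intervals m"
    define C where "C = {c \<in> {1..m}. shifted m c \<in> U}"
    have US: "U = S \<union> shifted m ` C" using U(1) by (auto simp: S_def C_def)
    have S: "S \<subseteq> intervals m" and C: "C \<subseteq> {1..m}" by (auto simp: S_def C_def)
    have nc: "noncrossing S" "\<And>s c. s \<in> S \<Longrightarrow> c \<in> C \<Longrightarrow> \<not> (fst s \<le> c \<and> c < snd s)"
      using U(2) unfolding US noncrossing_split(1)[OF S C] by auto
    define C' where "C' = (\<lambda>c. (c, Suc m)) ` C"
    have C': "C' \<subseteq> intervals m" using C sh by (auto simp: C'_def)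
    \<comment> \<open>An interval common to both parts would contain its own starting vertex
      \<open>c\<close>, against the vanishing condition for \<open>c\<close>. Disjointness allows
      the two index sets to be merged, and all intervals of the sum are then distinct.\<close>
    have disj: "S \<inter> C' = {}"
    proof (rule ccontr)
      assume "S \<inter> C' \<noteq> {}"
      then obtain c where c: "c \<in> C" "(c, Suc m) \<in> S" by (auto simp: C'_def)
      show False using nc(2)[OF c(2,1)] c(1) C by auto
    qed
    let ?M = "smod m S :: 'k rep" and ?P = "smod m C' :: 'k rep"
    have M: "left_module ?A ?M" and P: "left_module ?A ?P" by (rule smod_left_module[OF S]
        smod_left_module[OF C'])+
    let ?a = "\<lambda>i. fst (prod_decode i)" and ?b = "\<lambda>i. snd (prod_decode i)"
    \<comment> \<open>All intervals in \<open>C'\<close> end at \<open>m + 1\<close>, so their sum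
      is a sum of projectives.\<close>
    have Pp: "?P = pmod m (prod_encode ` C') ?a"
    proof -
      have "cells (prod_encode ` C') ?a ?b = cells (prod_encode ` C') ?a (\<lambda>_. Suc m)"
        by (auto simp: cells_def C'_def)
      then show ?thesis by (simp add: smod_def imod_def)
    qed
    note vM = smod_valid[OF S] and vP = pmod_valid[OF smod_valid[OF C']]
    have "tau_rigid ?A ?M" using smod_tau_rigid_iff[OF S, where 'k = 'k] nc(1) by simp
    moreover have "hom_vanishes ?A ?P ?M"
    proof (subst hom_vanishes_pmod_iff[OF vM vP M P])
      show "module_iso ?A (imod m (prod_encode ` S) ?a ?b) ?M" using module_iso_refl[OF M]
          by (simp add: smod_def)
      show "module_iso ?A (pmod m (prod_encode ` C') ?a) ?P" using module_iso_refl[OF P]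
          by (simp only: Pp)
      show "\<forall>i\<in>prod_encode ` S. \<forall>j\<in>prod_encode ` C'. \<not> (?a i \<le> ?a j \<and> ?a j < ?b i)"
        using nc(2) by (auto simp: C'_def)
    qed
    moreover have "fin_gen_module ?A ?P" "projective ?A ?P"
      unfolding Pp by (rule imod_fin_gen[OF vP], rule pmod_projective[OF vP])
    moreover have "basic ?A (direct_sum ?M ?P)"
    proof (rule basic_distinct)
      have e: "prod_encode ` (S \<union> C') = prod_encode ` S \<union> prod_encode ` C'" by (rule image_Un)
      show v: "ivalid m (prod_encode ` S \<union> prod_encode ` C') ?a ?b"
        using smod_valid[of "S \<union> C'" m] S C' unfolding e by simp
      show "left_module ?A (direct_sum ?M ?P)" by (rule direct_sum_left_module[OF M P])
      show "module_iso ?A (imod m (prod_encode ` S \<union> prod_encode ` C') ?a ?b) (direct_sum ?M ?P)"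
        unfolding smod_def by (rule imod_sum_iso[OF v]) (use disj in auto)
    qed (auto simp: prod_eq_iff)
    ultimately have "tau_rigid_pair ?A ?M ?P \<and> basic ?A (direct_sum ?M ?P)"
        by (simp add: tau_rigid_pair_def)
    moreover have "\<sigma> = ?sc ?M ?P"
    proof -
      have "?sc ?M ?P = (\<lambda>s. cls m s \<times> zcls m) ` S \<union> (\<lambda>c. zcls m \<times> cls m (c, Suc m)) ` C"
        unfolding pair_summand_classes[OF M P] smod_summand_classes[OF S] smod_summand_classes[OF
            C']
        by (simp add: image_image C'_def)
      also have "\<dots> = pair_cls m ` (S \<union> shifted m ` C)" by (rule pair_cls_image[OF S, symmetric])
      finally show ?thesis using U(3) US by simp
    qed
    ultimately show "\<sigma> \<in> {?sc M P | M P. tau_rigid_pair ?A M P \<and> basic ?A (direct_sum M P)}"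
        by blast
  qed
  ultimately show ?thesis unfolding support_tau_tilting_complex_def by blast
qed

text \<open>Puts the cone into the form already found for the complex of rigid modules: the image of
  the noncrossing families under a labelling of the intervals, here with the apex labelled by the
  new vertex. Adding or deleting the apex preserves noncrossing families, which is the cone
  condition.\<close>

lemma cone_support_tau_tilting_complex:
  fixes m :: nat
  defines "w \<equiv> (\<lambda>s. if s = apex m then None else Some (pair_cls m s :: ('k::field rep \<times> 'k rep)
      set))"
  shows "sc_cone (support_tau_tilting_complex (algebra_A m :: 'k path_alg)) =
    (w ` intervals (Suc m), (\<lambda>S. w ` S) ` {S. S \<subseteq> intervals (Suc m) \<and> noncrossing S})"
proof -
  let ?V = "intervals (Suc m) - {apex m}"
  let ?pc = "pair_cls m :: _ \<Rightarrow> ('k rep \<times> 'k rep) set"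
  have apex: "apex m \<in> intervals (Suc m)" by (simp add: intervals_def)
  have wS: "w ` S = Some ` ?pc ` S" if "S \<subseteq> ?V" for S
    unfolding image_image by (rule image_cong[OF refl]) (use that in \<open>auto simp: w_def\<close>)
  have wapex: "w (apex m) = None" by (simp add: w_def)
  have nc: "noncrossing (insert (apex m) S) \<longleftrightarrow> noncrossing S" if S: "S \<subseteq> ?V" for S
  proof -
    define C where "C = {c \<in> {1..m}. shifted m c \<in> S}"
    have "S = (S \<inter> intervals m) \<union> shifted m ` C" using S unfolding intervals_split
        by (auto simp: C_def)
    moreover have "C \<subseteq> {1..m}" by (auto simp: C_def)
    ultimately show ?thesis using noncrossing_split(2)[of "S \<inter> intervals m" m C] by auto
  qed
  have "insert None (Some ` ?pc ` ?V) = w ` intervals (Suc m)"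
  proof -
    have "intervals (Suc m) = insert (apex m) ?V" using apex by auto
    then have "w ` intervals (Suc m) = insert (w (apex m)) (w ` ?V)" by (metis image_insert)
    then show ?thesis using wS[of ?V] wapex by simp
  qed
  moreover have "(\<lambda>\<sigma>. Some ` \<sigma>) ` (\<lambda>S. ?pc ` S) ` {S. S \<subseteq> ?V \<and> noncrossing S} \<union>
      (\<lambda>\<sigma>. insert None (Some ` \<sigma>)) ` (\<lambda>S. ?pc ` S) ` {S. S \<subseteq> ?V \<and> noncrossing S}
    = (\<lambda>S. w ` S) ` {S. S \<subseteq> intervals (Suc m) \<and> noncrossing S}"
  proof (intro equalityI subsetI)
    fix \<tau> assume "\<tau> \<in> (\<lambda>\<sigma>. Some ` \<sigma>) ` (\<lambda>S. ?pc ` S) ` {S. S \<subseteq> ?V \<and> noncrossing S} \<union>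
      (\<lambda>\<sigma>. insert None (Some ` \<sigma>)) ` (\<lambda>S. ?pc ` S) ` {S. S \<subseteq> ?V \<and> noncrossing S}"
    then obtain S where S: "S \<subseteq> ?V" "noncrossing S" "\<tau> = Some ` ?pc ` S \<or> \<tau>
        = insert None (Some ` ?pc ` S)" by blast
    then have "\<tau> = w ` S \<or> \<tau> = w ` insert (apex m) S" using wS[OF S(1)] wapex by auto
    moreover have "insert (apex m) S \<subseteq> intervals (Suc m)" "S \<subseteq> intervals (Suc m)" using S(1) apex
        by auto
    ultimately show "\<tau> \<in> (\<lambda>S. w ` S) ` {S. S \<subseteq> intervals (Suc m) \<and> noncrossing S}"
      using S(2) nc[OF S(1)] by blast
  next
    fix \<tau> assume "\<tau> \<in> (\<lambda>S. w ` S) ` {S. S \<subseteq> intervals (Suc m) \<and> noncrossing S}"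
    then obtain S where S: "S \<subseteq> intervals (Suc m)" "noncrossing S" "\<tau> = w ` S" by blast
    define S' where "S' = S - {apex m}"
    have S': "S' \<subseteq> ?V" using S(1) by (auto simp: S'_def)
    have "noncrossing S'" using S(2) by (auto simp: noncrossing_def S'_def)
    moreover have "\<tau> = Some ` ?pc ` S' \<or> \<tau> = insert None (Some ` ?pc ` S')"
    proof (cases "apex m \<in> S")
      case True
      then have "S = insert (apex m) S'" by (auto simp: S'_def)
      then have "\<tau> = insert (w (apex m)) (w ` S')" unfolding S(3) by (metis image_insert)
      then show ?thesis using wS[OF S'] wapex by simp
    next
      case False
      then have "S = S'" by (auto simp: S'_def)
      then show ?thesis using wS[OF S'] S(3) by simp
    qed
    ultimately show "\<tau> \<in> (\<lambda>\<sigma>. Some ` \<sigma>) ` (\<lambda>S. ?pc ` S) ` {S. S \<subseteq> ?V \<and> noncrossing S} \<union>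
      (\<lambda>\<sigma>. insert None (Some ` \<sigma>)) ` (\<lambda>S. ?pc ` S) ` {S. S \<subseteq> ?V \<and> noncrossing S}"
      using S' by blast
  qed
  ultimately show ?thesis unfolding sc_cone_def support_tau_tilting_complex_algebra_A fst_conv
      snd_conv by simp
qed

text \<open>Two injective labellings of the vertices of one abstract complex give isomorphic
  complexes, through the inverse of one followed by the other.\<close>

lemma sc_isomorphicI:
  assumes "inj_on v V" "inj_on w V" "\<And>S. S \<in> F \<Longrightarrow> S \<subseteq> V"
  shows "sc_isomorphic (v ` V, (\<lambda>S. v ` S) ` F) (w ` V, (\<lambda>S. w ` S) ` F)"
  unfolding sc_isomorphic_def fst_conv snd_conv
proof (intro exI conjI)
  let ?f = "\<lambda>x. w (inv_into V v x)"
  have f: "?f (v s) = w s" if "s \<in> V" for s using that assms(1) by simp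
  have "inj_on ?f (v ` V)"
    using assms(2) f by (auto simp: inj_on_def)
  moreover have im: "?f ` v ` S = w ` S" if "S \<subseteq> V" for S
    unfolding image_image by (rule image_cong) (use f that in auto)
  ultimately show "bij_betw ?f (v ` V) (w ` V)" by (simp add: bij_betw_def)
  show "(\<lambda>\<sigma>. ?f ` \<sigma>) ` (\<lambda>S. v ` S) ` F = (\<lambda>S. w ` S) ` F"
    unfolding image_image[of _ "\<lambda>S. v ` S"] by (rule image_cong) (use im assms(3) in auto)
qed

theorem corollary6p11:
  fixes n :: nat
  assumes "n \<ge> 1"
  shows "sc_isomorphic
    (tau_tilting_complex (algebra_A n :: ('k::alg_closed_field, (nat, nat) path \<Rightarrow> 'k) module))
    (sc_cone (support_tau_tilting_complex
      (algebra_A (n - 1) :: ('k, (nat, nat) path \<Rightarrow> 'k) module)))"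
proof -
  \<comment> \<open>The case \<open>n = 1\<close> is included as \<open>m = 0\<close>: then there
    are no intervals for \<open>m\<close>, the base of the cone has only the empty simplex, and the
    apex is the single interval for \<open>Suc m\<close>.\<close>
  obtain m where n: "n = Suc m" using assms by (cases n) auto
  show ?thesis
    unfolding n diff_Suc_1 tau_tilting_complex_algebra_A cone_support_tau_tilting_complex
  proof (rule sc_isomorphicI)
    show "inj_on (cls (Suc m) :: _ \<Rightarrow> 'k rep set) (intervals (Suc m))"
      by (rule inj_onI) (simp add: cls_eq_iff)
    show "inj_on (\<lambda>s. if s = apex m then None else Some (pair_cls m s :: ('k rep \<times> 'k rep) set))
        (intervals (Suc m))"
      (is "inj_on ?w _")
    proof (rule inj_onI)
      fix s t assume st: "s \<in> intervals (Suc m)" "t \<in> intervals (Suc m)" and eq: "?w s = ?w t"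
      show "s = t"
      proof (cases "s = apex m \<or> t = apex m")
        case True
        then show ?thesis using eq by (metis option.distinct(1))
      next
        case False
        then have "(pair_cls m s :: ('k rep \<times> 'k rep) set) = pair_cls m t"
          using eq by (simp only: if_False option.inject de_Morgan_disj)
        then show ?thesis using inj_onD[OF pair_cls_inj] st False by blast
      qed
    qed
  qed blast
qed

end
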